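(* Let $(M^7,g,\omega^3,\nabla)$ be a $G_2$-manifold of type $\Lambda^0_1\oplus\Lambda^1_7\oplus\Lambda^3_{27}$ together with its unique connection $\nabla$ with totally skew-symmetric torsion $T$ preserving the $G_2$-structure. Let $\lambda$ and $\beta$ be the associated function and vector field (see context). Then the Ricci tensor $\mathrm{Ric}^\nabla$ is given by $$\mathrm{Ric}^\nabla(X)=\frac12\sum_{i=1}^7\big(X\lrcorner dT+2\,\nabla_XT,\ e_i\lrcorner*\omega^3\big)\,e_i.$$ $T$ is a solution of the equation $$\mathrm{Ric}^g_{ij}-\frac14T_{imn}T_{jmn}-\frac12\big(e_i\lrcorner dT+2\,\nabla_{e_i}T,\ e_j\lrcorner*\omega^3\big)-\frac12\,\delta^g(T)_{ij}=0,$$ and satisfies, for any vector $X$, the condition $(X\lrcorner dT,\omega^3)=-2\,(\nabla_XT,\omega^3)$. There exists a (non-zero) $\nabla$-parallel spinor field $\Psi_0$ such that the $3$-form $\omega^3$ and the Riemannian Dirac operator $D^g$ act on it by $$\omega^3\cdot\Psi_0=-7\,\Psi_0,\qquad D^g(\Psi_0)=-\frac34\,T\cdot\Psi_0=-\frac78\,\lambda\,\Psi_0+\frac3{16}\,(\beta\lrcorner*\omega^3)\cdot\Psi_0.$$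
   Context: On $\mathbb R^7$ let $\omega^3=e_{127}+e_{135}-e_{146}-e_{236}-e_{245}+e_{347}+e_{567}$, $e_{ijk}=e_i\wedge e_j\wedge e_k$. A $G_2$-structure on an oriented Riemannian $7$-manifold $(M^7,g)$ is a $3$-form $\omega^3$ having this form in suitable local oriented orthonormal frames $e_1,\dots,e_7$ (vectors and covectors identified by $g$). $(\cdot,\cdot)$ is the inner product on forms for which the $e_{i_1}\wedge\dots\wedge e_{i_p}$, $i_1<\dots<i_p$, are orthonormal; $*$ is the Hodge star for the orientation $e_1\wedge\dots\wedge e_7$; $\nabla^g$ is the Levi-Civita connection; $\delta^g\alpha=-\sum e_i\lrcorner\nabla^g_{e_i}\alpha$. Let $\Lambda^3_{27}=\{\alpha\in\Lambda^3:\alpha\wedge\omega^3=0,\ \alpha\wedge*\omega^3=0\}$. Type $\Lambda^0_1\oplus\Lambda^1_7\oplus\Lambda^3_{27}$ means that there are a (unique) function $\lambda$, vector field $\beta$ and section $\Gamma^3_{27}$ of $\Lambda^3_{27}$ with $$\nabla^g_X\omega^3=-\frac\lambda4(X\lrcorner*\omega^3)-\sum_{i=1}^7\Big(\frac14\beta\wedge X+\frac12X\lrcorner\Gamma^3_{27},\,e_i\lrcorner\omega^3\Big)(e_i\lrcorner*\omega^3)\quad\text{for all }X.$$ For such structures there is a unique affine connection $\nabla$ with $\nabla\omega^3=0$ whose torsion $T(X,Y,Z)=g(\nabla_XY-\nabla_YX-[X,Y],Z)$ is a $3$-form; it satisfies $g(\nabla_XY,Z)=g(\nabla^g_XY,Z)+\frac12T(X,Y,Z)$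 and $T=-\frac\lambda6\omega^3-\Gamma^3_{27}-\frac14(\beta\lrcorner*\omega^3)$. With $R^\nabla(X,Y,Z,V)=g(R^\nabla(X,Y)Z,V)$, where $R^\nabla(X,Y)=[\nabla_X,\nabla_Y]-\nabla_{[X,Y]}$: $\mathrm{Ric}^\nabla(X,Y)=\sum_iR^\nabla(e_i,X,Y,e_i)$ and $\mathrm{Ric}^\nabla(X)=\sum_i\mathrm{Ric}^\nabla(X,e_i)e_i$. $\mathrm{Ric}^g$ is the Riemannian Ricci tensor; repeated indices $m,n$ are summed. Spinors are taken with respect to the spin structure induced by the $G_2$-structure; Clifford multiplication satisfies $X\cdot X=-g(X,X)$, $e_{i_1}\wedge\dots\wedge e_{i_p}$ (distinct indices) acts as $e_{i_1}\cdots e_{i_p}$, and the spin representation is chosen so that $e_1\cdots e_7$ acts as the identity (then $-7$ is an eigenvalue of $\omega^3$ of multiplicity one). $D^g\Psi=\sum e_i\cdot\nabla^g_{e_i}\Psi$. *)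

theory Defs
  imports "HOL-Analysis.Analysis"
begin

section \<open>Smooth maps and smooth manifolds\<close>

primrec Ck_on :: "nat \<Rightarrow> (real^'n) set \<Rightarrow> (real^'n \<Rightarrow> 'b::real_normed_vector) \<Rightarrow> bool" where
  "Ck_on 0 S f \<longleftrightarrow> continuous_on S f"
| "Ck_on (Suc k) S f \<longleftrightarrow>
     (\<forall>x\<in>S. f differentiable (at x)) \<and> (\<forall>v. Ck_on k S (\<lambda>x. frechet_derivative f (at x) v))"

definition smooth_on :: "(real^'n) set \<Rightarrow> (real^'n \<Rightarrow> 'b::real_normed_vector) \<Rightarrow> bool" where
  "smooth_on S f \<longleftrightarrow> (\<forall>k. Ck_on k S f)"

type_synonym ('m, 'n) chart = "'m set \<times> ('m \<Rightarrow> real^'n)"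

abbreviation chart_inv :: "('m, 'n) chart \<Rightarrow> real^'n \<Rightarrow> 'm" where
  "chart_inv c \<equiv> inv_into (fst c) (snd c)"

definition jac :: "('m, 'n::finite) chart \<Rightarrow> ('m, 'n) chart \<Rightarrow> 'm \<Rightarrow> real^'n \<Rightarrow> real^'n" where
  "jac c d p = frechet_derivative (snd d \<circ> chart_inv c) (at (snd c p))"

text \<open>The manifold is the whole (Hausdorff, second countable) type; \<open>A\<close> is an oriented smooth atlas.\<close>

definition oriented_manifold ::
  "('m::{t2_space, second_countable_topology}, 'n::finite) chart set \<Rightarrow> bool" where
  "oriented_manifold A \<longleftrightarrow>
     (\<Union>c\<in>A. fst c) = UNIV \<and>
     (\<forall>c\<in>A. open (fst c) \<and> open (snd c ` fst c) \<and>
        homeomorphism (fst c) (snd c ` fst c) (snd c) (chart_inv c)) \<and>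
     (\<forall>c\<in>A. \<forall>d\<in>A. smooth_on (snd c ` (fst c \<inter> fst d)) (snd d \<circ> chart_inv c) \<and>
        (\<forall>p\<in>fst c \<inter> fst d. det (matrix (jac c d p)) > 0))"

text \<open>
  A tangent vector at \<open>p\<close> is represented by its components in one fixed chart \<open>chart_at A p\<close>
  around \<open>p\<close>. Its components in another chart \<open>c\<close> are obtained by the Jacobian of the
  transition map. Thus all tensors at \<open>p\<close> are tensors on the vector space \<open>real^'n\<close>, but
  derivatives and smoothness of fields have to be taken after passing to the components in
  one chart.
\<close>

definition chart_at :: "('m, 'n::finite) chart set \<Rightarrow> 'm \<Rightarrow> ('m, 'n) chart" where
  "chart_at A p = (SOME c. c \<in> A \<and> p \<in> fst c)"

abbreviation to_chart ::
  "('m, 'n::finite) chart set \<Rightarrow> ('m, 'n) chart \<Rightarrow> 'm \<Rightarrow> real^'n \<Rightarrow> real^'n" where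
  "to_chart A c q \<equiv> jac (chart_at A q) c q"

abbreviation from_chart ::
  "('m, 'n::finite) chart set \<Rightarrow> ('m, 'n) chart \<Rightarrow> 'm \<Rightarrow> real^'n \<Rightarrow> real^'n" where
  "from_chart A c q \<equiv> jac c (chart_at A q) q"

definition smooth_fun ::
  "('m, 'n::finite) chart set \<Rightarrow> 'm set \<Rightarrow> ('m \<Rightarrow> 'b::real_normed_vector) \<Rightarrow> bool" where
  "smooth_fun A U f \<longleftrightarrow> (\<forall>c\<in>A. smooth_on (snd c ` (U \<inter> fst c)) (f \<circ> chart_inv c))"

definition smooth_vf :: "('m, 'n::finite) chart set \<Rightarrow> 'm set \<Rightarrow> ('m \<Rightarrow> real^'n) \<Rightarrow> bool" where
  "smooth_vf A U X \<longleftrightarrow>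
     (\<forall>c\<in>A. smooth_on (snd c ` (U \<inter> fst c)) ((\<lambda>q. to_chart A c q (X q)) \<circ> chart_inv c))"

definition dir_deriv ::
  "('m, 'n::finite) chart set \<Rightarrow> 'm \<Rightarrow> real^'n \<Rightarrow> ('m \<Rightarrow> 'b::real_normed_vector) \<Rightarrow> 'b" where
  "dir_deriv A p v f =
     frechet_derivative (f \<circ> chart_inv (chart_at A p)) (at (snd (chart_at A p) p)) v"

definition lie_bracket ::
  "('m, 'n::finite) chart set \<Rightarrow> ('m \<Rightarrow> real^'n) \<Rightarrow> ('m \<Rightarrow> real^'n) \<Rightarrow> 'm \<Rightarrow> real^'n" where
  "lie_bracket A X Y p =
     dir_deriv A p (X p) (\<lambda>q. to_chart A (chart_at A p) q (Y q)) -
     dir_deriv A p (Y p) (\<lambda>q. to_chart A (chart_at A p) q (X q))"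

text \<open>The extension of a tangent vector \<open>v\<close> at \<open>p\<close> to the vector field with constant components
  in \<open>chart_at A p\<close>. Such fields commute. They are used to evaluate tensorial expressions.\<close>

definition const_ext ::
  "('m, 'n::finite) chart set \<Rightarrow> 'm \<Rightarrow> real^'n \<Rightarrow> 'm \<Rightarrow> real^'n" where
  "const_ext A p v q = from_chart A (chart_at A p) q v"


section \<open>Exterior algebra\<close>

text \<open>A \<open>k\<close>-form on a vector space is a function on argument lists; only its values on lists of
  length \<open>k\<close> matter.\<close>

type_synonym 'v form = "'v list \<Rightarrow> real"

definition is_form :: "nat \<Rightarrow> 'v::real_vector form \<Rightarrow> bool" where
  "is_form k \<alpha> \<longleftrightarrow>
     (\<forall>vs i. length vs = k \<and> i < k \<longrightarrow> linear (\<lambda>v. \<alpha> (vs[i := v]))) \<and>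
     (\<forall>vs i j. length vs = k \<and> i < j \<and> j < k \<and> vs ! i = vs ! j \<longrightarrow> \<alpha> vs = 0)"

definition contract :: "'v \<Rightarrow> 'v form \<Rightarrow> 'v form" where
  "contract X \<alpha> = (\<lambda>vs. \<alpha> (X # vs))"

text \<open>The wedge product of a \<open>k\<close>-form with a form, as a sum over shuffles: \<open>S\<close> is the set of
  positions of the arguments of \<open>\<alpha>\<close>, and the exponent counts the inversions of the shuffle.\<close>

definition wedge :: "nat \<Rightarrow> 'v form \<Rightarrow> 'v form \<Rightarrow> 'v form" where
  "wedge k \<alpha> \<beta> = (\<lambda>vs. \<Sum>S | S \<subseteq> {..<length vs} \<and> card S = k.
     (- 1) ^ card {(i, j). i \<in> S \<and> j \<in> {..<length vs} - S \<and> j < i} *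
     \<alpha> (nths vs S) * \<beta> (nths vs (- S)))"

definition flat :: "('v \<Rightarrow> 'v \<Rightarrow> real) \<Rightarrow> 'v \<Rightarrow> 'v form" where
  "flat g v = (\<lambda>vs. g v (hd vs))"

text \<open>\<open>ewedge g e [i, j, \<dots>]\<close> is \<open>e i \<and> e j \<and> \<dots>\<close>, vectors being identified with covectors by \<open>g\<close>.\<close>

primrec ewedge :: "('v \<Rightarrow> 'v \<Rightarrow> real) \<Rightarrow> (nat \<Rightarrow> 'v) \<Rightarrow> nat list \<Rightarrow> 'v form" where
  "ewedge g e [] = (\<lambda>_. 1)"
| "ewedge g e (i # I) = wedge 1 (flat g (e i)) (ewedge g e I)"

definition incr :: "nat \<Rightarrow> nat list set" where
  "incr k = {I. length I = k \<and> sorted_wrt (<) I \<and> set I \<subseteq> {1..7}}"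

text \<open>Frames of seven-dimensional spaces are indexed by \<open>{1..7}\<close>; other indices are irrelevant.
  Below, \<open>e\<close> is (oriented) orthonormal, and then neither the inner product nor the Hodge
  star depends on the choice of \<open>e\<close>.\<close>

definition form_inner :: "nat \<Rightarrow> (nat \<Rightarrow> 'v) \<Rightarrow> 'v form \<Rightarrow> 'v form \<Rightarrow> real" where
  "form_inner k e \<alpha> \<beta> = (\<Sum>I\<in>incr k. \<alpha> (map e I) * \<beta> (map e I))"

text \<open>On basis forms: \<open>* e\<^sub>I = \<plusminus> e\<^sub>J\<close> with \<open>J\<close> complementary to \<open>I\<close> and
  \<open>e\<^sub>I \<and> * e\<^sub>I = e\<^sub>1 \<and> \<dots> \<and> e\<^sub>7\<close>.\<close>

definition hodge :: "('v \<Rightarrow> 'v \<Rightarrow> real) \<Rightarrow> (nat \<Rightarrow> 'v) \<Rightarrow> nat \<Rightarrow> 'v form \<Rightarrow> 'v form" where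
  "hodge g e k \<alpha> = (\<lambda>vs. \<Sum>I\<in>incr k. \<alpha> (map e I) * ewedge g e [1..<8] (map e I @ vs))"

definition phi :: "('v \<Rightarrow> 'v \<Rightarrow> real) \<Rightarrow> (nat \<Rightarrow> 'v) \<Rightarrow> 'v form" where
  "phi g e = (\<lambda>vs. ewedge g e [1,2,7] vs + ewedge g e [1,3,5] vs - ewedge g e [1,4,6] vs
     - ewedge g e [2,3,6] vs - ewedge g e [2,4,5] vs + ewedge g e [3,4,7] vs
     + ewedge g e [5,6,7] vs)"


section \<open>Riemannian metrics, connections and tensor calculus\<close>

definition inner_product :: "('v::real_vector \<Rightarrow> 'v \<Rightarrow> real) \<Rightarrow> bool" where
  "inner_product b \<longleftrightarrow> bilinear b \<and> (\<forall>x y. b x y = b y x) \<and> (\<forall>x. x \<noteq> 0 \<longrightarrow> b x x > 0)"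

definition riemannian_metric ::
  "('m, 'n::finite) chart set \<Rightarrow> ('m \<Rightarrow> real^'n \<Rightarrow> real^'n \<Rightarrow> real) \<Rightarrow> bool" where
  "riemannian_metric A g \<longleftrightarrow>
     (\<forall>p. inner_product (g p)) \<and>
     (\<forall>c\<in>A. \<forall>v w. smooth_on (snd c ` fst c)
        ((\<lambda>q. g q (from_chart A c q v) (from_chart A c q w)) \<circ> chart_inv c))"

definition smooth_form ::
  "('m, 'n::finite) chart set \<Rightarrow> nat \<Rightarrow> ('m \<Rightarrow> (real^'n) form) \<Rightarrow> bool" where
  "smooth_form A k \<alpha> \<longleftrightarrow>
     (\<forall>p. is_form k (\<alpha> p)) \<and>
     (\<forall>c\<in>A. \<forall>vs. length vs = k \<longrightarrow> smooth_on (snd c ` fst c)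
        ((\<lambda>q. \<alpha> q (map (from_chart A c q) vs)) \<circ> chart_inv c))"

text \<open>\<open>D p v Y\<close> is the covariant derivative at \<open>p\<close>, in the direction of the tangent vector \<open>v\<close>, of
  a vector field \<open>Y\<close> that is smooth near \<open>p\<close>.\<close>

type_synonym ('m, 'n) cov_deriv = "'m \<Rightarrow> real^'n \<Rightarrow> ('m \<Rightarrow> real^'n) \<Rightarrow> real^'n"

definition affine_connection ::
  "('m::topological_space, 'n::finite) chart set \<Rightarrow> ('m, 'n) cov_deriv \<Rightarrow> bool" where
  "affine_connection A D \<longleftrightarrow>
     (\<forall>U Y Z f. open U \<and> smooth_vf A U Y \<and> smooth_vf A U Z \<and> smooth_fun A U f \<longrightarrow>
        (\<forall>p\<in>U. linear (\<lambda>v. D p v Y) \<and>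
           (\<forall>v. D p v (\<lambda>q. Y q + Z q) = D p v Y + D p v Z \<and>
                D p v (\<lambda>q. f q *\<^sub>R Y q) = dir_deriv A p v f *\<^sub>R Y p + f p *\<^sub>R D p v Y)) \<and>
        smooth_vf A U (\<lambda>q. D q (Z q) Y))"

definition levi_civita ::
  "('m::topological_space, 'n::finite) chart set \<Rightarrow> ('m \<Rightarrow> real^'n \<Rightarrow> real^'n \<Rightarrow> real)
     \<Rightarrow> ('m, 'n) cov_deriv \<Rightarrow> bool" where
  "levi_civita A g D \<longleftrightarrow> affine_connection A D \<and>
     (\<forall>U X Y. open U \<and> smooth_vf A U X \<and> smooth_vf A U Y \<longrightarrow>
        (\<forall>p\<in>U. D p (X p) Y - D p (Y p) X = lie_bracket A X Y p \<and>
           (\<forall>v. dir_deriv A p v (\<lambda>q. g q (X q) (Y q)) = g p (D p v X) (Y p) + g p (X p) (D p v Y))))"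

definition torsion_form ::
  "('m, 'n::finite) chart set \<Rightarrow> ('m \<Rightarrow> real^'n \<Rightarrow> real^'n \<Rightarrow> real) \<Rightarrow> ('m, 'n) cov_deriv
     \<Rightarrow> 'm \<Rightarrow> (real^'n) form" where
  "torsion_form A g D p vs = (let X = const_ext A p (vs ! 0); Y = const_ext A p (vs ! 1) in
     g p (D p (X p) Y - D p (Y p) X - lie_bracket A X Y p) (vs ! 2))"

definition cov_form ::
  "('m, 'n::finite) chart set \<Rightarrow> ('m, 'n) cov_deriv \<Rightarrow> ('m \<Rightarrow> (real^'n) form)
     \<Rightarrow> 'm \<Rightarrow> real^'n \<Rightarrow> (real^'n) form" where
  "cov_form A D \<alpha> p v vs =
     dir_deriv A p v (\<lambda>q. \<alpha> q (map (\<lambda>w. const_ext A p w q) vs)) -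
     (\<Sum>i<length vs. \<alpha> p (vs[i := D p v (const_ext A p (vs ! i))]))"

text \<open>The bracket terms of the invariant formula are absent because constant extensions
  commute.\<close>

definition ext_deriv ::
  "('m, 'n::finite) chart set \<Rightarrow> ('m \<Rightarrow> (real^'n) form) \<Rightarrow> 'm \<Rightarrow> (real^'n) form" where
  "ext_deriv A \<alpha> p vs = (\<Sum>i<length vs. (- 1) ^ i *
     dir_deriv A p (vs ! i) (\<lambda>q. \<alpha> q (map (\<lambda>w. const_ext A p w q) (take i vs @ drop (Suc i) vs))))"

definition codiff ::
  "('m, 'n::finite) chart set \<Rightarrow> ('m, 'n) cov_deriv \<Rightarrow> ('m \<Rightarrow> (real^'n) form)
     \<Rightarrow> 'm \<Rightarrow> (nat \<Rightarrow> real^'n) \<Rightarrow> (real^'n) form" where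
  "codiff A D \<alpha> p e vs = - (\<Sum>i=1..7. contract (e i) (cov_form A D \<alpha> p (e i)) vs)"

definition curvature ::
  "('m, 'n::finite) chart set \<Rightarrow> ('m, 'n) cov_deriv \<Rightarrow> 'm
     \<Rightarrow> real^'n \<Rightarrow> real^'n \<Rightarrow> real^'n \<Rightarrow> real^'n" where
  "curvature A D p x y z =
     (let X = const_ext A p x; Y = const_ext A p y; Z = const_ext A p z in
      D p (X p) (\<lambda>q. D q (Y q) Z) - D p (Y p) (\<lambda>q. D q (X q) Z) - D p (lie_bracket A X Y p) Z)"

definition ricci ::
  "('m, 'n::finite) chart set \<Rightarrow> ('m \<Rightarrow> real^'n \<Rightarrow> real^'n \<Rightarrow> real) \<Rightarrow> ('m, 'n) cov_deriv
     \<Rightarrow> 'm \<Rightarrow> (nat \<Rightarrow> real^'n) \<Rightarrow> real^'n \<Rightarrow> real^'n \<Rightarrow> real" where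
  "ricci A g D p e x y = (\<Sum>i=1..7. g p (curvature A D p (e i) x y) (e i))"

definition ricci_endo ::
  "('m, 'n::finite) chart set \<Rightarrow> ('m \<Rightarrow> real^'n \<Rightarrow> real^'n \<Rightarrow> real) \<Rightarrow> ('m, 'n) cov_deriv
     \<Rightarrow> 'm \<Rightarrow> (nat \<Rightarrow> real^'n) \<Rightarrow> real^'n \<Rightarrow> real^'n" where
  "ricci_endo A g D p e x = (\<Sum>i=1..7. ricci A g D p e x (e i) *\<^sub>R e i)"


section \<open>G2-structures\<close>

text \<open>In \<open>real^7\<close> the coordinates are \<open>x $ 1, \<dots>, x $ 6, x $ 7\<close>, where \<open>(7 :: 7) = 0\<close>. A frame is
  positive iff the linear map sending the standard basis to it has positive determinant.\<close>

definition on_frame :: "(real^7 \<Rightarrow> real^7 \<Rightarrow> real) \<Rightarrow> (nat \<Rightarrow> real^7) \<Rightarrow> bool" where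
  "on_frame b e \<longleftrightarrow>
     (\<forall>i\<in>{1..7}. \<forall>j\<in>{1..7}. b (e i) (e j) = (if i = j then 1 else 0)) \<and>
     det (matrix (\<lambda>x::real^7. \<Sum>k=1..7. (x $ of_nat k) *\<^sub>R e k)) > 0"

definition adapted_frame ::
  "(real^7 \<Rightarrow> real^7 \<Rightarrow> real) \<Rightarrow> (real^7) form \<Rightarrow> (nat \<Rightarrow> real^7) \<Rightarrow> bool" where
  "adapted_frame b w e \<longleftrightarrow> on_frame b e \<and> (\<forall>vs. length vs = 3 \<longrightarrow> w vs = phi b e vs)"

definition local_adapted_frame ::
  "('m::topological_space, 7) chart set \<Rightarrow> ('m \<Rightarrow> real^7 \<Rightarrow> real^7 \<Rightarrow> real) \<Rightarrow> ('m \<Rightarrow> (real^7) form)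
     \<Rightarrow> 'm set \<Rightarrow> ('m \<Rightarrow> nat \<Rightarrow> real^7) \<Rightarrow> bool" where
  "local_adapted_frame A g \<omega> U e \<longleftrightarrow> open U \<and>
     (\<forall>i\<in>{1..7}. smooth_vf A U (\<lambda>q. e q i)) \<and> (\<forall>q\<in>U. adapted_frame (g q) (\<omega> q) (e q))"

definition G2_structure ::
  "('m::topological_space, 7) chart set \<Rightarrow> ('m \<Rightarrow> real^7 \<Rightarrow> real^7 \<Rightarrow> real) \<Rightarrow> ('m \<Rightarrow> (real^7) form)
     \<Rightarrow> bool" where
  "G2_structure A g \<omega> \<longleftrightarrow> smooth_form A 3 \<omega> \<and> (\<forall>p. \<exists>U e. p \<in> U \<and> local_adapted_frame A g \<omega> U e)"

definition Lambda3_27 ::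
  "(real^7 \<Rightarrow> real^7 \<Rightarrow> real) \<Rightarrow> (nat \<Rightarrow> real^7) \<Rightarrow> (real^7) form \<Rightarrow> (real^7) form set" where
  "Lambda3_27 b e w = {\<alpha>. is_form 3 \<alpha> \<and>
     (\<forall>vs. length vs = 6 \<longrightarrow> wedge 3 \<alpha> w vs = 0) \<and>
     (\<forall>vs. length vs = 7 \<longrightarrow> wedge 3 \<alpha> (hodge b e 3 w) vs = 0)}"

definition G2_type_1_7_27 ::
  "('m::topological_space, 7) chart set \<Rightarrow> ('m \<Rightarrow> real^7 \<Rightarrow> real^7 \<Rightarrow> real) \<Rightarrow> ('m \<Rightarrow> (real^7) form)
     \<Rightarrow> ('m, 7) cov_deriv \<Rightarrow> ('m \<Rightarrow> real) \<Rightarrow> ('m \<Rightarrow> real^7) \<Rightarrow> ('m \<Rightarrow> (real^7) form) \<Rightarrow> bool" where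
  "G2_type_1_7_27 A g \<omega> Dg lam \<beta> \<Gamma> \<longleftrightarrow>
     smooth_fun A UNIV lam \<and> smooth_vf A UNIV \<beta> \<and> smooth_form A 3 \<Gamma> \<and>
     (\<forall>p e. on_frame (g p) e \<longrightarrow>
        \<Gamma> p \<in> Lambda3_27 (g p) e (\<omega> p) \<and>
        (\<forall>X vs. length vs = 3 \<longrightarrow>
           cov_form A Dg \<omega> p X vs =
             - (lam p / 4) * contract X (hodge (g p) e 3 (\<omega> p)) vs
             - (\<Sum>i=1..7.
                 form_inner 2 e
                   (\<lambda>us. 1/4 * wedge 1 (flat (g p) (\<beta> p)) (flat (g p) X) us
                        + 1/2 * contract X (\<Gamma> p) us)
                   (contract (e i) (\<omega> p))
                 * contract (e i) (hodge (g p) e 3 (\<omega> p)) vs)))"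


section \<open>Spinors\<close>

text \<open>The images \<open>c 1, \<dots>, c 7\<close> of the standard basis under the real eight-dimensional spin
  representation with \<open>e\<^sub>1 \<cdots> e\<^sub>7 = 1\<close>; it is unique up to equivalence.\<close>

definition cliff_prod :: "(nat \<Rightarrow> real^8^8) \<Rightarrow> nat list \<Rightarrow> real^8^8" where
  "cliff_prod c I = foldr (\<lambda>i M. c i ** M) I (mat 1)"

definition spin_rep :: "(nat \<Rightarrow> real^8^8) \<Rightarrow> bool" where
  "spin_rep c \<longleftrightarrow>
     (\<forall>i\<in>{1..7}. \<forall>j\<in>{1..7}. c i ** c j + c j ** c i = mat (if i = j then - 2 else 0)) \<and>
     cliff_prod c [1..<8] = mat 1"

text \<open>Spin(7): products of an even number of unit vectors.\<close>

definition spin_group :: "(nat \<Rightarrow> real^8^8) \<Rightarrow> (real^8^8) set" where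
  "spin_group c = {foldr (\<lambda>x M. (\<Sum>i=1..7. x i *\<^sub>R c i) ** M) xs (mat 1) | xs :: (nat \<Rightarrow> real) list.
     even (length xs) \<and> (\<forall>x\<in>set xs. (\<Sum>i=1..7. (x i)\<^sup>2) = 1)}"

text \<open>\<open>s\<close> lies over the matrix \<open>a\<close> under \<open>Spin(7) \<rightarrow> SO(7)\<close>, i.e. \<open>s e\<^sub>j s\<inverse> = \<Sum> a\<^sub>i\<^sub>j e\<^sub>i\<close>.\<close>

definition covers :: "(nat \<Rightarrow> real^8^8) \<Rightarrow> real^8^8 \<Rightarrow> (nat \<Rightarrow> nat \<Rightarrow> real) \<Rightarrow> bool" where
  "covers c s a \<longleftrightarrow> (\<forall>j\<in>{1..7}. s ** c j = (\<Sum>i=1..7. a i j *\<^sub>R c i) ** s)"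

definition frame_act :: "(nat \<Rightarrow> 'v::real_vector) \<Rightarrow> (nat \<Rightarrow> nat \<Rightarrow> real) \<Rightarrow> nat \<Rightarrow> 'v" where
  "frame_act e a j = (\<Sum>i=1..7. a i j *\<^sub>R e i)"

definition std_frame :: "nat \<Rightarrow> real^7" where
  "std_frame i = axis (of_nat i) 1"

text \<open>The lift of G2 (the stabiliser of the model form in SO(7)) to Spin(7). As G2 is connected and
  simply connected, its preimage in Spin(7) consists of two copies of G2, and the lift is the
  component of the identity.\<close>

definition G2_lift :: "(nat \<Rightarrow> real^8^8) \<Rightarrow> (real^8^8) set" where
  "G2_lift c = connected_component_set
     {s \<in> spin_group c. \<exists>a. covers c s a \<and>
        adapted_frame (\<bullet>) (phi (\<bullet>) std_frame) (frame_act std_frame a)} (mat 1)"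

text \<open>
  The spinor bundle of the induced spin structure is associated with the principal G2-bundle of
  adapted frames by the lift of G2 to Spin(7). A spinor field is given by its components
  \<open>\<Psi> p e\<close> with respect to the adapted frames \<open>e\<close> at \<open>p\<close>, subject to the equivariance
  \<open>\<Psi> p (e \<cdot> a) = s\<inverse> \<Psi> p e\<close> for \<open>s\<close> in the lift of G2 over \<open>a\<close>.
\<close>

type_synonym 'm spinor = "'m \<Rightarrow> (nat \<Rightarrow> real^7) \<Rightarrow> real^8"

definition spinor_field ::
  "('m::topological_space, 7) chart set \<Rightarrow> ('m \<Rightarrow> real^7 \<Rightarrow> real^7 \<Rightarrow> real) \<Rightarrow> ('m \<Rightarrow> (real^7) form)
     \<Rightarrow> (nat \<Rightarrow> real^8^8) \<Rightarrow> 'm spinor \<Rightarrow> bool" where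
  "spinor_field A g \<omega> c \<Psi> \<longleftrightarrow>
     (\<forall>p e s a. adapted_frame (g p) (\<omega> p) e \<and> s \<in> G2_lift c \<and> covers c s a \<longrightarrow>
        s *v \<Psi> p (frame_act e a) = \<Psi> p e) \<and>
     (\<forall>U e. local_adapted_frame A g \<omega> U e \<longrightarrow> smooth_fun A U (\<lambda>q. \<Psi> q (e q)))"

definition cliff_form :: "(nat \<Rightarrow> real^8^8) \<Rightarrow> nat \<Rightarrow> (nat \<Rightarrow> 'v) \<Rightarrow> 'v form \<Rightarrow> real^8 \<Rightarrow> real^8" where
  "cliff_form c k e \<alpha> \<psi> = (\<Sum>I\<in>incr k. \<alpha> (map e I) *\<^sub>R (cliff_prod c I *v \<psi>))"

text \<open>The components, with respect to the local adapted frame \<open>e\<close>, of the covariant derivative of a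
  spinor field induced by a metric connection \<open>D\<close>:
  \<open>\<nabla>\<^sub>v \<psi> = v(\<psi>) + 1/2 \<Sum>\<^sub>i\<^sub><\<^sub>j g(D\<^sub>v e\<^sub>i, e\<^sub>j) e\<^sub>i \<cdot> e\<^sub>j \<cdot> \<psi>\<close>.\<close>

definition spin_cov ::
  "('m, 7) chart set \<Rightarrow> ('m \<Rightarrow> real^7 \<Rightarrow> real^7 \<Rightarrow> real) \<Rightarrow> (nat \<Rightarrow> real^8^8) \<Rightarrow> ('m, 7) cov_deriv
     \<Rightarrow> ('m \<Rightarrow> nat \<Rightarrow> real^7) \<Rightarrow> 'm spinor \<Rightarrow> 'm \<Rightarrow> real^7 \<Rightarrow> real^8" where
  "spin_cov A g c D e \<Psi> p v =
     dir_deriv A p v (\<lambda>q. \<Psi> q (e q)) +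
     (1/2) *\<^sub>R (\<Sum>i=1..7. \<Sum>j\<in>{i<..7}.
        g p (D p v (\<lambda>q. e q i)) (e p j) *\<^sub>R (c i *v (c j *v \<Psi> p (e p))))"

definition dirac ::
  "('m, 7) chart set \<Rightarrow> ('m \<Rightarrow> real^7 \<Rightarrow> real^7 \<Rightarrow> real) \<Rightarrow> (nat \<Rightarrow> real^8^8) \<Rightarrow> ('m, 7) cov_deriv
     \<Rightarrow> ('m \<Rightarrow> nat \<Rightarrow> real^7) \<Rightarrow> 'm spinor \<Rightarrow> 'm \<Rightarrow> real^8" where
  "dirac A g c D e \<Psi> p = (\<Sum>i=1..7. c i *v spin_cov A g c D e \<Psi> p (e p i))"

end

theory Submission
  imports Defs
begin

text \<open>
  In adapted frames the connection form \<open>F u v = g (\<nabla>\<^sub>x e\<^sub>u) e\<^sub>v\<close> of \<open>\<nabla>\<close> stabilises the model form. Hence it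
  is skew, its contraction with \<open>\<omega>\<close> vanishes, and it annihilates the line of spinors on which \<open>\<omega>\<close>
  acts as \<open>- 7\<close>; the spinor field is constant in all adapted frames. The stabiliser of the model
  form preserves this line and so, being connected, fixes it.

  The curvature endomorphisms of \<open>\<nabla>\<close> also stabilise the model form. So contracting them with \<open>*\<omega>\<close>
  gives a multiple of themselves, which turns the first Bianchi identity with torsion into the formula
  for the Ricci tensor, and contracting them with \<open>\<omega>\<close> gives zero, which yields the relation
  between \<open>dT\<close> and \<open>\<nabla>T\<close>. The difference tensor \<open>\<nabla> - \<nabla>\<^sup>g = T/2\<close> relates the two Ricci tensors and
  the two Dirac operators.

  Finally \<open>\<nabla>\<omega> = 0\<close> expresses \<open>\<nabla>\<^sup>g\<omega>\<close> through the two-forms \<open>X \<lrcorner> T\<close>. Comparing this with the type of the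
  structure shows that \<open>S = T + \<lambda>/6 \<omega> + \<Gamma> + 1/4 \<beta> \<lrcorner> *\<omega>\<close> satisfies \<open>(X \<lrcorner> S, Y \<lrcorner> \<omega>) = 0\<close> for all \<open>X\<close> and \<open>Y\<close>.
  Then \<open>S\<close> acts trivially on the spinor, as does \<open>\<Gamma>\<close>, and the value of \<open>T\<close> on it follows.
\<close>


section \<open>Smooth maps\<close>

text \<open>The identities are computed at one point with fields whose components are constant in
  the chart fixed there. Such fields commute, so torsion, exterior derivative and curvature lose
  their bracket terms, at the price of intermediate quantities (Christoffel symbols, second
  covariant derivatives) that are not tensors. In terms of these, the Bianchi identity and the
  comparison of the two curvatures become linear identities between real numbers. The constants come
  from the structure constants \<phi> of the octonions and the components \<psi> of the dual
  four-form: \<phi>_iuv \<phi>_juv = 6 \<delta>_ij and \<psi>_uijk \<phi>_jkl = 4 \<phi>_uil absorb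
  the factors 1/6 and 1/4 in S, and a_kl \<psi>_klmn = - 2 a_mn on the stabiliser algebra produces
  the 1/2 in the Ricci formula. The algebra lives in adapted frames, while the tensor formulas are
  asserted in every oriented orthonormal frame; so traces, inner products and the Hodge star are
  shown to be independent of the frame. The spin representation is arbitrary, its matrices are not
  assumed orthogonal, hence the averaged inner product on spinors.\<close>

lemma frechet_derivative_cong_open:
  assumes "open S" "x \<in> S" "\<And>y. y \<in> S \<Longrightarrow> f y = g y"
  shows "frechet_derivative f (at x) = frechet_derivative g (at x)"
proof -
  have "(f has_derivative d) (at x) \<longleftrightarrow> (g has_derivative d) (at x)" for d
    using has_derivative_transform_within_open[OF _ assms(1,2)] assms(3) by metis
  then show ?thesis by (simp add: frechet_derivative_def)
qed

lemma differentiable_cong_open: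
  assumes "open S" "x \<in> S" "\<And>y. y \<in> S \<Longrightarrow> f y = g y"
  shows "f differentiable (at x) \<longleftrightarrow> g differentiable (at x)"
  unfolding differentiable_def
  using has_derivative_transform_within_open[OF _ assms(1,2)] assms(3) by metis

lemma frechet_has_derivative:
  "f differentiable (at x) \<Longrightarrow> (f has_derivative frechet_derivative f (at x)) (at x)"
  by (simp add: frechet_derivative_works)

lemma frechet_derivative_eqI: "(f has_derivative d) (at x) \<Longrightarrow> frechet_derivative f (at x) = d"
  using frechet_derivative_at by metis

lemma Ck_on_cong:
  assumes "open S" "\<And>y. y \<in> S \<Longrightarrow> f y = g y"
  shows "Ck_on k S f \<longleftrightarrow> Ck_on k S g"
  using assms(2)
proof (induction k arbitrary: f g)
  case 0
  then show ?case by (simp cong: continuous_on_cong)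
next
  case (Suc k)
  have "Ck_on k S (\<lambda>x. frechet_derivative f (at x) v) \<longleftrightarrow> Ck_on k S (\<lambda>x. frechet_derivative g (at x) v)" for v
    by (rule Suc.IH) (simp add: frechet_derivative_cong_open[OF assms(1) _ Suc.prems])
  moreover have "f differentiable (at x) \<longleftrightarrow> g differentiable (at x)" if "x \<in> S" for x
    by (rule differentiable_cong_open[OF assms(1) that Suc.prems])
  ultimately show ?case by simp
qed

lemma Ck_on_subset: "Ck_on k S f \<Longrightarrow> T \<subseteq> S \<Longrightarrow> Ck_on k T f"
  by (induction k arbitrary: f) (auto intro: continuous_on_subset)

lemma Ck_on_SucD: "Ck_on (Suc k) S f \<Longrightarrow> Ck_on k S f"
proof (induction k arbitrary: f)
  case 0
  then show ?case
    by (auto intro!: continuous_at_imp_continuous_on differentiable_imp_continuous_within)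
next
  case (Suc k)
  then show ?case by (meson Ck_on.simps(2))
qed

lemma Ck_on_const [simp]: "Ck_on k S (\<lambda>x. c)"
  by (induction k arbitrary: c) simp_all

lemma Ck_on_add:
  assumes "open S" "Ck_on k S f" "Ck_on k S g"
  shows "Ck_on k S (\<lambda>x. f x + g x)"
  using assms(2,3)
proof (induction k arbitrary: f g)
  case 0
  then show ?case by (simp add: continuous_on_add)
next
  case (Suc k)
  have d: "frechet_derivative (\<lambda>x. f x + g x) (at x) v
      = frechet_derivative f (at x) v + frechet_derivative g (at x) v" if "x \<in> S" for x v
    using Suc.prems that
    by (subst frechet_derivative_eqI[OF has_derivative_add[OF frechet_has_derivative frechet_has_derivative]]) auto
  show ?case
    using Suc.prems Suc.IH by (simp add: Ck_on_cong[OF assms(1) d])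
qed

lemma Ck_on_bilinear:
  assumes "open S" "Ck_on k S f" "Ck_on k S g" "bounded_bilinear B"
  shows "Ck_on k S (\<lambda>x. B (f x) (g x))"
  using assms(2,3)
proof (induction k arbitrary: f g)
  case 0
  then show ?case using bounded_bilinear.continuous_on[OF assms(4)] by auto
next
  case (Suc k)
  have d: "frechet_derivative (\<lambda>x. B (f x) (g x)) (at x) v
      = B (f x) (frechet_derivative g (at x) v) + B (frechet_derivative f (at x) v) (g x)" if "x \<in> S" for x v
    using Suc.prems that
    by (subst frechet_derivative_eqI[OF bounded_bilinear.FDERIV[OF assms(4) frechet_has_derivative frechet_has_derivative]]) auto
  have "(\<lambda>x. B (f x) (g x)) differentiable (at x)" if "x \<in> S" for x
  proof -
    have "f differentiable (at x)" "g differentiable (at x)" using Suc.prems that by auto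
    from bounded_bilinear.FDERIV[OF assms(4) this[THEN frechet_has_derivative]]
    show ?thesis unfolding differentiable_def by blast
  qed
  then show ?case
    using Suc.prems Suc.IH Ck_on_SucD[of k S f] Ck_on_SucD[of k S g]
    by (simp add: Ck_on_cong[OF assms(1) d] Ck_on_add[OF assms(1)])
qed

lemma Ck_on_linear:
  assumes "open S" "Ck_on k S f" "bounded_linear L"
  shows "Ck_on k S (\<lambda>x. L (f x))"
proof -
  \<comment> \<open>A linear map is treated as the bilinear map r *R L y with the constant function
    r = 1.\<close>
  have "bounded_bilinear (\<lambda>(r::real) y. r *\<^sub>R L y)"
    using bounded_bilinear.comp[OF bounded_bilinear_scaleR bounded_linear_ident assms(3)] .
  from Ck_on_bilinear[OF assms(1) Ck_on_const[of k S 1] assms(2) this] show ?thesis by simp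
qed

lemma Ck_on_sum:
  assumes "open S" "\<And>i. i \<in> I \<Longrightarrow> Ck_on k S (f i)"
  shows "Ck_on k S (\<lambda>x. \<Sum>i\<in>I. f i x)"
  using assms(2) by (induction I rule: infinite_finite_induct) (auto intro: Ck_on_add[OF assms(1)])

lemma frechet_derivative_expand:
  fixes f :: "real^'n \<Rightarrow> 'b::real_normed_vector"
  assumes "f differentiable (at x)"
  shows "frechet_derivative f (at x) v = (\<Sum>i\<in>UNIV. v $ i *\<^sub>R frechet_derivative f (at x) (axis i 1))"
proof -
  interpret linear "frechet_derivative f (at x)" using linear_frechet_derivative[OF assms] .
  have "v = (\<Sum>i\<in>UNIV. v $ i *\<^sub>R axis i 1)" by (simp add: basis_expansion flip: scalar_mult_eq_scaleR)
  then show ?thesis by (metis (no_types, lifting) sum scaleR sum.cong)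
qed

text \<open>\<open>Ck_on\<close> speaks of derivatives in fixed directions only, whereas the chain
  rule differentiates \<open>f\<close> in the direction of a derivative of \<open>g\<close>, which
  moves with the point. Expanding that direction in the standard basis leaves products with fixed
  partial derivatives of \<open>f\<close> composed with \<open>g\<close>, to which the induction
  hypothesis for arbitrary \<open>f\<close> applies.\<close>

lemma Ck_on_compose:
  fixes g :: "real^'n \<Rightarrow> real^'m" and f :: "real^'m \<Rightarrow> 'b::real_normed_vector"
  assumes "open S" "open T" "g ` S \<subseteq> T" "Ck_on k T f" "Ck_on k S g"
  shows "Ck_on k S (\<lambda>x. f (g x))"
  using assms(4,5)
proof (induction k arbitrary: f)
  case 0
  then show ?case using continuous_on_compose2 assms(3) by auto
next
  case (Suc k)
  have hd: "((\<lambda>x. f (g x)) has_derivative (\<lambda>v. frechet_derivative f (at (g x)) (frechet_derivative g (at x) v))) (at x)"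
    if "x \<in> S" for x
  proof -
    have "g differentiable (at x)" "f differentiable (at (g x))"
      using Suc.prems that assms(3) by auto
    then show ?thesis by (rule diff_chain_at[unfolded o_def, OF frechet_has_derivative frechet_has_derivative])
  qed
  have d: "frechet_derivative (\<lambda>x. f (g x)) (at x) v =
     (\<Sum>i\<in>UNIV. (frechet_derivative g (at x) v) $ i *\<^sub>R frechet_derivative f (at (g x)) (axis i 1))" if "x \<in> S" for x v
  proof -
    have "f differentiable (at (g x))" using Suc.prems that assms(3) by auto
    then show ?thesis
      by (simp add: frechet_derivative_eqI[OF hd[OF that]] flip: frechet_derivative_expand)
  qed
  have g: "Ck_on k S g" using Suc.prems Ck_on_SucD by blast
  have "Ck_on k S (\<lambda>x. (frechet_derivative g (at x) v) $ i *\<^sub>R frechet_derivative f (at (g x)) (axis i 1))" for v i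
    using Suc.prems g
    by (intro Ck_on_bilinear[OF assms(1) _ _ bounded_bilinear_scaleR] Suc.IH Ck_on_linear[OF assms(1) _ bounded_linear_vec_nth]) auto
  then have "Ck_on k S (\<lambda>x. frechet_derivative (\<lambda>x. f (g x)) (at x) v)" for v
    by (subst Ck_on_cong[OF assms(1) d]) (auto intro: Ck_on_sum[OF assms(1)])
  moreover have "(\<lambda>x. f (g x)) differentiable (at x)" if "x \<in> S" for x
    using hd[OF that] by (auto simp: differentiable_def)
  ultimately show ?case by simp
qed

lemma smooth_on_cong: "open S \<Longrightarrow> (\<And>y. y \<in> S \<Longrightarrow> f y = g y) \<Longrightarrow> smooth_on S f \<longleftrightarrow> smooth_on S g"
  unfolding smooth_on_def using Ck_on_cong by blast

lemma smooth_on_subset: "smooth_on S f \<Longrightarrow> T \<subseteq> S \<Longrightarrow> smooth_on T f"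
  unfolding smooth_on_def using Ck_on_subset by blast

lemma smooth_on_const [simp]: "smooth_on S (\<lambda>x. c)"
  by (simp add: smooth_on_def)

lemma smooth_on_add: "open S \<Longrightarrow> smooth_on S f \<Longrightarrow> smooth_on S g \<Longrightarrow> smooth_on S (\<lambda>x. f x + g x)"
  by (simp add: smooth_on_def Ck_on_add)

lemma smooth_on_bilinear:
  "open S \<Longrightarrow> smooth_on S f \<Longrightarrow> smooth_on S g \<Longrightarrow> bounded_bilinear B \<Longrightarrow> smooth_on S (\<lambda>x. B (f x) (g x))"
  by (simp add: smooth_on_def Ck_on_bilinear)

lemma smooth_on_scaleR:
  "open S \<Longrightarrow> smooth_on S f \<Longrightarrow> smooth_on S g \<Longrightarrow> smooth_on S (\<lambda>x. f x *\<^sub>R g x)"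
  by (rule smooth_on_bilinear[OF _ _ _ bounded_bilinear_scaleR])

lemma smooth_on_linear:
  "open S \<Longrightarrow> smooth_on S f \<Longrightarrow> bounded_linear L \<Longrightarrow> smooth_on S (\<lambda>x. L (f x))"
  by (simp add: smooth_on_def Ck_on_linear)

lemma smooth_on_sum:
  "open S \<Longrightarrow> (\<And>i. i \<in> I \<Longrightarrow> smooth_on S (f i)) \<Longrightarrow> smooth_on S (\<lambda>x. \<Sum>i\<in>I. f i x)"
  by (simp add: smooth_on_def Ck_on_sum)

lemma smooth_on_compose:
  fixes g :: "real^'n \<Rightarrow> real^'m" and f :: "real^'m \<Rightarrow> 'b::real_normed_vector"
  shows "open S \<Longrightarrow> open T \<Longrightarrow> g ` S \<subseteq> T \<Longrightarrow> smooth_on T f \<Longrightarrow> smooth_on S g \<Longrightarrow> smooth_on S (\<lambda>x. f (g x))"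
  unfolding smooth_on_def using Ck_on_compose by blast

lemma smooth_on_differentiable: "smooth_on S f \<Longrightarrow> x \<in> S \<Longrightarrow> f differentiable (at x)"
  unfolding smooth_on_def by (metis Ck_on.simps(2))

lemma smooth_on_has_derivative:
  "smooth_on S f \<Longrightarrow> x \<in> S \<Longrightarrow> (f has_derivative frechet_derivative f (at x)) (at x)"
  by (intro frechet_has_derivative smooth_on_differentiable)

lemma smooth_on_frechet: "smooth_on S f \<Longrightarrow> smooth_on S (\<lambda>x. frechet_derivative f (at x) v)"
  unfolding smooth_on_def by (metis Ck_on.simps(2))

text \<open>Needed for vector fields under a change of chart, where a Jacobian acts on a vector that
  varies with the point.\<close>

lemma smooth_on_frechet_var:
  fixes f :: "real^'n \<Rightarrow> 'b::real_normed_vector"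
  assumes "open S" "open T" "smooth_on T f" "smooth_on S h" "h ` S \<subseteq> T" "smooth_on S v"
  shows "smooth_on S (\<lambda>x. frechet_derivative f (at (h x)) (v x))"
proof -
  have e: "frechet_derivative f (at (h x)) (v x)
     = (\<Sum>i\<in>UNIV. v x $ i *\<^sub>R frechet_derivative f (at (h x)) (axis i 1))" if "x \<in> S" for x
    using that assms by (intro frechet_derivative_expand smooth_on_differentiable) auto
  show ?thesis
    by (subst smooth_on_cong[OF assms(1) e], assumption)
      (intro smooth_on_sum[OF assms(1)] smooth_on_scaleR[OF assms(1)]
         smooth_on_linear[OF assms(1) assms(6) bounded_linear_vec_nth]
         smooth_on_compose[OF assms(1,2,5) smooth_on_frechet[OF assms(3)] assms(4)])
qed

lemma smooth_on_vec_nth: "open S \<Longrightarrow> smooth_on S f \<Longrightarrow> smooth_on S (\<lambda>x. f x $ i)"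
  by (rule smooth_on_linear[OF _ _ bounded_linear_vec_nth])

text \<open>Both mixed derivatives are limits of the second difference quotient
  \<open>(f (x+hu+hv) - f (x+hu) - f (x+hv) + f x) / h\<^sup>2\<close>, by two applications of the mean value theorem.\<close>

lemma second_difference_mvt:
  fixes f :: "real^'n \<Rightarrow> real"
  assumes S: "open S" and f: "smooth_on S f" and h: "h > 0"
    and mem: "\<And>a b. 0 \<le> a \<Longrightarrow> a \<le> h \<Longrightarrow> 0 \<le> b \<Longrightarrow> b \<le> h \<Longrightarrow> x + a *\<^sub>R u + b *\<^sub>R v \<in> S"
  shows "\<exists>a b. 0 < a \<and> a < h \<and> 0 < b \<and> b < h \<and>
    f (x + h *\<^sub>R u + h *\<^sub>R v) - f (x + h *\<^sub>R u) - f (x + h *\<^sub>R v) + f x =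
    h * h * frechet_derivative (\<lambda>y. frechet_derivative f (at y) u) (at (x + a *\<^sub>R u + b *\<^sub>R v)) v"
proof -
  let ?fu = "\<lambda>y. frechet_derivative f (at y) u"
  have fu: "smooth_on S ?fu" by (rule smooth_on_frechet[OF f])
  have lin: "linear (frechet_derivative f (at y))" if "y \<in> S" for y
    using linear_frechet_derivative smooth_on_differentiable[OF f that] by blast
  have lin2: "linear (frechet_derivative ?fu (at y))" if "y \<in> S" for y
    using linear_frechet_derivative smooth_on_differentiable[OF fu that] by blast
  have 1: "DERIV (\<lambda>a. f (x + a *\<^sub>R u + b *\<^sub>R v)) a :> ?fu (x + a *\<^sub>R u + b *\<^sub>R v)"
    if "0 \<le> a" "a \<le> h" "0 \<le> b" "b \<le> h" for a b
  proof -
    have m: "x + a *\<^sub>R u + b *\<^sub>R v \<in> S" using mem that by blast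
    have "((\<lambda>a. f (x + a *\<^sub>R u + b *\<^sub>R v)) has_derivative
       (\<lambda>t. frechet_derivative f (at (x + a *\<^sub>R u + b *\<^sub>R v)) (t *\<^sub>R u))) (at a)"
      by (rule has_derivative_compose[where g = f and f = "\<lambda>a. x + a *\<^sub>R u + b *\<^sub>R v", OF _ smooth_on_has_derivative[OF f m]])
        (auto intro!: derivative_eq_intros)
    then show ?thesis
      by (simp add: has_field_derivative_def linear_scale[OF lin[OF m]] mult_commute_abs)
  qed
  have 2: "DERIV (\<lambda>b. ?fu (x + a *\<^sub>R u + b *\<^sub>R v)) b :> frechet_derivative ?fu (at (x + a *\<^sub>R u + b *\<^sub>R v)) v"
    if "0 \<le> a" "a \<le> h" "0 \<le> b" "b \<le> h" for a b
  proof -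
    have m: "x + a *\<^sub>R u + b *\<^sub>R v \<in> S" using mem that by blast
    have "((\<lambda>b. ?fu (x + a *\<^sub>R u + b *\<^sub>R v)) has_derivative
       (\<lambda>t. frechet_derivative ?fu (at (x + a *\<^sub>R u + b *\<^sub>R v)) (t *\<^sub>R v))) (at b)"
      by (rule has_derivative_compose[where g = ?fu and f = "\<lambda>b. x + a *\<^sub>R u + b *\<^sub>R v", OF _ smooth_on_has_derivative[OF fu m]])
        (auto intro!: derivative_eq_intros)
    then show ?thesis
      by (simp add: has_field_derivative_def linear_scale[OF lin2[OF m]] mult_commute_abs)
  qed
  let ?\<phi> = "\<lambda>a. f (x + a *\<^sub>R u + h *\<^sub>R v) - f (x + a *\<^sub>R u + 0 *\<^sub>R v)"
  have "DERIV ?\<phi> a :> ?fu (x + a *\<^sub>R u + h *\<^sub>R v) - ?fu (x + a *\<^sub>R u + 0 *\<^sub>R v)" if "0 \<le> a" "a \<le> h" for a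
    using h that by (intro DERIV_diff 1) auto
  from MVT2[OF h this] obtain a where a: "0 < a" "a < h"
    and ae: "?\<phi> h - ?\<phi> 0 = (h - 0) * (?fu (x + a *\<^sub>R u + h *\<^sub>R v) - ?fu (x + a *\<^sub>R u + 0 *\<^sub>R v))"
    by auto
  have "DERIV (\<lambda>b. ?fu (x + a *\<^sub>R u + b *\<^sub>R v)) b :> frechet_derivative ?fu (at (x + a *\<^sub>R u + b *\<^sub>R v)) v"
    if "0 \<le> b" "b \<le> h" for b using 2 a that by simp
  from MVT2[OF h this] obtain b where b: "0 < b" "b < h"
    and be: "?fu (x + a *\<^sub>R u + h *\<^sub>R v) - ?fu (x + a *\<^sub>R u + 0 *\<^sub>R v) =
       (h - 0) * frechet_derivative ?fu (at (x + a *\<^sub>R u + b *\<^sub>R v)) v"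
    by auto
  have "f (x + h *\<^sub>R u + h *\<^sub>R v) - f (x + h *\<^sub>R u) - f (x + h *\<^sub>R v) + f x = ?\<phi> h - ?\<phi> 0" by simp
  also have "\<dots> = h * h * frechet_derivative ?fu (at (x + a *\<^sub>R u + b *\<^sub>R v)) v"
    unfolding ae be by simp
  finally show ?thesis using a b by blast
qed

text \<open>If the mixed derivatives \<open>P\<close> and \<open>Q\<close> differed at
  \<open>x\<close>, continuity would keep their values apart on a small ball; but the second
  difference is symmetric in \<open>u\<close> and \<open>v\<close>, which forces a value of
  \<open>P\<close> and a value of \<open>Q\<close> in that ball to coincide.\<close>

lemma second_derivative_symmetric:
  fixes f :: "real^'n \<Rightarrow> real"
  assumes S: "open S" and f: "smooth_on S f" and x: "x \<in> S"
  shows "frechet_derivative (\<lambda>y. frechet_derivative f (at y) u) (at x) v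
       = frechet_derivative (\<lambda>y. frechet_derivative f (at y) v) (at x) u"
proof (rule ccontr)
  define P where "P = (\<lambda>y. frechet_derivative (\<lambda>y. frechet_derivative f (at y) u) (at y) v)"
  define Q where "Q = (\<lambda>y. frechet_derivative (\<lambda>y. frechet_derivative f (at y) v) (at y) u)"
  assume "\<not> ?thesis"
  then have ne: "\<bar>P x - Q x\<bar> > 0" by (simp add: P_def Q_def)
  have "smooth_on S P" "smooth_on S Q" unfolding P_def Q_def by (intro smooth_on_frechet f)+
  then have cP: "isCont P x" and cQ: "isCont Q x"
    using x smooth_on_differentiable differentiable_imp_continuous_within by blast+
  define e where "e = \<bar>P x - Q x\<bar> / 2"
  have e: "e > 0" using ne by (simp add: e_def)
  obtain d1 where d1: "d1 > 0" "\<And>y. dist y x < d1 \<Longrightarrow> dist (P y) (P x) < e"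
    using cP e unfolding continuous_at_eps_delta by metis
  obtain d2 where d2: "d2 > 0" "\<And>y. dist y x < d2 \<Longrightarrow> dist (Q y) (Q x) < e"
    using cQ e unfolding continuous_at_eps_delta by metis
  obtain d3 where d3: "d3 > 0" "ball x d3 \<subseteq> S" using S x open_contains_ball by blast
  define d where "d = Min {d1, d2, d3}"
  have d: "d > 0" "d \<le> d1" "d \<le> d2" "d \<le> d3" using d1 d2 d3 by (auto simp: d_def)
  \<comment> \<open>Keeps all points of the parallelogram within distance \<open>d\<close> of
    \<open>x\<close>; the summand 1 makes the denominator positive even if both directions
    vanish.\<close>
  define h where "h = d / (2 * (norm u + norm v + 1))"
  have np: "2 * (norm u + norm v + 1) > 0" by (smt (verit) norm_ge_zero)
  have h: "h > 0" using d np by (simp add: h_def)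
  have small: "dist (x + a *\<^sub>R u + b *\<^sub>R v) x < d" if "0 \<le> a" "a \<le> h" "0 \<le> b" "b \<le> h" for a b
  proof -
    have "dist (x + a *\<^sub>R u + b *\<^sub>R v) x \<le> norm (a *\<^sub>R u) + norm (b *\<^sub>R v)"
      using norm_triangle_ineq[of "a *\<^sub>R u" "b *\<^sub>R v"]
      by (simp only: dist_norm add.assoc add_diff_cancel_left')
    also have "\<dots> \<le> h * norm u + h * norm v" using that by (simp add: mult_right_mono add_mono)
    also have "\<dots> < h * (2 * (norm u + norm v + 1))" using h by (simp add: algebra_simps add_pos_nonneg add_nonneg_pos)
    also have "\<dots> = d" using np by (simp add: h_def)
    finally show ?thesis .
  qed
  have mem: "x + a *\<^sub>R u + b *\<^sub>R v \<in> S" if "0 \<le> a" "a \<le> h" "0 \<le> b" "b \<le> h" for a b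
    using small[OF that] d3 d(4) by (auto simp: mem_ball dist_commute)
  obtain a b where ab: "0 < a" "a < h" "0 < b" "b < h"
    and 1: "f (x + h *\<^sub>R u + h *\<^sub>R v) - f (x + h *\<^sub>R u) - f (x + h *\<^sub>R v) + f x = h * h * P (x + a *\<^sub>R u + b *\<^sub>R v)"
    using second_difference_mvt[OF S f h mem] unfolding P_def by auto
  have mem': "x + a *\<^sub>R v + b *\<^sub>R u \<in> S" if "0 \<le> a" "a \<le> h" "0 \<le> b" "b \<le> h" for a b
    using mem[OF that(3,4,1,2)] by (simp add: algebra_simps)
  obtain a' b' where ab': "0 < a'" "a' < h" "0 < b'" "b' < h"
    and 2: "f (x + h *\<^sub>R v + h *\<^sub>R u) - f (x + h *\<^sub>R v) - f (x + h *\<^sub>R u) + f x = h * h * Q (x + a' *\<^sub>R v + b' *\<^sub>R u)"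
    using second_difference_mvt[OF S f h mem'] unfolding Q_def by auto
  have "f (x + h *\<^sub>R v + h *\<^sub>R u) = f (x + h *\<^sub>R u + h *\<^sub>R v)" by (simp add: algebra_simps)
  with 1 2 have "h * h * P (x + a *\<^sub>R u + b *\<^sub>R v) = h * h * Q (x + b' *\<^sub>R u + a' *\<^sub>R v)"
    by (simp add: algebra_simps)
  then have "P (x + a *\<^sub>R u + b *\<^sub>R v) = Q (x + b' *\<^sub>R u + a' *\<^sub>R v)" using h by simp
  moreover have "dist (P (x + a *\<^sub>R u + b *\<^sub>R v)) (P x) < e"
    using small[of a b] ab d d1 by simp
  moreover have "dist (Q (x + b' *\<^sub>R u + a' *\<^sub>R v)) (Q x) < e"
    using small[of b' a'] ab' d d2 by simp
  ultimately show False by (simp add: dist_real_def e_def abs_if split: if_splits)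
qed

lemma second_derivative_symmetric_vec:
  fixes f :: "real^'n \<Rightarrow> real^'m"
  assumes S: "open S" and f: "smooth_on S f" and x: "x \<in> S"
  shows "frechet_derivative (\<lambda>y. frechet_derivative f (at y) u) (at x) v
       = frechet_derivative (\<lambda>y. frechet_derivative f (at y) v) (at x) u"
proof -
  have nth: "frechet_derivative F (at y) w $ i = frechet_derivative (\<lambda>y. F y $ i) (at y) w"
    if "smooth_on S F" "y \<in> S" for F :: "real^'n \<Rightarrow> real^'m" and y w i
    by (subst frechet_derivative_eqI[OF bounded_linear.has_derivative[OF bounded_linear_vec_nth smooth_on_has_derivative[OF that]]])
      (rule refl)
  have "frechet_derivative (\<lambda>y. frechet_derivative f (at y) a) (at x) b $ i
     = frechet_derivative (\<lambda>y. frechet_derivative (\<lambda>y. f y $ i) (at y) a) (at x) b" for a b i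
    by (subst nth[OF smooth_on_frechet[OF f] x], subst frechet_derivative_cong_open[OF S x nth[OF f]])
      (assumption, rule refl)
  then show ?thesis
    using second_derivative_symmetric[OF S smooth_on_vec_nth[OF S f] x] by (simp add: vec_eq_iff)
qed


section \<open>Charts and derivatives on a manifold\<close>

locale mfd =
  fixes A :: "('m::{t2_space, second_countable_topology}, 'n::finite) chart set"
  assumes mfd: "oriented_manifold A"
begin

lemma chart_open: "c \<in> A \<Longrightarrow> open (fst c)"
  and chart_image_open: "c \<in> A \<Longrightarrow> open (snd c ` fst c)"
  and chart_homeo: "c \<in> A \<Longrightarrow> homeomorphism (fst c) (snd c ` fst c) (snd c) (chart_inv c)"
  using mfd by (auto simp: oriented_manifold_def)

lemma chart_inv_chart [simp]: "c \<in> A \<Longrightarrow> q \<in> fst c \<Longrightarrow> chart_inv c (snd c q) = q"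
  using chart_homeo homeomorphism_apply1 by blast

lemma image_open:
  assumes "c \<in> A" "open U"
  shows "open (snd c ` (U \<inter> fst c))"
proof -
  have "openin (top_of_set (fst c)) (U \<inter> fst c)" using assms(2) by (auto simp: openin_open)
  from homeomorphism_imp_open_map[OF chart_homeo[OF assms(1)] this]
  show ?thesis using chart_image_open[OF assms(1)] openin_open_trans by blast
qed

lemma image_open': "c \<in> A \<Longrightarrow> open U \<Longrightarrow> U \<subseteq> fst c \<Longrightarrow> open (snd c ` U)"
  using image_open[of c U] by (simp add: Int_absorb2)

lemma trans_smooth: "c \<in> A \<Longrightarrow> d \<in> A \<Longrightarrow> smooth_on (snd c ` (fst c \<inter> fst d)) (snd d \<circ> chart_inv c)"
  using mfd by (auto simp: oriented_manifold_def)

lemma trans_deriv: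
  assumes "c \<in> A" "d \<in> A" "q \<in> fst c" "q \<in> fst d"
  shows "((snd d \<circ> chart_inv c) has_derivative jac c d q) (at (snd c q))"
  unfolding jac_def using assms
  by (intro smooth_on_has_derivative[OF trans_smooth]) auto

lemma chart_at: "chart_at A p \<in> A" "p \<in> fst (chart_at A p)"
proof -
  have "p \<in> (\<Union>c\<in>A. fst c)" using mfd by (simp add: oriented_manifold_def)
  then have "\<exists>c. c \<in> A \<and> p \<in> fst c" by blast
  from someI_ex[OF this] show "chart_at A p \<in> A" "p \<in> fst (chart_at A p)"
    by (auto simp: chart_at_def)
qed

lemma has_derivative_change_chart:
  assumes c: "c \<in> A" "q \<in> fst c" and d: "d \<in> A" "q \<in> fst d"
    and f: "((f \<circ> chart_inv d) has_derivative F) (at (snd d q))"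
  shows "((f \<circ> chart_inv c) has_derivative (\<lambda>v. F (jac c d q v))) (at (snd c q))"
proof -
  have 1: "((f \<circ> chart_inv d) \<circ> (snd d \<circ> chart_inv c) has_derivative F \<circ> jac c d q) (at (snd c q))"
    using c d f by (intro diff_chain_at trans_deriv) auto
  have 2: "snd c q \<in> snd c ` (fst d \<inter> fst c)" using c d by auto
  have 3: "((f \<circ> chart_inv d) \<circ> (snd d \<circ> chart_inv c)) y = (f \<circ> chart_inv c) y"
    if "y \<in> snd c ` (fst d \<inter> fst c)" for y
    using that c d by auto
  show ?thesis
    using has_derivative_transform_within_open[OF 1 image_open[OF c(1) chart_open[OF d(1)]] 2 3]
    by (simp add: o_def)
qed

lemma jac_chain:
  assumes "c \<in> A" "d \<in> A" "f \<in> A" "q \<in> fst c" "q \<in> fst d" "q \<in> fst f"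
  shows "jac d f q (jac c d q v) = jac c f q v"
  using has_derivative_unique[OF has_derivative_change_chart[OF assms(1,4,2,5) trans_deriv[OF assms(2,3,5,6)]]
      trans_deriv[OF assms(1,3,4,6)]]
  by (rule fun_cong)

lemma jac_self:
  assumes "c \<in> A" "q \<in> fst c"
  shows "jac c c q v = v"
proof -
  have "((\<lambda>y. y) has_derivative (\<lambda>v. v)) (at (snd c q))" by simp
  moreover have "open (snd c ` fst c)" "snd c q \<in> snd c ` fst c" using assms chart_image_open by auto
  ultimately have "((snd c \<circ> chart_inv c) has_derivative (\<lambda>v. v)) (at (snd c q))"
    using assms by (elim has_derivative_transform_within_open) auto
  from fun_cong[OF has_derivative_unique[OF trans_deriv[OF assms(1,1,2,2)] this]] show ?thesis .
qed

lemma jac_linear: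
  "c \<in> A \<Longrightarrow> d \<in> A \<Longrightarrow> q \<in> fst c \<Longrightarrow> q \<in> fst d \<Longrightarrow> linear (jac c d q)"
  using trans_deriv has_derivative_linear by blast

lemma to_chart_linear: "c \<in> A \<Longrightarrow> q \<in> fst c \<Longrightarrow> linear (to_chart A c q)"
  and from_chart_linear: "c \<in> A \<Longrightarrow> q \<in> fst c \<Longrightarrow> linear (from_chart A c q)"
  by (intro jac_linear chart_at; assumption)+

lemma to_from_chart: "c \<in> A \<Longrightarrow> q \<in> fst c \<Longrightarrow> to_chart A c q (from_chart A c q v) = v"
  and from_to_chart: "c \<in> A \<Longrightarrow> q \<in> fst c \<Longrightarrow> from_chart A c q (to_chart A c q v) = v"
  by (simp_all add: jac_chain chart_at jac_self)

lemma const_ext_self: "const_ext A p v p = v"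
  by (simp add: const_ext_def jac_self chart_at)

lemma to_chart_self: "to_chart A (chart_at A p) p v = v"
  by (simp add: jac_self chart_at)

subsection \<open>Derivatives\<close>

text \<open>A tangent vector at \<open>q\<close> is given by its components in
  \<open>chart_at A q\<close>, so the derivative is taken in that chart and \<open>F\<close> applies
  to such vectors directly; \<open>has_mderiv_chart\<close> converts from any other chart.\<close>

definition has_mderiv :: "'m \<Rightarrow> ('m \<Rightarrow> 'b::real_normed_vector) \<Rightarrow> (real^'n \<Rightarrow> 'b) \<Rightarrow> bool" where
  "has_mderiv q f F \<longleftrightarrow> ((f \<circ> chart_inv (chart_at A q)) has_derivative F) (at (snd (chart_at A q) q))"

text \<open>\<open>dir_deriv\<close> is total and arbitrary where \<open>f\<close> is not
  differentiable; this records that it really is the derivative.\<close>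

definition mdiff :: "'m \<Rightarrow> ('m \<Rightarrow> 'b::real_normed_vector) \<Rightarrow> bool" where
  "mdiff q f \<longleftrightarrow> has_mderiv q f (\<lambda>v. dir_deriv A q v f)"

lemma dir_deriv_eq: "has_mderiv q f F \<Longrightarrow> dir_deriv A q v f = F v"
  unfolding has_mderiv_def dir_deriv_def by (simp add: frechet_derivative_eqI)

lemma has_mderiv_mdiff: "has_mderiv q f F \<Longrightarrow> mdiff q f"
  using dir_deriv_eq[of q f F] by (simp add: mdiff_def)

lemma has_mderiv_cong:
  assumes "open U" "q \<in> U" "\<And>r. r \<in> U \<Longrightarrow> f r = g r" "has_mderiv q f F"
  shows "has_mderiv q g F"
proof -
  let ?c = "chart_at A q"
  have "open (snd ?c ` (U \<inter> fst ?c))" "snd ?c q \<in> snd ?c ` (U \<inter> fst ?c)"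
    using image_open[OF _ assms(1)] chart_at assms(2) by auto
  with assms(4) show ?thesis
    unfolding has_mderiv_def
    by (elim has_derivative_transform_within_open) (use assms(3) chart_at in auto)
qed

lemma dir_deriv_cong:
  assumes "open U" "q \<in> U" "\<And>r. r \<in> U \<Longrightarrow> f r = g r"
  shows "dir_deriv A q v f = dir_deriv A q v g"
proof -
  let ?c = "chart_at A q"
  have *: "open (snd ?c ` (U \<inter> fst ?c))" "snd ?c q \<in> snd ?c ` (U \<inter> fst ?c)"
    using image_open[OF _ assms(1)] chart_at assms(2) by auto
  have "frechet_derivative (f \<circ> chart_inv ?c) (at (snd ?c q))
    = frechet_derivative (g \<circ> chart_inv ?c) (at (snd ?c q))"
    by (rule frechet_derivative_cong_open[OF *]) (use assms(3) chart_at in auto)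
  then show ?thesis by (simp add: dir_deriv_def)
qed

lemma has_mderiv_const: "has_mderiv q (\<lambda>r. k) (\<lambda>v. 0)"
  by (simp add: has_mderiv_def o_def)

lemma has_mderiv_add:
  "has_mderiv q f F \<Longrightarrow> has_mderiv q g G \<Longrightarrow> has_mderiv q (\<lambda>r. f r + g r) (\<lambda>v. F v + G v)"
  by (simp add: has_mderiv_def o_def has_derivative_add)

lemma has_mderiv_sum:
  "(\<And>i. i \<in> I \<Longrightarrow> has_mderiv q (f i) (F i)) \<Longrightarrow> has_mderiv q (\<lambda>r. \<Sum>i\<in>I. f i r) (\<lambda>v. \<Sum>i\<in>I. F i v)"
  by (simp add: has_mderiv_def o_def has_derivative_sum)

lemma has_mderiv_bilinear:
  "bounded_bilinear B \<Longrightarrow> has_mderiv q f F \<Longrightarrow> has_mderiv q g G \<Longrightarrow>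
    has_mderiv q (\<lambda>r. B (f r) (g r)) (\<lambda>v. B (f q) (G v) + B (F v) (g q))"
  unfolding has_mderiv_def o_def
  by (drule (2) bounded_bilinear.FDERIV) (simp add: chart_at)

lemma has_mderiv_mult:
  fixes f g :: "'m \<Rightarrow> real"
  shows "has_mderiv q f F \<Longrightarrow> has_mderiv q g G \<Longrightarrow>
    has_mderiv q (\<lambda>r. f r * g r) (\<lambda>v. f q * G v + F v * g q)"
  by (rule has_mderiv_bilinear[OF bounded_bilinear_mult])

lemma has_mderiv_linear:
  "bounded_linear L \<Longrightarrow> has_mderiv q f F \<Longrightarrow> has_mderiv q (\<lambda>r. L (f r)) (\<lambda>v. L (F v))"
  unfolding has_mderiv_def o_def by (rule bounded_linear.has_derivative)

lemma has_mderiv_nth: "has_mderiv q f F \<Longrightarrow> has_mderiv q (\<lambda>r. f r $ i) (\<lambda>v. F v $ i)"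
  by (rule has_mderiv_linear[OF bounded_linear_vec_nth])

lemma has_mderiv_chart:
  assumes "c \<in> A" "q \<in> fst c" "((f \<circ> chart_inv c) has_derivative F) (at (snd c q))"
  shows "has_mderiv q f (\<lambda>v. F (to_chart A c q v))"
  unfolding has_mderiv_def
  by (rule has_derivative_change_chart[OF chart_at assms])

lemma has_mderiv_in_chart:
  assumes "c \<in> A" "q \<in> fst c" "mdiff q f"
  shows "((f \<circ> chart_inv c) has_derivative (\<lambda>v. dir_deriv A q (from_chart A c q v) f)) (at (snd c q))"
  using has_derivative_change_chart[OF assms(1,2) chart_at[of q]] assms(3)
  unfolding mdiff_def has_mderiv_def by blast

subsection \<open>Smooth functions and vector fields\<close>

lemma smooth_fun_mdiff: "smooth_fun A U f \<Longrightarrow> q \<in> U \<Longrightarrow> mdiff q f"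
  unfolding smooth_fun_def
  by (rule has_mderiv_mdiff, unfold has_mderiv_def, rule smooth_on_has_derivative)
    (use chart_at[of q] in auto)

lemma smooth_fun_subset: "smooth_fun A U f \<Longrightarrow> V \<subseteq> U \<Longrightarrow> smooth_fun A V f"
  unfolding smooth_fun_def by (blast intro: smooth_on_subset)

lemma smooth_vf_subset: "smooth_vf A U X \<Longrightarrow> V \<subseteq> U \<Longrightarrow> smooth_vf A V X"
  unfolding smooth_vf_def by (blast intro: smooth_on_subset)

lemma smooth_fun_cong:
  assumes "open U" "\<And>r. r \<in> U \<Longrightarrow> f r = g r"
  shows "smooth_fun A U f \<longleftrightarrow> smooth_fun A U g"
proof -
  have "smooth_on (snd c ` (U \<inter> fst c)) (f \<circ> chart_inv c) \<longleftrightarrow> smooth_on (snd c ` (U \<inter> fst c)) (g \<circ> chart_inv c)"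
    if "c \<in> A" for c
    using that assms by (intro smooth_on_cong image_open) auto
  then show ?thesis by (auto simp: smooth_fun_def)
qed

lemma smooth_vf_cong:
  assumes "open U" "\<And>r. r \<in> U \<Longrightarrow> X r = Y r"
  shows "smooth_vf A U X \<longleftrightarrow> smooth_vf A U Y"
proof -
  have "smooth_on (snd c ` (U \<inter> fst c)) ((\<lambda>q. to_chart A c q (X q)) \<circ> chart_inv c)
     \<longleftrightarrow> smooth_on (snd c ` (U \<inter> fst c)) ((\<lambda>q. to_chart A c q (Y q)) \<circ> chart_inv c)"
    if "c \<in> A" for c
    using that assms by (intro smooth_on_cong image_open) auto
  then show ?thesis by (auto simp: smooth_vf_def)
qed

lemma smooth_fun_const: "smooth_fun A U (\<lambda>r. k)"
  by (simp add: smooth_fun_def o_def)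

text \<open>Transition maps are smooth, so one chart whose domain contains \<open>U\<close>
  suffices.\<close>

lemma smooth_fun_chartI:
  assumes c: "c \<in> A" and U: "open U" "U \<subseteq> fst c" and f: "smooth_on (snd c ` U) (f \<circ> chart_inv c)"
  shows "smooth_fun A U f"
  unfolding smooth_fun_def
proof
  fix d assume d: "d \<in> A"
  let ?S = "snd d ` (U \<inter> fst d)"
  have "smooth_on ?S (\<lambda>y. (f \<circ> chart_inv c) ((snd c \<circ> chart_inv d) y))"
  proof (rule smooth_on_compose[OF image_open[OF d U(1)] image_open'[OF c U] _ f])
    show "(snd c \<circ> chart_inv d) ` ?S \<subseteq> snd c ` U" using d by auto
    show "smooth_on ?S (snd c \<circ> chart_inv d)"
      by (rule smooth_on_subset[OF trans_smooth[OF d c]]) (use U in auto)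
  qed
  moreover have "(f \<circ> chart_inv c) ((snd c \<circ> chart_inv d) y) = (f \<circ> chart_inv d) y" if y: "y \<in> ?S" for y
  proof -
    obtain r where r: "r \<in> U" "r \<in> fst d" "y = snd d r" using y by auto
    then have "r \<in> fst c" using U by auto
    then show ?thesis using r c d by simp
  qed
  ultimately show "smooth_on ?S (f \<circ> chart_inv d)"
    by (subst (asm) smooth_on_cong[OF image_open[OF d U(1)]])
qed

lemma smooth_fun_chartD:
  "smooth_fun A U f \<Longrightarrow> c \<in> A \<Longrightarrow> U \<subseteq> fst c \<Longrightarrow> smooth_on (snd c ` U) (f \<circ> chart_inv c)"
  unfolding smooth_fun_def by (metis Int_absorb2)

lemma smooth_vf_chartD:
  assumes "smooth_vf A U X" "c \<in> A" "open U"
  shows "smooth_fun A (U \<inter> fst c) (\<lambda>q. to_chart A c q (X q))"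
  using assms chart_open[OF assms(2)]
  by (intro smooth_fun_chartI[of c]) (auto simp: smooth_vf_def)

text \<open>In another chart the components arise by the Jacobian of the transition map, a
  derivative in a direction that depends smoothly on the point.\<close>

lemma smooth_vf_chartI:
  assumes c: "c \<in> A" and U: "open U" "U \<subseteq> fst c"
    and X: "smooth_fun A U (\<lambda>q. to_chart A c q (X q))"
  shows "smooth_vf A U X"
  unfolding smooth_vf_def
proof
  fix d assume d: "d \<in> A"
  let ?S = "snd d ` (U \<inter> fst d)"
  have S: "open ?S" by (rule image_open[OF d U(1)])
  let ?\<Phi> = "snd d \<circ> chart_inv c" and ?\<Psi> = "snd c \<circ> chart_inv d"
  have "smooth_on ?S (\<lambda>y. frechet_derivative ?\<Phi> (at (?\<Psi> y)) (((\<lambda>q. to_chart A c q (X q)) \<circ> chart_inv d) y))"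
  proof (rule smooth_on_frechet_var[OF S _ trans_smooth[OF c d]])
    show "open (snd c ` (fst c \<inter> fst d))"
      using image_open[OF c chart_open[OF d]] by (simp add: Int_commute)
    show "smooth_on ?S ?\<Psi>" by (rule smooth_on_subset[OF trans_smooth[OF d c]]) (use U in auto)
    show "?\<Psi> ` ?S \<subseteq> snd c ` (fst c \<inter> fst d)"
    proof
      fix y assume "y \<in> ?\<Psi> ` ?S"
      then obtain r where "r \<in> U" "r \<in> fst d" "y = ?\<Psi> (snd d r)" by auto
      then show "y \<in> snd c ` (fst c \<inter> fst d)" using U d by auto
    qed
    show "smooth_on ?S ((\<lambda>q. to_chart A c q (X q)) \<circ> chart_inv d)"
      using X d by (auto simp: smooth_fun_def)
  qed
  moreover have "frechet_derivative ?\<Phi> (at (?\<Psi> y)) (((\<lambda>q. to_chart A c q (X q)) \<circ> chart_inv d) y)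
     = ((\<lambda>q. to_chart A d q (X q)) \<circ> chart_inv d) y" if y: "y \<in> ?S" for y
  proof -
    obtain r where r: "r \<in> U" "r \<in> fst d" "y = snd d r" using y by auto
    then have "r \<in> fst c" using U by auto
    then have "jac c d r (to_chart A c r (X r)) = to_chart A d r (X r)"
      using r c d by (simp add: jac_chain chart_at)
    then show ?thesis using r c d \<open>r \<in> fst c\<close> by (simp add: jac_def)
  qed
  ultimately show "smooth_on ?S ((\<lambda>q. to_chart A d q (X q)) \<circ> chart_inv d)"
    by (subst (asm) smooth_on_cong[OF S])
qed

lemma smooth_vf_mdiff:
  "smooth_vf A U X \<Longrightarrow> open U \<Longrightarrow> q \<in> U \<Longrightarrow> c \<in> A \<Longrightarrow> q \<in> fst c \<Longrightarrow> mdiff q (\<lambda>r. to_chart A c r (X r))"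
  using smooth_fun_mdiff[OF smooth_vf_chartD] by blast

lemma smooth_vf_from_chart: "c \<in> A \<Longrightarrow> smooth_vf A (fst c) (\<lambda>q. from_chart A c q v)"
  by (rule smooth_vf_chartI[of c])
    (auto simp: chart_open to_from_chart smooth_fun_const cong: smooth_fun_cong[OF chart_open])

lemma smooth_vf_const_ext: "smooth_vf A (fst (chart_at A p)) (const_ext A p v)"
  using smooth_vf_from_chart[OF chart_at(1), of p v] by (simp add: const_ext_def[abs_def])

lemma to_chart_const_ext: "q \<in> fst (chart_at A p) \<Longrightarrow> to_chart A (chart_at A p) q (const_ext A p v q) = v"
  and const_ext_to_chart: "q \<in> fst (chart_at A p) \<Longrightarrow> const_ext A p (to_chart A (chart_at A p) q v) q = v"
  and const_ext_linear: "q \<in> fst (chart_at A p) \<Longrightarrow> linear (\<lambda>v. const_ext A p v q)"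
  by (simp_all add: const_ext_def to_from_chart from_to_chart chart_at from_chart_linear)

text \<open>The components of a constant field of the chart \<open>c\<close> in another chart are a directional
  derivative of the transition map, so its bracket is the difference of two mixed derivatives.\<close>

lemma lie_bracket_from_chart:
  assumes c: "c \<in> A" "q \<in> fst c"
  shows "lie_bracket A (\<lambda>r. from_chart A c r v) (\<lambda>r. from_chart A c r w) q = 0"
proof -
  let ?d = "chart_at A q"
  let ?\<Phi> = "snd ?d \<circ> chart_inv c" and ?U = "fst c \<inter> fst ?d"
  have d: "?d \<in> A" "q \<in> fst ?d" by (rule chart_at)+
  have U: "open ?U" "q \<in> ?U" using c d chart_open[OF c(1)] chart_open[OF d(1)] by (auto intro: open_Int)
  have oS: "open (snd c ` ?U)" using image_open[OF c(1) chart_open[OF d(1)]] by (simp add: Int_commute)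
  have "dir_deriv A q (from_chart A c q a) (\<lambda>r. to_chart A ?d r (from_chart A c r b))
     = frechet_derivative (\<lambda>y. frechet_derivative ?\<Phi> (at y) b) (at (snd c q)) a" for a b
  proof -
    have "smooth_on (snd c ` ?U) (\<lambda>y. frechet_derivative ?\<Phi> (at y) b)"
      by (rule smooth_on_frechet[OF trans_smooth[OF c(1) d(1)]])
    then have "((\<lambda>y. frechet_derivative ?\<Phi> (at y) b) has_derivative
        frechet_derivative (\<lambda>y. frechet_derivative ?\<Phi> (at y) b) (at (snd c q))) (at (snd c q))"
      using U by (intro smooth_on_has_derivative) auto
    then have "((((\<lambda>r. jac c ?d r b)) \<circ> chart_inv c) has_derivative
        frechet_derivative (\<lambda>y. frechet_derivative ?\<Phi> (at y) b) (at (snd c q))) (at (snd c q))"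
      by (rule has_derivative_transform_within_open[OF _ oS]) (use U c in \<open>auto simp: jac_def\<close>)
    from has_mderiv_chart[OF c this]
    have "dir_deriv A q (from_chart A c q a) (\<lambda>r. jac c ?d r b)
      = frechet_derivative (\<lambda>y. frechet_derivative ?\<Phi> (at y) b) (at (snd c q)) a"
      by (simp add: dir_deriv_eq to_from_chart[OF c])
    moreover have "to_chart A ?d r (from_chart A c r b) = jac c ?d r b" if "r \<in> ?U" for r
      using that c d by (intro jac_chain) (auto simp: chart_at)
    ultimately show ?thesis by (subst dir_deriv_cong[OF U]) auto
  qed
  then show ?thesis
    using second_derivative_symmetric_vec[OF oS trans_smooth[OF c(1) d(1)]] U
    by (simp add: lie_bracket_def)
qed

lemma lie_bracket_const_ext:
  "q \<in> fst (chart_at A p) \<Longrightarrow> lie_bracket A (const_ext A p v) (const_ext A p w) q = 0"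
  using lie_bracket_from_chart[OF chart_at(1)] by (simp add: const_ext_def[abs_def])

lemma smooth_fun_add: "open U \<Longrightarrow> smooth_fun A U f \<Longrightarrow> smooth_fun A U g \<Longrightarrow> smooth_fun A U (\<lambda>r. f r + g r)"
  by (auto simp: smooth_fun_def o_def intro!: smooth_on_add image_open)

lemma smooth_fun_scaleR:
  "open U \<Longrightarrow> smooth_fun A U f \<Longrightarrow> smooth_fun A U g \<Longrightarrow> smooth_fun A U (\<lambda>r. f r *\<^sub>R g r)"
  by (auto simp: smooth_fun_def o_def intro!: smooth_on_scaleR image_open)

lemma smooth_fun_nth: "open U \<Longrightarrow> smooth_fun A U f \<Longrightarrow> smooth_fun A U (\<lambda>r. f r $ i)"
  by (auto simp: smooth_fun_def o_def intro!: smooth_on_vec_nth image_open)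

lemma smooth_vf_scaleR:
  assumes "open U" "smooth_fun A U f" "smooth_vf A U X"
  shows "smooth_vf A U (\<lambda>r. f r *\<^sub>R X r)"
  unfolding smooth_vf_def
proof
  fix c assume c: "c \<in> A"
  have "smooth_fun A (U \<inter> fst c) (\<lambda>r. f r *\<^sub>R to_chart A c r (X r))"
    using assms c chart_open[OF c] smooth_fun_subset[of U f "U \<inter> fst c"]
    by (intro smooth_fun_scaleR smooth_vf_chartD) auto
  moreover have "f r *\<^sub>R to_chart A c r (X r) = to_chart A c r (f r *\<^sub>R X r)" if "r \<in> U \<inter> fst c" for r
    using that c by (simp add: linear_scale[OF to_chart_linear])
  ultimately have "smooth_fun A (U \<inter> fst c) (\<lambda>r. to_chart A c r (f r *\<^sub>R X r))"
    by (subst (asm) smooth_fun_cong[OF open_Int[OF assms(1) chart_open[OF c]]])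
  then show "smooth_on (snd c ` (U \<inter> fst c)) ((\<lambda>r. to_chart A c r (f r *\<^sub>R X r)) \<circ> chart_inv c)"
    using c by (rule smooth_fun_chartD) auto
qed

end


section \<open>Connections\<close>

context mfd begin

lemma smooth_vf_add:
  assumes "open U" "smooth_vf A U X" "smooth_vf A U Y"
  shows "smooth_vf A U (\<lambda>r. X r + Y r)"
  unfolding smooth_vf_def
proof
  fix c assume c: "c \<in> A"
  have "smooth_fun A (U \<inter> fst c) (\<lambda>r. to_chart A c r (X r) + to_chart A c r (Y r))"
    using assms c chart_open[OF c] by (intro smooth_fun_add smooth_vf_chartD open_Int) auto
  moreover have "to_chart A c r (X r) + to_chart A c r (Y r) = to_chart A c r (X r + Y r)"
    if "r \<in> U \<inter> fst c" for r
    using that c by (simp add: linear_add[OF to_chart_linear])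
  ultimately have "smooth_fun A (U \<inter> fst c) (\<lambda>r. to_chart A c r (X r + Y r))"
    by (subst (asm) smooth_fun_cong[OF open_Int[OF assms(1) chart_open[OF c]]])
  then show "smooth_on (snd c ` (U \<inter> fst c)) ((\<lambda>r. to_chart A c r (X r + Y r)) \<circ> chart_inv c)"
    using c by (rule smooth_fun_chartD) auto
qed

lemma smooth_vf_zero:
  assumes "open U"
  shows "smooth_vf A U (\<lambda>r. 0)"
  unfolding smooth_vf_def
proof
  fix c assume c: "c \<in> A"
  have "(0::real^'n) = ((\<lambda>r. to_chart A c r 0) \<circ> chart_inv c) y" if "y \<in> snd c ` (U \<inter> fst c)" for y
    using that c by (auto simp: linear_0[OF to_chart_linear])
  then show "smooth_on (snd c ` (U \<inter> fst c)) ((\<lambda>r. to_chart A c r 0) \<circ> chart_inv c)"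
    by (rule smooth_on_cong[OF image_open[OF c assms], THEN iffD1, OF _ smooth_on_const])
qed

lemma smooth_vf_sum:
  assumes "open U" "\<And>i. i \<in> I \<Longrightarrow> smooth_vf A U (X i)"
  shows "smooth_vf A U (\<lambda>r. \<Sum>i\<in>I. X i r)"
  using assms(2)
  by (induction I rule: infinite_finite_induct) (auto intro: smooth_vf_add smooth_vf_zero assms(1))

text \<open>Depends on the chart; it acquires an invariant meaning only together with the
  Christoffel term \<open>chr\<close> below.\<close>

definition vf_deriv :: "'m \<Rightarrow> real^'n \<Rightarrow> ('m \<Rightarrow> real^'n) \<Rightarrow> real^'n" where
  "vf_deriv q v X = dir_deriv A q v (\<lambda>r. to_chart A (chart_at A q) r (X r))"

lemma vf_deriv_mderiv:
  assumes "open U" "q \<in> U" "smooth_vf A U X"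
  shows "has_mderiv q (\<lambda>r. to_chart A (chart_at A q) r (X r)) (\<lambda>v. vf_deriv q v X)"
  using smooth_vf_mdiff[OF assms(3,1,2) chart_at] by (simp add: mdiff_def vf_deriv_def)

lemma vf_expand:
  assumes "r \<in> fst (chart_at A p)"
  shows "x = (\<Sum>i\<in>UNIV. to_chart A (chart_at A p) r x $ i *\<^sub>R const_ext A p (axis i 1) r)"
proof -
  interpret linear "\<lambda>v. const_ext A p v r" by (rule const_ext_linear[OF assms])
  have "w = (\<Sum>i\<in>UNIV. w $ i *\<^sub>R axis i 1)" for w :: "real^'n"
    by (simp add: basis_expansion flip: scalar_mult_eq_scaleR)
  then have "const_ext A p w r = (\<Sum>i\<in>UNIV. w $ i *\<^sub>R const_ext A p (axis i 1) r)" for w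
    by (metis (no_types, lifting) sum scaleR sum.cong)
  from this[of "to_chart A (chart_at A p) r x"] show ?thesis
    by (simp add: const_ext_to_chart[OF assms])
qed

text \<open>Near \<open>q\<close> the field is a combination of coordinate fields, so the product
  rule gives one term in which \<open>L\<close> on these fields is differentiated and one in which
  the components of \<open>X\<close> are. Applied slot by slot, it passes from constant extensions,
  by which \<open>cov_form\<close> is defined, to arbitrary fields.\<close>

lemma linear_slot_deriv:
  fixes L :: "'m \<Rightarrow> real^'n \<Rightarrow> real"
  assumes L: "\<And>r. linear (L r)" and E: "\<And>w. mdiff q (\<lambda>r. L r (const_ext A q w r))"
    and U: "open U" "q \<in> U" and X: "smooth_vf A U X"
  shows "mdiff q (\<lambda>r. L r (X r))" (is ?th1)
    and "dir_deriv A q v (\<lambda>r. L r (X r)) =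
      dir_deriv A q v (\<lambda>r. L r (const_ext A q (X q) r)) + L q (vf_deriv q v X)" (is ?th2)
proof -
  let ?c = "chart_at A q"
  define x where "x = (\<lambda>i r. to_chart A ?c r (X r) $ i)"
  define e where "e = (\<lambda>i r. L r (const_ext A q (axis i 1) r))"
  have xd: "has_mderiv q (x i) (\<lambda>v. vf_deriv q v X $ i)" for i
    unfolding x_def by (rule has_mderiv_nth[OF vf_deriv_mderiv[OF U X]])
  have ed: "has_mderiv q (e i) (\<lambda>v. dir_deriv A q v (e i))" for i
    using E[of "axis i 1"] by (simp add: e_def mdiff_def)
  have xq: "x i q = X q $ i" for i by (simp add: x_def to_chart_self)
  have eq: "e i q = L q (axis i 1)" for i by (simp add: e_def const_ext_self)
  have Lex: "L r (\<Sum>i\<in>UNIV. a i *\<^sub>R b i) = (\<Sum>i\<in>UNIV. a i * L r (b i))" for r a b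
    using L[of r] by (simp add: linear_sum linear_scale)
  have bex: "w = (\<Sum>i\<in>UNIV. w $ i *\<^sub>R axis i 1)" for w :: "real^'n"
    by (simp add: basis_expansion flip: scalar_mult_eq_scaleR)
  have near: "(\<Sum>i\<in>UNIV. x i r * e i r) = L r (X r)" if "r \<in> fst ?c" for r
    by (subst vf_expand[OF that, of "X r"]) (simp add: Lex x_def e_def)
  have near0: "(\<Sum>i\<in>UNIV. X q $ i * e i r) = L r (const_ext A q (X q) r)" if "r \<in> fst ?c" for r
    by (subst vf_expand[OF that, of "const_ext A q (X q) r"])
      (simp add: Lex to_chart_const_ext[OF that] e_def)
  note c = chart_open[OF chart_at(1)] chart_at(2)
  have d0: "dir_deriv A q v (\<lambda>r. L r (const_ext A q (X q) r)) = (\<Sum>i\<in>UNIV. X q $ i * dir_deriv A q v (e i))" for v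
    by (rule dir_deriv_eq[OF has_mderiv_cong[OF c near0]])
      (auto intro!: has_mderiv_sum has_mderiv_linear[OF bounded_linear_mult_right] ed)
  have dv: "L q (vf_deriv q v X) = (\<Sum>i\<in>UNIV. vf_deriv q v X $ i * e i q)" for v
    by (subst bex[of "vf_deriv q v X"]) (simp only: Lex eq)
  have "has_mderiv q (\<lambda>r. \<Sum>i\<in>UNIV. x i r * e i r)
    (\<lambda>v. \<Sum>i\<in>UNIV. x i q * dir_deriv A q v (e i) + vf_deriv q v X $ i * e i q)"
    by (intro has_mderiv_sum has_mderiv_mult xd ed)
  from has_mderiv_cong[OF c near this]
  have "has_mderiv q (\<lambda>r. L r (X r))
     (\<lambda>v. dir_deriv A q v (\<lambda>r. L r (const_ext A q (X q) r)) + L q (vf_deriv q v X))"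
    by (simp add: d0 dv xq sum.distrib)
  then show ?th1 ?th2 by (auto intro: has_mderiv_mdiff dir_deriv_eq)
qed

end

section \<open>Christoffel symbols and covariant derivatives of tensors\<close>

locale conn = mfd A for A :: "('m::{t2_space, second_countable_topology}, 'n::finite) chart set" +
  fixes D :: "('m, 'n) cov_deriv"
  assumes conn: "affine_connection A D"
begin

lemma conn_rules:
  assumes "open U" "p \<in> U" "smooth_vf A U Y" "smooth_vf A U Z" "smooth_fun A U f"
  shows "linear (\<lambda>v. D p v Y)" "D p v (\<lambda>q. Y q + Z q) = D p v Y + D p v Z"
    "D p v (\<lambda>q. f q *\<^sub>R Y q) = dir_deriv A p v f *\<^sub>R Y p + f p *\<^sub>R D p v Y"
    "smooth_vf A U (\<lambda>q. D q (Z q) Y)"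
  using conn assms unfolding affine_connection_def by blast+

lemma conn_linear: "open U \<Longrightarrow> p \<in> U \<Longrightarrow> smooth_vf A U Y \<Longrightarrow> linear (\<lambda>v. D p v Y)"
  using conn_rules(1)[where f = "\<lambda>r. 0", OF _ _ _ _ smooth_fun_const] by blast

lemma conn_add: "open U \<Longrightarrow> p \<in> U \<Longrightarrow> smooth_vf A U Y \<Longrightarrow> smooth_vf A U Z \<Longrightarrow>
    D p v (\<lambda>q. Y q + Z q) = D p v Y + D p v Z"
  by (rule conn_rules(2)[where f = "\<lambda>r. 0", OF _ _ _ _ smooth_fun_const])

lemma conn_scaleR: "open U \<Longrightarrow> p \<in> U \<Longrightarrow> smooth_vf A U Y \<Longrightarrow> smooth_fun A U f \<Longrightarrow>
    D p v (\<lambda>q. f q *\<^sub>R Y q) = dir_deriv A p v f *\<^sub>R Y p + f p *\<^sub>R D p v Y"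
  by (rule conn_rules(3))

lemma conn_smooth:
  "open U \<Longrightarrow> smooth_vf A U Y \<Longrightarrow> smooth_vf A U Z \<Longrightarrow> smooth_vf A U (\<lambda>q. D q (Z q) Y)"
  using conn smooth_fun_const[of U "0::real"] unfolding affine_connection_def by blast

lemma conn_scaleR_const: "open U \<Longrightarrow> p \<in> U \<Longrightarrow> smooth_vf A U Y \<Longrightarrow>
    D p v (\<lambda>q. k *\<^sub>R Y q) = k *\<^sub>R D p v Y"
  by (subst conn_scaleR) (auto simp: smooth_fun_const dir_deriv_eq[OF has_mderiv_const])

lemma conn_zero: "D p v (\<lambda>q. 0) = 0"
  using conn_scaleR_const[OF open_UNIV _ smooth_vf_zero[OF open_UNIV], of p v 0] by simp

lemma conn_sum:
  assumes "open U" "p \<in> U" "\<And>i. i \<in> I \<Longrightarrow> smooth_vf A U (X i)" "finite I"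
  shows "D p v (\<lambda>q. \<Sum>i\<in>I. X i q) = (\<Sum>i\<in>I. D p v (X i))"
  using assms(4,3)
  by (induction I) (simp_all add: conn_zero conn_add[OF assms(1,2)] smooth_vf_sum assms(1))

text \<open>Multiplication with the indicator function of \<open>U\<close>, which is smooth on \<open>U\<close>, does not change the
  covariant derivative at points of \<open>U\<close>.\<close>

lemma conn_local:
  assumes U: "open U" "p \<in> U" and Y: "smooth_vf A U Y" and eq: "\<And>q. q \<in> U \<Longrightarrow> Y q = Z q"
  shows "D p v Y = D p v Z"
proof -
  define f where "f = (\<lambda>q. if q \<in> U then 1 else (0::real))"
  have "smooth_fun A U f \<longleftrightarrow> smooth_fun A U (\<lambda>r. 1 :: real)"
    by (rule smooth_fun_cong[OF U(1)]) (simp add: f_def)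
  then have f: "smooth_fun A U f" using smooth_fun_const by blast
  have Z: "smooth_vf A U Z" using Y smooth_vf_cong[OF U(1) eq] by auto
  have "dir_deriv A p v f = dir_deriv A p v (\<lambda>r. 1 :: real)"
    by (rule dir_deriv_cong[OF U]) (simp add: f_def)
  then have f0: "dir_deriv A p v f = 0" by (simp add: dir_deriv_eq[OF has_mderiv_const])
  have f1: "f p = 1" using U by (simp add: f_def)
  have "(\<lambda>q. f q *\<^sub>R Y q) = (\<lambda>q. f q *\<^sub>R Z q)" using eq by (auto simp: f_def)
  then show ?thesis
    using conn_scaleR[OF U Y f, of v] conn_scaleR[OF U Z f, of v] f0 f1 by simp
qed

text \<open>The Christoffel symbols at \<open>q\<close> in the chart \<open>chart_at A q\<close>, as
  a map of two vectors.\<close>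

definition chr :: "'m \<Rightarrow> real^'n \<Rightarrow> real^'n \<Rightarrow> real^'n" where
  "chr q v w = D q v (const_ext A q w)"

lemma chr_linear: "linear (chr q v)"
proof
  let ?U = "fst (chart_at A q)"
  note U = chart_open[OF chart_at(1)] chart_at(2)
  show "chr q v (a + b) = chr q v a + chr q v b" for a b
    unfolding chr_def
    by (subst conn_add[OF U smooth_vf_const_ext smooth_vf_const_ext, symmetric],
        rule conn_local[OF U smooth_vf_const_ext])
      (simp add: linear_add[OF const_ext_linear])
  show "chr q v (k *\<^sub>R a) = k *\<^sub>R chr q v a" for k a
    unfolding chr_def
    by (subst conn_scaleR_const[OF U smooth_vf_const_ext, symmetric],
        rule conn_local[OF U smooth_vf_const_ext])
      (simp add: linear_scale[OF const_ext_linear])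
qed

text \<open>The Leibniz rule on an expansion in coordinate fields. The expansion holds only inside
  the chart; \<open>conn_local\<close> permits the replacement.\<close>

lemma conn_expand:
  assumes U: "open U" "q \<in> U" and X: "smooth_vf A U X"
  shows "D q v X = vf_deriv q v X + chr q v (X q)"
proof -
  let ?c = "chart_at A q"
  let ?V = "U \<inter> fst ?c"
  define x where "x = (\<lambda>i r. to_chart A ?c r (X r) $ i)"
  define e where "e = (\<lambda>i. const_ext A q (axis i 1))"
  have V: "open ?V" "q \<in> ?V" using U chart_open[OF chart_at(1)] chart_at(2) by auto
  have xs: "smooth_fun A ?V (x i)" for i
    unfolding x_def by (rule smooth_fun_nth[OF V(1) smooth_vf_chartD[OF X chart_at(1) U(1)]])
  have es: "smooth_vf A ?V (e i)" for i
    unfolding e_def by (rule smooth_vf_subset[OF smooth_vf_const_ext]) auto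
  have xes: "smooth_vf A ?V (\<lambda>r. x i r *\<^sub>R e i r)" for i
    by (rule smooth_vf_scaleR[OF V(1) xs es])
  have xd: "dir_deriv A q v (x i) = vf_deriv q v X $ i" for i
    unfolding x_def by (rule dir_deriv_eq[OF has_mderiv_nth[OF vf_deriv_mderiv[OF U X]]])
  have bex: "w = (\<Sum>i\<in>UNIV. w $ i *\<^sub>R axis i 1)" for w :: "real^'n"
    by (simp add: basis_expansion flip: scalar_mult_eq_scaleR)
  have "D q v X = D q v (\<lambda>r. \<Sum>i\<in>UNIV. x i r *\<^sub>R e i r)"
  proof (rule conn_local[OF V smooth_vf_subset[OF X]])
    fix r assume "r \<in> ?V"
    then show "X r = (\<Sum>i\<in>UNIV. x i r *\<^sub>R e i r)"
      unfolding x_def e_def by (intro vf_expand) auto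
  qed auto
  also have "\<dots> = (\<Sum>i\<in>UNIV. D q v (\<lambda>r. x i r *\<^sub>R e i r))"
    by (rule conn_sum[OF V xes]) auto
  also have "\<dots> = (\<Sum>i\<in>UNIV. vf_deriv q v X $ i *\<^sub>R axis i 1 + X q $ i *\<^sub>R chr q v (axis i 1))"
    by (rule sum.cong, rule refl)
      (simp add: conn_scaleR[OF V es xs] xd, simp add: e_def x_def const_ext_self to_chart_self chr_def)
  also have "\<dots> = (\<Sum>i\<in>UNIV. vf_deriv q v X $ i *\<^sub>R axis i 1) + chr q v (\<Sum>i\<in>UNIV. X q $ i *\<^sub>R axis i 1)"
    by (simp add: sum.distrib linear_sum[OF chr_linear] linear_scale[OF chr_linear])
  finally show ?thesis by (simp only: bex[symmetric])
qed

text \<open>The bracket is the antisymmetrised derivative of components and so cancels the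
  \<open>vf_deriv\<close> parts: the torsion is a tensor.\<close>

lemma torsion_fields:
  assumes "open U" "q \<in> U" "smooth_vf A U X" "smooth_vf A U Y"
  shows "D q (X q) Y - D q (Y q) X - lie_bracket A X Y q = chr q (X q) (Y q) - chr q (Y q) (X q)"
  using conn_expand[OF assms(1,2)] assms(3,4) by (simp add: lie_bracket_def vf_deriv_def)

lemma torsion_form_chr: "torsion_form A g D q [x, y, z] = g q (chr q x y - chr q y x) z"
  by (simp add: torsion_form_def Let_def const_ext_self lie_bracket_const_ext[OF chart_at(2)] chr_def)

end

lemma is_form_linear: "is_form k \<alpha> \<Longrightarrow> length vs = k \<Longrightarrow> i < k \<Longrightarrow> linear (\<lambda>v. \<alpha> (vs[i := v]))"
  unfolding is_form_def by blast

lemma form3_linear: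
  assumes "is_form 3 \<alpha>"
  shows "linear (\<lambda>x. \<alpha> [x, y, z])" "linear (\<lambda>y. \<alpha> [x, y, z])" "linear (\<lambda>z. \<alpha> [x, y, z])"
  using is_form_linear[OF assms, of "[undefined, y, z]" 0] is_form_linear[OF assms, of "[x, undefined, z]" 1]
    is_form_linear[OF assms, of "[x, y, undefined]" 2] by simp_all

context conn begin

lemma cov_form_fields:
  assumes \<alpha>: "smooth_form A 3 \<alpha>" and U: "open U" "q \<in> U"
    and X: "smooth_vf A U X" "smooth_vf A U Y" "smooth_vf A U Z"
  shows "mdiff q (\<lambda>r. \<alpha> r [X r, Y r, Z r])"
    and "dir_deriv A q v (\<lambda>r. \<alpha> r [X r, Y r, Z r]) = cov_form A D \<alpha> q v [X q, Y q, Z q] +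
      \<alpha> q [D q v X, Y q, Z q] + \<alpha> q [X q, D q v Y, Z q] + \<alpha> q [X q, Y q, D q v Z]"
proof -
  have f: "is_form 3 (\<alpha> r)" for r using \<alpha> by (simp add: smooth_form_def)
  note l = form3_linear[OF f]
  have m0: "mdiff q (\<lambda>r. \<alpha> r [const_ext A q x r, const_ext A q y r, const_ext A q z r])" for x y z
  proof -
    have "smooth_on (snd (chart_at A q) ` fst (chart_at A q))
       ((\<lambda>r. \<alpha> r (map (from_chart A (chart_at A q) r) [x, y, z])) \<circ> chart_inv (chart_at A q))"
      by (rule bspec[OF conjunct2[OF \<alpha>[unfolded smooth_form_def]] chart_at(1), rule_format]) simp
    from smooth_fun_chartI[OF chart_at(1) chart_open[OF chart_at(1)] order_refl this]
    have "smooth_fun A (fst (chart_at A q)) (\<lambda>r. \<alpha> r (map (from_chart A (chart_at A q) r) [x, y, z]))" .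
    from smooth_fun_mdiff[OF this chart_at(2)] show ?thesis by (simp add: const_ext_def)
  qed
  \<comment> \<open>The constant extensions are replaced by fields in the last slot, then in the
    second, then in the first.\<close>
  note s1 = linear_slot_deriv[where L = "\<lambda>r z. \<alpha> r [const_ext A q x r, const_ext A q y r, z]" for x y,
      OF l(3) m0 U X(3)]
  note s2 = linear_slot_deriv[where L = "\<lambda>r y. \<alpha> r [const_ext A q x r, y, Z r]" for x, OF l(2) s1(1) U X(2)]
  note s3 = linear_slot_deriv[where L = "\<lambda>r x. \<alpha> r [x, Y r, Z r]", OF l(1) s2(1) U X(1)]
  show "mdiff q (\<lambda>r. \<alpha> r [X r, Y r, Z r])" by (rule s3(1))
  have D: "D q v W = vf_deriv q v W + chr q v (W q)" if "smooth_vf A U W" for W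
    by (rule conn_expand[OF U that])
  show "dir_deriv A q v (\<lambda>r. \<alpha> r [X r, Y r, Z r]) = cov_form A D \<alpha> q v [X q, Y q, Z q] +
      \<alpha> q [D q v X, Y q, Z q] + \<alpha> q [X q, D q v Y, Z q] + \<alpha> q [X q, Y q, D q v Z]"
    unfolding s3(2) s2(2) s1(2) D[OF X(1)] D[OF X(2)] D[OF X(3)]
    by (simp add: linear_add[OF l(1)] linear_add[OF l(2)] linear_add[OF l(3)] const_ext_self
        cov_form_def chr_def lessThan_Suc eval_nat_numeral)
qed

text \<open>The covariant derivative of the metric for an arbitrary connection;
  \<open>metric_parallel\<close> shows that it vanishes when the connection preserves the
  three-form.\<close>

definition cov_metric :: "('m \<Rightarrow> real^'n \<Rightarrow> real^'n \<Rightarrow> real) \<Rightarrow> 'm \<Rightarrow> real^'n \<Rightarrow> real^'n \<Rightarrow> real^'n \<Rightarrow> real" where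
  "cov_metric g q v x y = dir_deriv A q v (\<lambda>r. g r (const_ext A q x r) (const_ext A q y r))
     - g q (chr q v x) y - g q x (chr q v y)"

lemma metric_linear:
  assumes "riemannian_metric A g"
  shows "linear (\<lambda>x. g q x y)" "linear (g q x)"
  using assms by (auto simp: riemannian_metric_def inner_product_def bilinear_def)

lemma metric_mdiff0:
  assumes g: "riemannian_metric A g"
  shows "mdiff q (\<lambda>r. g r (const_ext A q x r) (const_ext A q y r))"
proof -
  have "smooth_fun A (fst (chart_at A q)) (\<lambda>r. g r (from_chart A (chart_at A q) r x) (from_chart A (chart_at A q) r y))"
    by (rule smooth_fun_chartI[OF chart_at(1) chart_open[OF chart_at(1)] order_refl])
      (use g chart_at(1)[of q] in \<open>simp add: riemannian_metric_def\<close>)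
  from smooth_fun_mdiff[OF this chart_at(2)] show ?thesis by (simp add: const_ext_def)
qed

lemma cov_metric_fields:
  assumes g: "riemannian_metric A g" and U: "open U" "q \<in> U"
    and X: "smooth_vf A U X" "smooth_vf A U Y"
  shows "mdiff q (\<lambda>r. g r (X r) (Y r))"
    and "dir_deriv A q v (\<lambda>r. g r (X r) (Y r)) = cov_metric g q v (X q) (Y q) +
      g q (D q v X) (Y q) + g q (X q) (D q v Y)"
proof -
  note l = metric_linear[OF g]
  note s1 = linear_slot_deriv[where L = "\<lambda>r y. g r (const_ext A q x r) y" for x, OF l(2) metric_mdiff0[OF g] U X(2)]
  note s2 = linear_slot_deriv[where L = "\<lambda>r x. g r x (Y r)", OF l(1) s1(1) U X(1)]
  show "mdiff q (\<lambda>r. g r (X r) (Y r))" by (rule s2(1))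
  show "dir_deriv A q v (\<lambda>r. g r (X r) (Y r)) = cov_metric g q v (X q) (Y q) +
      g q (D q v X) (Y q) + g q (X q) (D q v Y)"
    unfolding s2(2) s1(2) conn_expand[OF U X(1)] conn_expand[OF U X(2)]
    by (simp add: linear_add[OF l(1)] linear_add[OF l(2)] const_ext_self cov_metric_def)
qed

lemma cov_metric_linear:
  assumes g: "riemannian_metric A g"
  shows "linear (\<lambda>x. cov_metric g q v x y)" "linear (cov_metric g q v x)"
proof -
  note l = metric_linear[OF g]
  note c = chart_open[OF chart_at(1)] chart_at(2)
  note m = metric_mdiff0[OF g, unfolded mdiff_def]
  note sm = chr_linear[THEN linear_add] chr_linear[THEN linear_scale] 
    l(1)[THEN linear_add] l(1)[THEN linear_scale] l(2)[THEN linear_add] l(2)[THEN linear_scale]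
    const_ext_linear[THEN linear_add] const_ext_linear[THEN linear_scale]
  have 1: "dir_deriv A q v (\<lambda>r. g r (const_ext A q (a + b) r) (const_ext A q y r)) =
      dir_deriv A q v (\<lambda>r. g r (const_ext A q a r) (const_ext A q y r)) +
      dir_deriv A q v (\<lambda>r. g r (const_ext A q b r) (const_ext A q y r))" for a b y
    by (rule dir_deriv_eq[OF has_mderiv_cong[OF c _ has_mderiv_add[OF m m]]]) (simp add: sm)
  have 2: "dir_deriv A q v (\<lambda>r. g r (const_ext A q (k *\<^sub>R a) r) (const_ext A q y r)) =
      k * dir_deriv A q v (\<lambda>r. g r (const_ext A q a r) (const_ext A q y r))" for k a y
    by (rule dir_deriv_eq[OF has_mderiv_cong[OF c _ has_mderiv_linear[OF bounded_linear_mult_right m]]])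
      (simp add: sm)
  have 3: "dir_deriv A q v (\<lambda>r. g r (const_ext A q x r) (const_ext A q (a + b) r)) =
      dir_deriv A q v (\<lambda>r. g r (const_ext A q x r) (const_ext A q a r)) +
      dir_deriv A q v (\<lambda>r. g r (const_ext A q x r) (const_ext A q b r))" for a b x
    by (rule dir_deriv_eq[OF has_mderiv_cong[OF c _ has_mderiv_add[OF m m]]]) (simp add: sm)
  have 4: "dir_deriv A q v (\<lambda>r. g r (const_ext A q x r) (const_ext A q (k *\<^sub>R a) r)) =
      k * dir_deriv A q v (\<lambda>r. g r (const_ext A q x r) (const_ext A q a r))" for k a x
    by (rule dir_deriv_eq[OF has_mderiv_cong[OF c _ has_mderiv_linear[OF bounded_linear_mult_right m]]])
      (simp add: sm)
  show "linear (\<lambda>x. cov_metric g q v x y)" "linear (cov_metric g q v x)"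
    by (rule linearI; simp add: cov_metric_def 1 2 3 4 sm algebra_simps)+
qed


end


section \<open>Alternating forms\<close>

lemma form_linear:
  assumes "is_form k f" "Suc (length pre + length post) = k"
  shows "linear (\<lambda>v. f (pre @ v # post))"
  using is_form_linear[OF assms(1), of "pre @ undefined # post" "length pre"] assms(2) by simp

lemma form_repeated_nth:
  "is_form k f \<Longrightarrow> length vs = k \<Longrightarrow> i < j \<Longrightarrow> j < k \<Longrightarrow> vs ! i = vs ! j \<Longrightarrow> f vs = 0"
  unfolding is_form_def by blast

lemma form_repeated:
  assumes "is_form k f" "length (pre @ x # x # post) = k"
  shows "f (pre @ x # x # post) = 0"
  using assms(2) by (intro form_repeated_nth[OF assms, of "length pre" "Suc (length pre)"]) (auto simp: nth_append)

lemma form_swap: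
  assumes "is_form k f" "length (pre @ x # y # post) = k"
  shows "f (pre @ x # y # post) = - f (pre @ y # x # post)"
proof -
  have l1: "linear (\<lambda>v. f (pre @ v # z # post))" for z using assms by (intro form_linear[of k]) auto
  have l2: "linear (\<lambda>v. f (pre @ z # v # post))" for z
    using form_linear[OF assms(1), of "pre @ [z]" post] assms by simp
  have 0: "f (pre @ z # z # post) = 0" for z using assms by (intro form_repeated[of k]) auto
  have "0 = f (pre @ (x + y) # (x + y) # post)" using 0 by simp
  also have "\<dots> = f (pre @ x # x # post) + f (pre @ x # y # post) + (f (pre @ y # x # post) + f (pre @ y # y # post))"
    by (simp only: linear_add[OF l1] linear_add[OF l2])
  finally show ?thesis using 0 by simp
qed

text \<open>Vanishing on adjacent equal arguments gives, by polarisation, a sign under adjacent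
  swaps, and these bring equal arguments together from any distance.\<close>

lemma is_formI:
  assumes lin: "\<And>pre post. Suc (length pre + length post) = k \<Longrightarrow> linear (\<lambda>v. f (pre @ v # post))"
    and adj: "\<And>pre x post. length pre + length post + 2 = k \<Longrightarrow> f (pre @ x # x # post) = 0"
  shows "is_form k f"
proof -
  have swap: "f (pre @ x # y # post) = - f (pre @ y # x # post)" if k: "length pre + length post + 2 = k" for pre x y post
  proof -
    have l1: "linear (\<lambda>v. f (pre @ v # z # post))" for z using k by (intro lin) auto
    have l2: "linear (\<lambda>v. f (pre @ z # v # post))" for z
      using lin[of "pre @ [z]" post] k by simp
    have "0 = f (pre @ (x + y) # (x + y) # post)" using adj k by simp
    also have "\<dots> = f (pre @ x # x # post) + f (pre @ x # y # post) + (f (pre @ y # x # post) + f (pre @ y # y # post))"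
      by (simp only: linear_add[OF l1] linear_add[OF l2])
    finally show ?thesis using adj k by simp
  qed
  have rep: "f (pre @ x # mid @ x # post) = 0" if "length pre + length mid + length post + 2 = k" for pre x mid post
    using that
  proof (induction mid arbitrary: pre)
    case Nil
    then show ?case using adj by simp
  next
    case (Cons y mid)
    have "f (pre @ x # y # mid @ x # post) = - f ((pre @ [y]) @ x # mid @ x # post)"
      using swap[of pre "mid @ x # post" x y] Cons.prems by simp
    also have "f ((pre @ [y]) @ x # mid @ x # post) = 0" by (rule Cons.IH) (use Cons.prems in simp)
    finally show ?case by simp
  qed
  show ?thesis
    unfolding is_form_def
  proof (intro conjI allI impI)
    fix vs :: "'a list" and i assume *: "length vs = k \<and> i < k"
    then have "vs[i := v] = take i vs @ v # drop (Suc i) vs" for v by (simp add: upd_conv_take_nth_drop)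
    then show "linear (\<lambda>v. f (vs[i := v]))" using lin[of "take i vs" "drop (Suc i) vs"] * by simp
  next
    fix vs :: "'a list" and i j assume *: "length vs = k \<and> i < j \<and> j < k \<and> vs ! i = vs ! j"
    have "vs = take i vs @ vs ! i # drop (Suc i) vs" by (rule id_take_nth_drop) (use * in simp)
    moreover have "drop (Suc i) vs = take (j - Suc i) (drop (Suc i) vs) @ vs ! j # drop (Suc j) vs"
    proof -
      have "j - Suc i < length (drop (Suc i) vs)" using * by simp linarith
      from id_take_nth_drop[OF this] show ?thesis using * by simp
    qed
    ultimately have "vs = take i vs @ vs ! i # take (j - Suc i) (drop (Suc i) vs) @ vs ! i # drop (Suc j) vs"
      using * by metis
    moreover have "f (take i vs @ vs ! i # take (j - Suc i) (drop (Suc i) vs) @ vs ! i # drop (Suc j) vs) = 0"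
      by (rule rep) (use * in auto)
    ultimately show "f vs = 0" by simp
  qed
qed

lemma form_contract:
  assumes "is_form (Suc k) f"
  shows "is_form k (contract x f)"
proof (rule is_formI)
  show "linear (\<lambda>v. contract x f (pre @ v # post))" if "Suc (length pre + length post) = k" for pre post
    using form_linear[OF assms, of "x # pre" post] that by (simp add: contract_def)
  show "contract x f (pre @ y # y # post) = 0" if "length pre + length post + 2 = k" for pre y post
    using form_repeated[OF assms, of "x # pre" y post] that by (simp add: contract_def)
qed

lemma linear_lincomb: "linear f \<Longrightarrow> linear h \<Longrightarrow> linear (\<lambda>v. a * f v + b * h v :: real)"
  by (auto intro!: linearI simp: linear_add linear_scale algebra_simps)

lemma form_lincomb:
  assumes "is_form k f" "is_form k h"
  shows "is_form k (\<lambda>vs. a * f vs + b * h vs)"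
proof (rule is_formI)
  show "linear (\<lambda>v. a * f (pre @ v # post) + b * h (pre @ v # post))" if "Suc (length pre + length post) = k" for pre post
    using that assms by (intro linear_lincomb form_linear) auto
  show "a * f (pre @ y # y # post) + b * h (pre @ y # y # post) = 0" if "length pre + length post + 2 = k" for pre y post
    using that assms form_repeated[of k f pre y post] form_repeated[of k h pre y post] by simp
qed

lemma form_sum:
  assumes "finite I" "\<And>i. i \<in> I \<Longrightarrow> is_form k (f i)"
  shows "is_form k (\<lambda>vs. \<Sum>i\<in>I. a i * f i vs)"
  using assms
proof (induction I)
  case empty
  then show ?case by (auto intro!: is_formI linearI)
next
  case (insert i I)
  then have "is_form k (\<lambda>vs. a i * f i vs + 1 * (\<Sum>i\<in>I. a i * f i vs))"
    by (intro form_lincomb) auto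
  then show ?case using insert by simp
qed

text \<open>Sorting the indices by adjacent transpositions only changes signs.\<close>

primrec inversions :: "nat list \<Rightarrow> nat" where
  "inversions [] = 0"
| "inversions (i # I) = length (filter (\<lambda>j. j < i) I) + inversions I"

lemma form_insort:
  fixes e :: "nat \<Rightarrow> 'v::real_vector"
  assumes "is_form k f" "sorted J" "length (pre @ map e (x # J) @ post) = k"
  shows "f (pre @ map e (x # J) @ post) =
    (- 1) ^ length (filter (\<lambda>j. j < x) J) * f (pre @ map e (insort x J) @ post)"
  using assms(2,3)
proof (induction J arbitrary: pre)
  case (Cons y J)
  show ?case
  proof (cases "x \<le> y")
    case True
    then have "filter (\<lambda>j. j < x) (y # J) = []" using Cons.prems by (auto simp: filter_empty_conv)
    then show ?thesis using True by simp
  next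
    case False
    have "f (pre @ map e (x # y # J) @ post) = - f ((pre @ [e y]) @ map e (x # J) @ post)"
      using form_swap[OF assms(1), of pre "e x" "e y" "map e J @ post"] Cons.prems by simp
    then show ?thesis using Cons.IH[of "pre @ [e y]"] Cons.prems False by simp
  qed
qed simp

lemma form_sort:
  fixes e :: "nat \<Rightarrow> 'v::real_vector"
  assumes "is_form k f" "length (pre @ map e J) = k"
  shows "f (pre @ map e J) = (- 1) ^ inversions J * f (pre @ map e (sort J))"
  using assms(2)
proof (induction J arbitrary: pre)
  case (Cons x J)
  have "f (pre @ map e (x # sort J) @ []) =
     (- 1) ^ length (filter (\<lambda>j. j < x) (sort J)) * f (pre @ map e (insort x (sort J)) @ [])"
    by (rule form_insort[OF assms(1)]) (use Cons.prems in simp_all)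
  moreover have "length (filter (\<lambda>j. j < x) (sort J)) = length (filter (\<lambda>j. j < x) J)"
    by (simp add: filter_sort)
  ultimately show ?case using Cons.IH[of "pre @ [e x]"] Cons.prems by (simp add: power_add)
qed simp

lemma form_zero_basis_list:
  fixes e :: "nat \<Rightarrow> 'v::real_vector"
  assumes f: "is_form k f" and z: "\<And>I. I \<in> incr k \<Longrightarrow> f (map e I) = 0"
    and J: "length J = k" "set J \<subseteq> {1..7}"
  shows "f (map e J) = 0"
proof (cases "distinct J")
  case True
  then have "sort J \<in> incr k" using J by (simp add: incr_def strict_sorted_iff)
  then show ?thesis using z form_sort[OF f, of "[]" e J] J by simp
next
  case False
  then obtain i j where "i < j" "j < length J" "J ! i = J ! j"
    unfolding distinct_conv_nth by (metis linorder_neqE_nat)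
  then show ?thesis using J by (intro form_repeated_nth[OF f, of _ i j]) auto
qed

text \<open>The arguments are expanded in the basis one at a time, from the last to the first, until
  only basis vectors remain; sorting reduces those to increasing lists.\<close>

lemma form_zero:
  fixes e :: "nat \<Rightarrow> 'v::real_vector"
  assumes basis: "\<And>x. \<exists>a. x = (\<Sum>i=1..7. a i *\<^sub>R e i)"
    and f: "is_form k f" and z: "\<And>I. I \<in> incr k \<Longrightarrow> f (map e I) = 0" and vs: "length vs = k"
  shows "f vs = 0"
proof -
  have "f (us @ map e J) = 0" if "length us + length J = k" "set J \<subseteq> {1..7}" for us J
    using that
  proof (induction us arbitrary: J rule: rev_induct)
    case Nil
    then show ?case using form_zero_basis_list[OF f z] by simp
  next
    case (snoc u us)
    obtain a where a: "u = (\<Sum>i=1..7. a i *\<^sub>R e i)" using basis by blast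
    have l: "linear (\<lambda>v. f (us @ v # map e J))" using snoc.prems by (intro form_linear[OF f]) simp
    have "f (us @ e i # map e J) = 0" if "i \<in> {1..7}" for i
      using snoc.IH[of "i # J"] snoc.prems that by simp
    then show ?case by (simp add: a linear_sum[OF l] linear_scale[OF l])
  qed
  from this[of vs "[]"] vs show ?thesis by simp
qed

subsection \<open>Wedge products\<close>

lemma wedge_0: "wedge 0 f h vs = f [] * h vs"
proof -
  have *: "{S. S \<subseteq> {..<length vs} \<and> card S = 0} = {{}}" by (auto dest: finite_subset)
  show ?thesis by (simp add: wedge_def * nths_all)
qed

lemma wedge_Nil: "wedge (Suc k) f h [] = 0"
  by (auto simp: wedge_def intro: sum.neutral)

lemma nths_Cons_shift: "nths (v # vs) (insert 0 (Suc ` S)) = v # nths vs S" "nths (v # vs) (Suc ` S) = nths vs S"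
  "nths (v # vs) (- insert 0 (Suc ` S)) = nths vs (- S)" "nths (v # vs) (- Suc ` S) = v # nths vs (- S)"
proof -
  have *: "{j. Suc j \<in> insert 0 (Suc ` S)} = S" "{j. Suc j \<in> Suc ` S} = S"
    "{j. Suc j \<in> - insert 0 (Suc ` S)} = - S" "{j. Suc j \<in> - Suc ` S} = - S" by auto
  show "nths (v # vs) (insert 0 (Suc ` S)) = v # nths vs S" "nths (v # vs) (Suc ` S) = nths vs S"
    "nths (v # vs) (- insert 0 (Suc ` S)) = nths vs (- S)" "nths (v # vs) (- Suc ` S) = v # nths vs (- S)"
    unfolding nths_Cons * by auto
qed

lemma card_subsets_Suc:
  "{S. S \<subseteq> {..<Suc n} \<and> card S = Suc k} =
    (\<lambda>S. insert 0 (Suc ` S)) ` {S. S \<subseteq> {..<n} \<and> card S = k} \<union> (\<lambda>S. Suc ` S) ` {S. S \<subseteq> {..<n} \<and> card S = Suc k}"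
  (is "?L = ?R")
proof
  show "?R \<subseteq> ?L"
  proof
    fix T assume "T \<in> ?R"
    then consider S where "S \<subseteq> {..<n}" "card S = k" "T = insert 0 (Suc ` S)"
      | S where "S \<subseteq> {..<n}" "card S = Suc k" "T = Suc ` S" by auto
    then show "T \<in> ?L"
    proof cases
      case 1
      then have "finite S" using finite_subset[of S "{..<n}"] by simp
      then have "card T = Suc k" using 1 by (simp add: card_insert_if card_image)
      then show ?thesis using 1 by auto
    next
      case 2
      then show ?thesis by (auto simp: card_image)
    qed
  qed
  show "?L \<subseteq> ?R"
  proof
    fix T assume T: "T \<in> ?L"
    define S where "S = {j. Suc j \<in> T}"
    have fin: "finite T" using T finite_subset[of T "{..<Suc n}"] by simp
    have S: "S \<subseteq> {..<n}" using T by (auto simp: S_def)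
    show "T \<in> ?R"
    proof (cases "0 \<in> T")
      case True
      have TS: "T = insert 0 (Suc ` S)"
      proof (rule set_eqI)
        show "x \<in> T \<longleftrightarrow> x \<in> insert 0 (Suc ` S)" for x using True by (cases x) (auto simp: S_def)
      qed
      have "finite S" using S finite_subset[of S "{..<n}"] by simp
      then have "card T = Suc (card S)" by (simp add: TS card_insert_if card_image)
      then show ?thesis using T S TS by auto
    next
      case False
      have TS: "T = Suc ` S"
      proof (rule set_eqI)
        show "x \<in> T \<longleftrightarrow> x \<in> Suc ` S" for x using False by (cases x) (auto simp: S_def)
      qed
      then have "card T = card S" by (simp add: card_image)
      then show ?thesis using T S TS by auto
    qed
  qed
qed

text \<open>The first argument goes either to \<open>f\<close> or to \<open>h\<close>; in the second case it is passed by all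
  the arguments of \<open>f\<close>.\<close>

lemma wedge_Cons:
  "wedge (Suc k) f h (v # vs) = wedge k (contract v f) h vs + (- 1) ^ Suc k * wedge (Suc k) f (contract v h) vs"
proof -
  let ?n = "length vs"
  let ?inv = "\<lambda>n S. {(i, j). i \<in> S \<and> j \<in> {..<n} - S \<and> j < i}"
  define t where "t = (\<lambda>S. (- 1) ^ card (?inv (Suc ?n) S) * f (nths (v # vs) S) * h (nths (v # vs) (- S)))"
  let ?P = "\<lambda>n k. {S. S \<subseteq> {..<n} \<and> card S = k}"
  let ?a = "\<lambda>S. insert (0::nat) (Suc ` S)" and ?b = "\<lambda>S. Suc ` S"
  have fin: "finite (?P n k)" for n k :: nat by (rule finite_subset[of _ "Pow {..<n}"]) auto
  have inja: "inj_on ?a X" for X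
    by (rule inj_onI) (metis (no_types, lifting) nths_Cons_shift(1) Diff_insert_absorb imageE inj_image_eq_iff inj_Suc nat.distinct(1))
  have injb: "inj_on ?b X" for X by (rule inj_onI) (simp add: inj_image_eq_iff)
  have "wedge (Suc k) f h (v # vs) = sum t (?P (Suc ?n) (Suc k))" by (simp add: wedge_def t_def)
  also have "\<dots> = sum t (?a ` ?P ?n k) + sum t (?b ` ?P ?n (Suc k))"
    unfolding card_subsets_Suc by (rule sum.union_disjoint) (auto simp: fin)
  also have "sum t (?a ` ?P ?n k) = wedge k (contract v f) h vs"
  proof -
    have "t (?a S) = (- 1) ^ card (?inv ?n S) * contract v f (nths vs S) * h (nths vs (- S))" for S
    proof -
      have "?inv (Suc ?n) (?a S) = map_prod Suc Suc ` ?inv ?n S"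
      proof (rule set_eqI)
        show "x \<in> ?inv (Suc ?n) (?a S) \<longleftrightarrow> x \<in> map_prod Suc Suc ` ?inv ?n S" for x
          by (cases x; cases "fst x"; cases "snd x") (auto simp: image_iff)
      qed
      then have "card (?inv (Suc ?n) (?a S)) = card (?inv ?n S)"
        by (simp add: card_image prod.inj_map inj_on_def)
      then show ?thesis by (simp add: t_def nths_Cons_shift contract_def)
    qed
    then show ?thesis by (simp add: sum.reindex[OF inja] wedge_def)
  qed
  also have "sum t (?b ` ?P ?n (Suc k)) = (- 1) ^ Suc k * wedge (Suc k) f (contract v h) vs"
  proof -
    have "t (?b S) = (- 1) ^ Suc k * ((- 1) ^ card (?inv ?n S) * f (nths vs S) * contract v h (nths vs (- S)))"
      if S: "S \<in> ?P ?n (Suc k)" for S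
    proof -
      have "finite S" using S finite_subset[of S "{..<?n}"] by simp
      have "?inv (Suc ?n) (?b S) = map_prod Suc Suc ` ?inv ?n S \<union> (\<lambda>i. (Suc i, 0)) ` S"
      proof (rule set_eqI)
        show "x \<in> ?inv (Suc ?n) (?b S) \<longleftrightarrow> x \<in> map_prod Suc Suc ` ?inv ?n S \<union> (\<lambda>i. (Suc i, 0)) ` S" for x
          by (cases x; cases "fst x"; cases "snd x") (auto simp: image_iff)
      qed
      moreover have "finite (?inv ?n S)"
        by (rule finite_subset[of _ "S \<times> {..<?n}"]) (use \<open>finite S\<close> in auto)
      ultimately have "card (?inv (Suc ?n) (?b S)) = card (map_prod Suc Suc ` ?inv ?n S) + card ((\<lambda>i. (Suc i, 0::nat)) ` S)"
        using \<open>finite S\<close> by (auto intro!: card_Un_disjoint)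
      also have "\<dots> = card (?inv ?n S) + Suc k"
        using S by (simp add: card_image prod.inj_map inj_on_def)
      finally show ?thesis by (simp add: t_def nths_Cons_shift contract_def power_add)
    qed
    then show ?thesis by (simp add: sum.reindex[OF injb] wedge_def sum_distrib_left)
  qed
  finally show ?thesis .
qed

lemma wedge1_Cons: "wedge 1 (flat g u) h (v # vs) = g u v * h vs - wedge 1 (flat g u) (contract v h) vs"
  by (simp add: wedge_Cons wedge_0 contract_def flat_def)

lemma wedge1_zero: "(\<And>v. v \<in> set vs \<Longrightarrow> g u v = 0) \<Longrightarrow> wedge 1 (flat g u) h vs = 0"
proof (induction vs arbitrary: h)
  case Nil
  then show ?case by (simp add: wedge_Nil)
next
  case (Cons v vs)
  then show ?case by (simp add: wedge1_Cons del: One_nat_def)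
qed

lemma wedge1_cong:
  "(\<And>us. set us \<subseteq> set vs \<Longrightarrow> Suc (length us) = length vs \<Longrightarrow> h us = h' us) \<Longrightarrow> wedge 1 (flat g u) h vs = wedge 1 (flat g u) h' vs"
proof (induction vs arbitrary: h h')
  case Nil
  then show ?case by (simp add: wedge_Nil)
next
  case (Cons v vs)
  have "wedge 1 (flat g u) (contract v h) vs = wedge 1 (flat g u) (contract v h') vs"
    by (rule Cons.IH, unfold contract_def, rule Cons.prems) auto
  moreover have "h vs = h' vs" by (rule Cons.prems) auto
  ultimately show ?case by (simp add: wedge1_Cons del: One_nat_def)
qed

lemma wedge1_lincomb: "wedge 1 (flat g u) (\<lambda>us. a * h us + b * h' us) vs = a * wedge 1 (flat g u) h vs + b * wedge 1 (flat g u) h' vs"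
proof (induction vs arbitrary: h h')
  case Nil
  then show ?case by (simp add: wedge_Nil)
next
  case (Cons v vs)
  have "contract v (\<lambda>us. a * h us + b * h' us) = (\<lambda>us. a * contract v h us + b * contract v h' us)"
    by (simp add: contract_def)
  then show ?case using Cons.IH by (simp add: wedge1_Cons algebra_simps del: One_nat_def)
qed

text \<open>Both properties are proved by induction on the arguments in front of the slots
  concerned: peeling off one of them leaves a multiple of \<open>h\<close> and the wedge product
  with a contraction of \<open>h\<close>.\<close>

lemma form_wedge1:
  assumes g: "linear (g u)" and h: "is_form k h"
  shows "is_form (Suc k) (wedge 1 (flat g u) h)"
proof (rule is_formI)
  show "linear (\<lambda>v. wedge 1 (flat g u) h (pre @ v # post))" if "Suc (length pre + length post) = Suc k" for pre post
    using that h
  proof (induction pre arbitrary: h k)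
    case Nil
    have c: "linear (\<lambda>v. contract v h us)" if "Suc (length us) = length post" for us
      using form_linear[OF Nil(2), of "[]" us] Nil(1) that by (simp add: contract_def)
    show ?case
    proof (rule linearI)
      fix x y :: 'a and r :: real
      have "wedge 1 (flat g u) (contract (x + y) h) post
         = wedge 1 (flat g u) (\<lambda>us. 1 * contract x h us + 1 * contract y h us) post"
        by (rule wedge1_cong) (simp add: linear_add[OF c])
      then show "wedge 1 (flat g u) h ([] @ (x + y) # post)
         = wedge 1 (flat g u) h ([] @ x # post) + wedge 1 (flat g u) h ([] @ y # post)"
        unfolding wedge1_lincomb by (simp add: wedge1_Cons linear_add[OF g] algebra_simps del: One_nat_def)
      have "wedge 1 (flat g u) (contract (r *\<^sub>R x) h) post
         = wedge 1 (flat g u) (\<lambda>us. r * contract x h us + 0 * contract x h us) post"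
        by (rule wedge1_cong) (simp add: linear_scale[OF c])
      then show "wedge 1 (flat g u) h ([] @ (r *\<^sub>R x) # post) = r *\<^sub>R wedge 1 (flat g u) h ([] @ x # post)"
        unfolding wedge1_lincomb by (simp add: wedge1_Cons linear_scale[OF g] algebra_simps del: One_nat_def)
    qed
  next
    case (Cons p pre)
    then obtain m where k: "k = Suc m" by (cases k) auto
    have "linear (\<lambda>v. wedge 1 (flat g u) (contract p h) (pre @ v # post))"
      by (rule Cons.IH[of m]) (use Cons.prems k form_contract in auto)
    moreover have "linear (\<lambda>v. h (pre @ v # post))" using Cons.prems by (intro form_linear) auto
    ultimately have "linear (\<lambda>v. g u p * h (pre @ v # post) + (-1) * wedge 1 (flat g u) (contract p h) (pre @ v # post))"
      by (intro linear_lincomb)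
    then show ?case by (simp add: wedge1_Cons del: One_nat_def)
  qed
  show "wedge 1 (flat g u) h (pre @ x # x # post) = 0" if "length pre + length post + 2 = Suc k" for pre x post
    using that h
  proof (induction pre arbitrary: h k)
    case Nil
    \<comment> \<open>Peeling off both copies of \<open>x\<close> produces the product of
      \<open>g u x\<close> with \<open>h (x # post)\<close> twice, with opposite signs; what remains
      contracts \<open>h\<close> with \<open>x\<close> twice.\<close>
    have "wedge 1 (flat g u) (contract x (contract x h)) post = wedge 1 (flat g u) (\<lambda>us. 0 * h us + 0 * h us) post"
    proof (rule wedge1_cong)
      fix us :: "'a list" assume "Suc (length us) = length post"
      then show "contract x (contract x h) us = 0 * h us + 0 * h us"
        using form_repeated[OF Nil(2), of "[]" x us] Nil(1) by (simp add: contract_def)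
    qed
    then show ?case unfolding wedge1_lincomb by (simp add: wedge1_Cons contract_def del: One_nat_def)
  next
    case (Cons p pre)
    then obtain m where k: "k = Suc m" by (cases k) auto
    have "wedge 1 (flat g u) (contract p h) (pre @ x # x # post) = 0"
      by (rule Cons.IH[of m]) (use Cons.prems k form_contract in auto)
    moreover have "h (pre @ x # x # post) = 0" using Cons.prems by (intro form_repeated[of k]) auto
    ultimately show ?case by (simp add: wedge1_Cons del: One_nat_def)
  qed
qed

lemma form_ewedge:
  assumes "\<And>u. linear (g u)"
  shows "is_form (length I) (ewedge g e I)"
proof (induction I)
  case Nil
  show ?case by (rule is_formI) auto
next
  case (Cons i I)
  then show ?case using form_wedge1[OF assms] by (simp del: One_nat_def)
qed

lemma ewedge_self:
  assumes "\<And>i j. i \<in> set I \<Longrightarrow> j \<in> set I \<Longrightarrow> g (e i) (e j) = (if i = j then 1 else 0)" "distinct I"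
  shows "ewedge g e I (map e I) = 1"
  using assms
proof (induction I)
  case (Cons i I)
  have "wedge 1 (flat g (e i)) (contract (e i) (ewedge g e I)) (map e I) = 0"
    by (rule wedge1_zero) (use Cons.prems in auto)
  then show ?case using Cons by (simp add: wedge1_Cons del: One_nat_def)
qed simp

lemma ewedge_zero:
  "i \<in> set I \<Longrightarrow> (\<And>v. v \<in> set vs \<Longrightarrow> g (e i) v = 0) \<Longrightarrow> ewedge g e I vs = 0"
proof (induction I arbitrary: vs)
  case (Cons j I)
  show ?case
  proof (cases "j = i")
    case True
    then show ?thesis using Cons.prems by (simp add: wedge1_zero del: One_nat_def)
  next
    case False
    have "wedge 1 (flat g (e j)) (ewedge g e I) vs = wedge 1 (flat g (e j)) (\<lambda>us. 0 * (0::real) + 0 * 0) vs"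
      by (rule wedge1_cong) (use Cons False in auto)
    then show ?thesis unfolding wedge1_lincomb by (simp del: One_nat_def)
  qed
qed simp

text \<open>Increasing lists of equal length coincide once the entries of one are among those of the
  other; otherwise the covector of an entry of \<open>I\<close> outside \<open>J\<close> annihilates
  all arguments.\<close>

lemma ewedge_incr:
  assumes "\<And>i j. i \<in> {1..7} \<Longrightarrow> j \<in> {1..7} \<Longrightarrow> g (e i) (e j) = (if i = j then 1 else 0)"
    and I: "I \<in> incr k" and J: "J \<in> incr k"
  shows "ewedge g e I (map e J) = (if I = J then 1 else 0)"
proof (cases "set I \<subseteq> set J")
  case True
  have "card (set I) = card (set J)" using I J by (simp add: incr_def strict_sorted_iff distinct_card)
  then have "set I = set J" using True by (intro card_subset_eq) auto
  then have "I = J" using I J by (auto simp: incr_def strict_sorted_iff intro: sorted_distinct_set_unique)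
  moreover have "ewedge g e J (map e J) = 1"
    using assms(1) J by (intro ewedge_self) (auto simp: incr_def strict_sorted_iff subset_iff)
  ultimately show ?thesis by simp
next
  case False
  then obtain i where i: "i \<in> set I" "i \<notin> set J" by auto
  have "ewedge g e I (map e J) = 0"
    by (rule ewedge_zero[OF i(1)]) (use assms(1) I J i in \<open>auto simp: incr_def subset_iff\<close>)
  then show ?thesis using i by auto
qed


section \<open>Orthonormal frames of a seven-dimensional space\<close>

declare One_nat_def [simp del]

section \<open>Sums over indices and over increasing multi-indices\<close>

lemma sum7: "(\<Sum>i=1..7. f i) = f 1 + f 2 + f 3 + f 4 + f 5 + f 6 + f (7::nat)"
  by (simp add: eval_nat_numeral sum.atLeast_Suc_atMost One_nat_def)

lemma ball7: "(\<forall>i\<in>{1..7}. P i) \<longleftrightarrow> P 1 \<and> P 2 \<and> P 3 \<and> P 4 \<and> P 5 \<and> P 6 \<and> P (7::nat)"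
proof -
  have "{1..7::nat} = {1,2,3,4,5,6,7}" by auto
  then show ?thesis by simp
qed

lemma greater7:
  "{1<..7::nat} = {2,3,4,5,6,7}" "{2<..7::nat} = {3,4,5,6,7}" "{3<..7::nat} = {4,5,6,7}"
  "{4<..7::nat} = {5,6,7}" "{5<..7::nat} = {6,7}" "{6<..7::nat} = {7}" "{7<..7::nat} = {}"
  by auto

lemma ball_greater7:
  "(\<forall>i\<in>{1<..7}. P i) \<longleftrightarrow> P 2 \<and> P 3 \<and> P 4 \<and> P 5 \<and> P 6 \<and> P (7::nat)"
  "(\<forall>i\<in>{2<..7}. P i) \<longleftrightarrow> P 3 \<and> P 4 \<and> P 5 \<and> P 6 \<and> P (7::nat)"
  "(\<forall>i\<in>{3<..7}. P i) \<longleftrightarrow> P 4 \<and> P 5 \<and> P 6 \<and> P (7::nat)"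
  "(\<forall>i\<in>{4<..7}. P i) \<longleftrightarrow> P 5 \<and> P 6 \<and> P (7::nat)"
  "(\<forall>i\<in>{5<..7}. P i) \<longleftrightarrow> P 6 \<and> P (7::nat)"
  "(\<forall>i\<in>{6<..7}. P i) \<longleftrightarrow> P (7::nat)"
  "(\<forall>i\<in>{7<..7::nat}. P i) \<longleftrightarrow> True"
  unfolding greater7 by simp_all

lemma sum_greater7:
  "(\<Sum>i\<in>{1<..7}. f i) = f 2 + f 3 + f 4 + f 5 + f 6 + f (7::nat)"
  "(\<Sum>i\<in>{2<..7}. f i) = f 3 + f 4 + f 5 + f 6 + f (7::nat)"
  "(\<Sum>i\<in>{3<..7}. f i) = f 4 + f 5 + f 6 + f (7::nat)"
  "(\<Sum>i\<in>{4<..7}. f i) = f 5 + f 6 + f (7::nat)"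
  "(\<Sum>i\<in>{5<..7}. f i) = f 6 + f (7::nat)"
  "(\<Sum>i\<in>{6<..7}. f i) = f (7::nat)"
  "(\<Sum>i\<in>{7<..7::nat}. f i) = 0"
  unfolding greater7 by (simp_all add: add.assoc)

lemma sum_incr2: "(\<Sum>I\<in>incr 2. f I) = (\<Sum>i=1..7. \<Sum>j\<in>{i<..7}. f [i, j])"
proof -
  have i: "inj_on (\<lambda>(i, j). [i, j]) X" for X :: "(nat \<times> nat) set" by (auto simp: inj_on_def)
  have "I \<in> incr 2 \<longleftrightarrow> (\<exists>i j. I = [i, j] \<and> 1 \<le> i \<and> i < j \<and> j \<le> 7)" for I
    by (auto simp: incr_def numeral_2_eq_2 length_Suc_conv)
  note mem = this
  have "incr 2 = (\<lambda>(i, j). [i, j]) ` (SIGMA i:{1..7}. {i<..7})" (is "_ = ?f ` ?S")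
  proof (intro equalityI subsetI)
    fix I assume "I \<in> incr 2"
    then obtain i j where *: "I = ?f (i, j)" "(i, j) \<in> ?S" unfolding mem by auto
    show "I \<in> ?f ` ?S" unfolding *(1) by (rule imageI[OF *(2)])
  next
    fix I assume "I \<in> ?f ` ?S"
    then show "I \<in> incr 2" unfolding mem by auto
  qed
  then show ?thesis unfolding \<open>incr _ = _\<close> sum.reindex[OF i]
    by (simp add: sum.Sigma case_prod_unfold)
qed

lemma sum_incr3: "(\<Sum>I\<in>incr 3. f I) = (\<Sum>i=1..7. \<Sum>j\<in>{i<..7}. \<Sum>k\<in>{j<..7}. f [i, j, k])"
proof -
  have i: "inj_on (\<lambda>(i, j, k). [i, j, k]) X" for X :: "(nat \<times> nat \<times> nat) set" by (auto simp: inj_on_def)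
  have "I \<in> incr 3 \<longleftrightarrow> (\<exists>i j k. I = [i, j, k] \<and> 1 \<le> i \<and> i < j \<and> j < k \<and> k \<le> 7)" for I
    by (auto simp: incr_def numeral_3_eq_3 length_Suc_conv)
  note mem = this
  have "incr 3 = (\<lambda>(i, j, k). [i, j, k]) ` (SIGMA i:{1..7}. SIGMA j:{i<..7}. {j<..7})" (is "_ = ?f ` ?S")
  proof (intro equalityI subsetI)
    fix I assume "I \<in> incr 3"
    then obtain i j k where *: "I = ?f (i, j, k)" "(i, j, k) \<in> ?S" unfolding mem by auto
    show "I \<in> ?f ` ?S" unfolding *(1) by (rule imageI[OF *(2)])
  next
    fix I assume "I \<in> ?f ` ?S"
    then show "I \<in> incr 3" unfolding mem by auto
  qed
  then show ?thesis unfolding \<open>incr _ = _\<close> sum.reindex[OF i]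
    by (simp add: sum.Sigma case_prod_unfold)
qed

lemma numeral_4_eq_4: "4 = Suc (Suc (Suc (Suc 0)))"
  by simp

lemma incr4_iff: "I \<in> incr 4 \<longleftrightarrow> (\<exists>i j k l. I = [i, j, k, l] \<and> 1 \<le> i \<and> i < j \<and> j < k \<and> k < l \<and> l \<le> 7)"
  by (auto simp: incr_def numeral_4_eq_4 length_Suc_conv)

lemma incr7: "incr 7 = {[1..<8]}"
proof -
  have "I = [1..<8]" if "I \<in> incr 7" for I
  proof -
    have I: "length I = 7" "sorted_wrt (<) I" "set I \<subseteq> {1..7}" using that by (auto simp: incr_def)
    then have "distinct I" "sorted I" by (simp_all add: strict_sorted_iff)
    then have "card (set I) = card {1..7::nat}" using I by (simp add: distinct_card)
    then have "set I = {1..7}" using I(3) by (intro card_subset_eq) auto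
    then have "set I = set [1..<8]" by (simp add: atLeastLessThanSuc_atLeastAtMost[of 1 7, simplified] del: upt.simps)
    then show ?thesis using \<open>distinct I\<close> \<open>sorted I\<close>
      by (intro sorted_distinct_set_unique) (simp_all del: upt.simps)
  qed
  moreover have "[1..<8] \<in> incr 7" by (auto simp: incr_def)
  ultimately show ?thesis by blast
qed

text \<open>A product of two alternating expressions is symmetric and vanishes on the diagonal, so
  sums over increasing indices become full sums, divided by 2 here and by 6 for three
  indices.\<close>

lemma sum_symmetric2:
  fixes f :: "nat \<Rightarrow> nat \<Rightarrow> real"
  assumes "\<And>i j. f i j = f j i" "\<And>i. f i i = 0"
  shows "(\<Sum>i=1..7. \<Sum>j=1..7. f i j) = 2 * (\<Sum>i=1..7. \<Sum>j\<in>{i<..7}. f i j)"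
  unfolding sum7 sum_greater7 by (simp add: assms)

lemma sum_symmetric3:
  fixes f :: "nat \<Rightarrow> nat \<Rightarrow> nat \<Rightarrow> real"
  assumes s: "\<And>i j k. f i j k = f j i k" "\<And>i j k. f i j k = f i k j" and z: "\<And>i k. f i i k = 0"
  shows "(\<Sum>i=1..7. \<Sum>j=1..7. \<Sum>k=1..7. f i j k) = 6 * (\<Sum>i=1..7. \<Sum>j\<in>{i<..7}. \<Sum>k\<in>{j<..7}. f i j k)"
proof -
  have z2: "f i k k = 0" for i k using z s by metis
  show ?thesis unfolding sum7 sum_greater7 by (simp add: s z z2)
qed

section \<open>Expansion in orthonormal frames and independence of the frame\<close>

lemma on_frame_orth:
  "on_frame b e \<Longrightarrow> i \<in> {1..7} \<Longrightarrow> j \<in> {1..7} \<Longrightarrow> b (e i) (e j) = (if i = j then 1 else 0)"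
  by (simp add: on_frame_def)

lemma inner_product_rules:
  assumes "inner_product b"
  shows "linear (\<lambda>x. b x y)" "linear (b x)" "b x y = b y x"
  using assms by (auto simp: inner_product_def bilinear_def)

lemma of_nat_7: "inj_on (of_nat :: nat \<Rightarrow> 7) {1..7}" "(of_nat :: nat \<Rightarrow> 7) ` {1..7} = UNIV"
proof -
  have 1: "{1..7::nat} = {1,2,3,4,5,6,7}" by auto
  have 2: "card {1,2,3,4,5,6,7::7} = 7" by simp
  then have 3: "{1,2,3,4,5,6,7::7} = UNIV" by (intro card_subset_eq) auto
  show "(of_nat :: nat \<Rightarrow> 7) ` {1..7} = UNIV" by (simp add: 1 flip: 3)
  then show "inj_on (of_nat :: nat \<Rightarrow> 7) {1..7}"
    by (intro eq_card_imp_inj_on) auto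
qed

lemma linear_frame_map: "linear (\<lambda>x::real^7. \<Sum>k=1..7. (x $ of_nat k) *\<^sub>R (e k :: real^7))"
  by (auto intro!: linearI simp: algebra_simps sum.distrib scaleR_sum_right)

lemma frame_basis:
  assumes "on_frame b e"
  shows "\<exists>a. x = (\<Sum>i=1..7. a i *\<^sub>R e i)"
proof -
  let ?L = "\<lambda>x::real^7. \<Sum>k=1..7. (x $ of_nat k) *\<^sub>R e k"
  have "invertible (matrix ?L)" using assms by (simp add: on_frame_def invertible_det_nz)
  then obtain B where "matrix ?L ** B = mat 1" by (auto simp: invertible_def)
  then have "x = matrix ?L *v (B *v x)" by (simp add: matrix_vector_mul_assoc)
  also have "\<dots> = ?L (B *v x)" by (simp add: matrix_works linear_matrix_vector_mul_eq linear_frame_map)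
  finally show ?thesis by (intro exI[of _ "\<lambda>k. (B *v x) $ of_nat k"])
qed

lemma frame_expand:
  assumes b: "inner_product b" and e: "on_frame b e"
  shows "x = (\<Sum>i=1..7. b x (e i) *\<^sub>R e i)"
proof -
  obtain a where a: "x = (\<Sum>i=1..7. a i *\<^sub>R e i)" using frame_basis[OF e] by blast
  have "b x (e j) = a j" if "j \<in> {1..7}" for j
  proof -
    have "b x (e j) = (\<Sum>i=1..7. a i * b (e i) (e j))"
      by (simp add: a linear_sum[OF inner_product_rules(1)[OF b]] linear_scale[OF inner_product_rules(1)[OF b]])
    also have "\<dots> = (\<Sum>i=1..7. if i = j then a i else 0)"
      by (rule sum.cong) (use that in \<open>auto simp: on_frame_orth[OF e]\<close>)
    also have "\<dots> = a j" using that by simp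
    finally show ?thesis .
  qed
  then show ?thesis using a by simp
qed

lemma frame_parseval:
  assumes b: "inner_product b" and e: "on_frame b e"
  shows "(\<Sum>i=1..7. b x (e i) * b y (e i)) = b x y"
proof -
  have "b x y = b x (\<Sum>i=1..7. b y (e i) *\<^sub>R e i)"
    by (rule arg_cong[where f = "b x", OF frame_expand[OF b e]])
  then show ?thesis
    by (simp add: linear_sum[OF inner_product_rules(2)[OF b]] linear_scale[OF inner_product_rules(2)[OF b]] mult.commute)
qed

text \<open>Expanding in \<open>e\<close> and summing over \<open>e'\<close> leaves, by Parseval for
  \<open>e'\<close>, the products of the vectors of \<open>e\<close>, a Kronecker delta. Forms of
  higher degree are treated by exchanging one index after the other.\<close>

lemma trace_invariant:
  fixes f :: "real^7 \<Rightarrow> real^7 \<Rightarrow> real"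
  assumes b: "inner_product b" and e: "on_frame b e" and e': "on_frame b e'"
    and f: "\<And>y. linear (\<lambda>x. f x y)" "\<And>x. linear (f x)"
  shows "(\<Sum>i=1..7. f (e' i) (e' i)) = (\<Sum>i=1..7. f (e i) (e i))"
proof -
  have ex: "f x y = (\<Sum>j=1..7. \<Sum>k=1..7. b x (e j) * b y (e k) * f (e j) (e k))" for x y
  proof -
    have fy: "f z y = (\<Sum>k=1..7. b y (e k) * f z (e k))" for z
    proof -
      have "f z y = f z (\<Sum>k=1..7. b y (e k) *\<^sub>R e k)"
        by (rule arg_cong[where f = "f z", OF frame_expand[OF b e]])
      then show ?thesis by (simp add: linear_sum[OF f(2)] linear_scale[OF f(2)])
    qed
    have "f x y = f (\<Sum>j=1..7. b x (e j) *\<^sub>R e j) y"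
      by (rule arg_cong[where f = "\<lambda>z. f z y", OF frame_expand[OF b e]])
    also have "\<dots> = (\<Sum>j=1..7. b x (e j) * f (e j) y)"
      by (simp add: linear_sum[OF f(1)] linear_scale[OF f(1)])
    finally show ?thesis by (simp add: fy sum_distrib_left mult.assoc)
  qed
  have "(\<Sum>i=1..7. f (e' i) (e' i)) = (\<Sum>i=1..7. \<Sum>j=1..7. \<Sum>k=1..7. b (e' i) (e j) * b (e' i) (e k) * f (e j) (e k))"
    by (subst ex) simp
  also have "\<dots> = (\<Sum>j=1..7. \<Sum>k=1..7. (\<Sum>i=1..7. b (e' i) (e j) * b (e' i) (e k)) * f (e j) (e k))"
  proof -
    have "(\<Sum>i=1..7. \<Sum>j=1..7. \<Sum>k=1..7. b (e' i) (e j) * b (e' i) (e k) * f (e j) (e k))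
      = (\<Sum>j=1..7. \<Sum>i=1..7. \<Sum>k=1..7. b (e' i) (e j) * b (e' i) (e k) * f (e j) (e k))" by (rule sum.swap)
    also have "\<dots> = (\<Sum>j=1..7. \<Sum>k=1..7. \<Sum>i=1..7. b (e' i) (e j) * b (e' i) (e k) * f (e j) (e k))"
      by (rule sum.cong[OF refl sum.swap])
    finally show ?thesis by (simp only: sum_distrib_right)
  qed
  also have "\<dots> = (\<Sum>j=1..7. \<Sum>k=1..7. b (e j) (e k) * f (e j) (e k))"
  proof -
    have "b (e' i) x = b x (e' i)" for i x by (rule inner_product_rules(3)[OF b])
    then show ?thesis by (simp only: frame_parseval[OF b e'])
  qed
  also have "\<dots> = (\<Sum>j=1..7. \<Sum>k=1..7. if j = k then f (e j) (e k) else 0)"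
    by (intro sum.cong refl) (simp add: on_frame_orth[OF e])
  finally show ?thesis by simp
qed

lemma form3_symmetric:
  assumes "is_form 3 \<alpha>"
  shows "\<alpha> [x, y, z] = - \<alpha> [y, x, z]" "\<alpha> [x, y, z] = - \<alpha> [x, z, y]" "\<alpha> [x, x, z] = 0"
  using form_swap[OF assms, of "[]" x y "[z]"] form_swap[OF assms, of "[x]" y z "[]"]
    form_repeated[OF assms, of "[]" x "[z]"] by simp_all

lemma form_inner3:
  assumes "is_form 3 \<alpha>" "is_form 3 \<beta>"
  shows "form_inner 3 e \<alpha> \<beta> =
    1/6 * (\<Sum>i=1..7. \<Sum>j=1..7. \<Sum>k=1..7. \<alpha> [e i, e j, e k] * \<beta> [e i, e j, e k])"
proof -
  note a = form3_symmetric[OF assms(1)] and b = form3_symmetric[OF assms(2)]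
  let ?f = "\<lambda>i j k. \<alpha> [e i, e j, e k] * \<beta> [e i, e j, e k]"
  have "?f i j k = ?f j i k" for i j k
    by (subst a(1), subst b(1)) (rule minus_mult_minus)
  moreover have "?f i j k = ?f i k j" for i j k
    by (subst a(2), subst b(2)) (rule minus_mult_minus)
  ultimately show ?thesis unfolding form_inner_def sum_incr3
    by (subst sum_symmetric3) (use a(3) in auto)
qed

lemma form_inner3_invariant:
  assumes b: "inner_product b" and e: "on_frame b e" and e': "on_frame b e'"
    and f: "is_form 3 \<alpha>" "is_form 3 \<beta>"
  shows "form_inner 3 e' \<alpha> \<beta> = form_inner 3 e \<alpha> \<beta>"
proof -
  note l = form3_linear[OF f(1)] form3_linear[OF f(2)]
  have sc: "linear (\<lambda>x. r * h x)" "linear (\<lambda>x. h x * r)" if "linear h" for r and h :: "real^7 \<Rightarrow> real"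
    using that by (auto intro!: linearI simp: linear_add linear_scale algebra_simps)
  have lin_sum: "linear (\<lambda>x. \<Sum>i=1..7. h i x)" if "\<And>i. linear (h i)" for h :: "nat \<Rightarrow> real^7 \<Rightarrow> real"
    using that by (auto intro!: linearI simp: linear_add linear_scale sum.distrib sum_distrib_left)
  note t = trace_invariant[OF b e e']
  have 1: "(\<Sum>k=1..7. \<alpha> [x, y, e' k] * \<beta> [x', y', e' k]) = (\<Sum>k=1..7. \<alpha> [x, y, e k] * \<beta> [x', y', e k])" for x y x' y'
    by (rule t[where f = "\<lambda>u v. \<alpha> [x, y, u] * \<beta> [x', y', v]"]) (intro sc l)+
  have 2: "(\<Sum>j=1..7. \<Sum>k=1..7. \<alpha> [x, e' j, e k] * \<beta> [x', e' j, e k])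
     = (\<Sum>j=1..7. \<Sum>k=1..7. \<alpha> [x, e j, e k] * \<beta> [x', e j, e k])" for x x'
    by (rule t[where f = "\<lambda>u v. \<Sum>k=1..7. \<alpha> [x, u, e k] * \<beta> [x', v, e k]"]) (intro sc l lin_sum)+
  have 3: "(\<Sum>i=1..7. \<Sum>j=1..7. \<Sum>k=1..7. \<alpha> [e' i, e j, e k] * \<beta> [e' i, e j, e k])
     = (\<Sum>i=1..7. \<Sum>j=1..7. \<Sum>k=1..7. \<alpha> [e i, e j, e k] * \<beta> [e i, e j, e k])"
    by (rule t[where f = "\<lambda>u v. \<Sum>j=1..7. \<Sum>k=1..7. \<alpha> [u, e j, e k] * \<beta> [v, e j, e k]"]) (intro sc l lin_sum)+
  show ?thesis unfolding form_inner3[OF f] 1 2 3 ..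
qed

subsection \<open>The volume form and the Hodge star\<close>

text \<open>A volume form that refers to no frame, against which orthonormal frames are compared.
  The \<open>k\<close>-th vector, at list position \<open>k - 1\<close>, becomes row
  \<open>of_nat k\<close>, in agreement with the map in \<open>on_frame\<close>; so row 0 is the
  seventh vector.\<close>

definition det_form :: "(real^7) form" where
  "det_form vs = det (\<chi> i. vs ! (inv_into {1..7} of_nat (i::7) - 1))"

lemma inv7: "inv_into {1..7} of_nat (i::7) \<in> {1..7}" "of_nat (inv_into {1..7} of_nat (i::7)) = i"
  "k \<in> {1..7} \<Longrightarrow> inv_into {1..7} of_nat (of_nat k :: 7) = k"
proof -
  have i: "i \<in> of_nat ` {1..7}" using of_nat_7(2) by auto
  show "inv_into {1..7} of_nat i \<in> {1..7}" by (rule inv_into_into[OF i])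
  show "of_nat (inv_into {1..7} of_nat i) = i" by (rule f_inv_into_f[OF i])
  show "k \<in> {1..7} \<Longrightarrow> inv_into {1..7} of_nat (of_nat k :: 7) = k" by (rule inv_into_f_f[OF of_nat_7(1)])
qed

lemma nth_frame: "k \<in> {1..7} \<Longrightarrow> map e [1..<8] ! (k - 1) = e k"
proof -
  assume k: "k \<in> {1..7}"
  then have "k - 1 < 7" by auto
  then show ?thesis using k by (simp del: upt.simps)
qed

lemma inv7_eq_iff: "m < 7 \<Longrightarrow> inv_into {1..7} of_nat (i::7) - 1 = m \<longleftrightarrow> i = of_nat (Suc m)"
proof -
  assume m: "m < 7"
  have "Suc m \<in> {1..7}" using m by auto
  then have "inv_into {1..7} of_nat i = Suc m \<longleftrightarrow> i = of_nat (Suc m)"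
    using inv7(2)[of i] inv7(3)[of "Suc m"] by (auto simp del: of_nat_Suc)
  moreover have "inv_into {1..7} of_nat i - 1 = m \<longleftrightarrow> inv_into {1..7} of_nat i = Suc m"
    using inv7(1)[of i] by auto
  ultimately show ?thesis by simp
qed

lemma det_form_form: "is_form 7 det_form"
  unfolding is_form_def
proof (intro conjI allI impI)
  fix vs :: "(real^7) list" and m :: nat assume *: "length vs = 7 \<and> m < 7"
  let ?r = "\<lambda>i::7. vs ! (inv_into {1..7} of_nat i - 1)"
  have "det_form (vs[m := v]) = det (\<chi> i. if i = of_nat (Suc m) then v else ?r i)" for v
  proof -
    have "vs[m := v] ! (inv_into {1..7} of_nat i - 1) = (if i = of_nat (Suc m) then v else ?r i)" for i :: 7
      using * inv7_eq_iff[of m i] by (auto simp: nth_list_update)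
    then show ?thesis unfolding det_form_def by presburger
  qed
  moreover have "det (\<chi> i. if i = k then c *\<^sub>R a else r i) = c * det (\<chi> i. if i = k then a else r i)"
    for k :: 7 and c :: real and a and r :: "7 \<Rightarrow> real^7"
    using det_row_mul[of k c "\<lambda>_. a" r] by (simp add: scalar_mult_eq_scaleR cong: if_cong)
  ultimately show "linear (\<lambda>v. det_form (vs[m := v]))"
    by (auto intro!: linearI simp: det_row_add simp del: of_nat_Suc)
next
  fix vs :: "(real^7) list" and i j assume *: "length vs = 7 \<and> i < j \<and> j < 7 \<and> vs ! i = vs ! j"
  have i: "inv_into {1..7} of_nat (of_nat (Suc i) :: 7) - 1 = i" and j: "inv_into {1..7} of_nat (of_nat (Suc j) :: 7) - 1 = j"
    using * inv7_eq_iff by auto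
  have "(of_nat (Suc i) :: 7) \<noteq> of_nat (Suc j)"
  proof
    assume "(of_nat (Suc i) :: 7) = of_nat (Suc j)"
    from i[unfolded this j] show False using * by simp
  qed
  then show "det_form vs = 0" unfolding det_form_def
    by (rule det_identical_rows) (use i j * in \<open>simp add: row_def\<close>)
qed

lemma det_form_frame: "det_form (map e [1..<8]) = det (matrix (\<lambda>x::real^7. \<Sum>k=1..7. (x $ of_nat k) *\<^sub>R e k))"
proof -
  have "matrix (\<lambda>x::real^7. \<Sum>k=1..7. (x $ of_nat k) *\<^sub>R e k) = transpose (\<chi> i. map e [1..<8] ! (inv_into {1..7} of_nat i - 1))"
  proof -
    have "(\<Sum>k=1..7. (axis j 1 $ of_nat k) *\<^sub>R e k) = map e [1..<8] ! (inv_into {1..7} of_nat j - 1)" for j :: 7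
    proof -
      let ?k = "inv_into {1..7} of_nat j"
      have "(\<Sum>k=1..7. (axis j 1 $ of_nat k) *\<^sub>R e k) = (\<Sum>k=1..7. if k = ?k then e k else 0)"
      proof (rule sum.cong)
        fix k :: nat assume "k \<in> {1..7}"
        then have "of_nat k = j \<longleftrightarrow> k = ?k" using inv7 by metis
        then show "(axis j 1 $ of_nat k) *\<^sub>R e k = (if k = ?k then e k else 0)" by (auto simp: axis_def)
      qed simp
      also have "\<dots> = e ?k" using inv7(1)[of j] by simp
      also have "\<dots> = map e [1..<8] ! (?k - 1)" by (rule nth_frame[OF inv7(1), symmetric])
      finally show ?thesis .
    qed
    then show ?thesis by (simp add: matrix_def transpose_def vec_eq_iff)
  qed
  then show ?thesis by (simp add: det_form_def det_transpose del: upt.simps)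
qed

text \<open>With the frame as rows of E and the Gram matrix G of \<open>b\<close> in the standard
  basis, orthonormality says E G E^T = 1. So the squared determinant of an orthonormal frame depends
  on \<open>b\<close> alone, and the positivity in \<open>on_frame\<close> fixes the sign.\<close>

lemma det_frame:
  assumes b: "inner_product b" and e: "on_frame b e"
  shows "(det_form (map e [1..<8]))\<^sup>2 * det (matrix (\<lambda>x. \<chi> i. b (axis i 1) x)) = 1"
proof -
  let ?B = "matrix (\<lambda>x. \<chi> i. b (axis i 1) x)"
  let ?r = "\<lambda>i::7. inv_into {1..7} of_nat i"
  let ?E = "\<chi> i. e (?r i)"
  have E: "det_form (map e [1..<8]) = det ?E"
  proof -
    have "map e [1..<8] ! (?r i - 1) = e (?r i)" for i
      by (rule nth_frame[OF inv7(1)])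
    then show ?thesis by (simp add: det_form_def del: upt.simps)
  qed
  have "linear (\<lambda>x. \<chi> i. b (axis i 1) x)"
    using inner_product_rules(2)[OF b] by (auto intro!: linearI simp: vec_eq_iff linear_add linear_scale)
  then have Bv: "(?B *v x) $ i = b (axis i 1) x" for x i by (simp add: matrix_works)
  have bB: "b y x = (\<Sum>i\<in>UNIV. y $ i * (?B *v x) $ i)" for x y
  proof -
    have "y = (\<Sum>i\<in>UNIV. y $ i *\<^sub>R axis i 1)" by (simp add: basis_expansion flip: scalar_mult_eq_scaleR)
    then have "b y x = b (\<Sum>i\<in>UNIV. y $ i *\<^sub>R axis i 1) x" by (rule arg_cong[where f = "\<lambda>z. b z x"])
    then show ?thesis
      by (simp only: linear_sum[OF inner_product_rules(1)[OF b]] linear_scale[OF inner_product_rules(1)[OF b]] Bv real_scaleR_def)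
  qed
  have "?E ** (?B ** transpose ?E) = mat 1"
  proof -
    have "(?E ** (?B ** transpose ?E)) $ i $ j = b (e (?r i)) (e (?r j))" for i j
    proof -
      have "(?B ** transpose ?E) $ k $ j = (?B *v e (?r j)) $ k" for k
        by (simp add: matrix_matrix_mult_def matrix_vector_mult_def transpose_def)
      then have "(?E ** (?B ** transpose ?E)) $ i $ j = (\<Sum>k\<in>UNIV. e (?r i) $ k * (?B *v e (?r j)) $ k)"
        by (subst matrix_matrix_mult_def) simp
      then show ?thesis by (rule trans[OF _ bB[symmetric]])
    qed
    moreover have "b (e (?r i)) (e (?r j)) = (if i = j then 1 else 0)" for i j :: 7
    proof -
      have "?r i = ?r j \<longleftrightarrow> i = j"
        by (rule inj_on_eq_iff[of ?r UNIV]) (auto intro: inj_on_inverseI inv7(2))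
      then show ?thesis using on_frame_orth[OF e inv7(1)[of i] inv7(1)[of j]] by presburger
    qed
    ultimately show ?thesis by (simp add: vec_eq_iff mat_def)
  qed
  then have "det (?E ** (?B ** transpose ?E)) = 1" by (simp only: det_I)
  then have "det ?E * (det ?B * det ?E) = 1" by (simp only: det_mul det_transpose)
  then show ?thesis by (simp add: E power2_eq_square algebra_simps)
qed

lemma form7_proportional:
  assumes e: "on_frame b e" and f: "is_form 7 f" "is_form 7 h" and vs: "length vs = 7"
  shows "f vs * h (map e [1..<8]) = h vs * f (map e [1..<8])"
  using form_zero[OF frame_basis[OF e] form_lincomb[OF f, of "h (map e [1..<8])" "- f (map e [1..<8])"] _ vs]
  by (simp add: incr7 mult.commute del: upt.simps)

lemma volume_form:
  assumes b: "inner_product b" and e: "on_frame b e"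
  shows "is_form 7 (ewedge b e [1..<8])" "ewedge b e [1..<8] (map e [1..<8]) = 1"
  using form_ewedge[where I = "[1..<8]" and e = e, OF inner_product_rules(2)[OF b]]
    ewedge_self[of "[1..<8]" b e] on_frame_orth[OF e] by (auto simp del: upt.simps)

lemma volume_det:
  assumes b: "inner_product b" and e: "on_frame b e" and vs: "length vs = 7"
  shows "ewedge b e [1..<8] vs * det_form (map e [1..<8]) = det_form vs"
  using form7_proportional[OF e volume_form(1)[OF b e] det_form_form vs] volume_form(2)[OF b e] by simp

lemma volume_invariant:
  assumes b: "inner_product b" and e: "on_frame b e" and e': "on_frame b e'" and vs: "length vs = 7"
  shows "ewedge b e' [1..<8] vs = ewedge b e [1..<8] vs"
proof -
  let ?d = "det_form (map e [1..<8])" and ?d' = "det_form (map e' [1..<8])"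
  have pos: "?d > 0" "?d' > 0" using e e' unfolding det_form_frame by (simp_all add: on_frame_def)
  have "?d\<^sup>2 = ?d'\<^sup>2"
  proof -
    let ?X = "det (matrix (\<lambda>x. \<chi> i. b (axis i 1) x))"
    have "?d\<^sup>2 * ?X = ?d'\<^sup>2 * ?X" "?X \<noteq> 0" using det_frame[OF b e] det_frame[OF b e'] by auto
    then show ?thesis by (simp only: mult_cancel_right) simp
  qed
  then have "?d = ?d'" using pos by (simp add: power2_eq_iff)
  then have "ewedge b e' [1..<8] vs * ?d = ewedge b e [1..<8] vs * ?d"
    using volume_det[OF b e vs] volume_det[OF b e' vs] by simp
  then show ?thesis using pos(1) by (simp only: mult_cancel_right) simp
qed

lemma form_append:
  assumes "is_form (k + l) f" "length vs = l"
  shows "is_form k (\<lambda>us. f (us @ vs))"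
proof (rule is_formI)
  show "linear (\<lambda>v. f ((pre @ v # post) @ vs))" if "Suc (length pre + length post) = k" for pre post
    using form_linear[OF assms(1), of pre "post @ vs"] that assms(2) by simp
  show "f ((pre @ x # x # post) @ vs) = 0" if "length pre + length post + 2 = k" for pre x post
    using form_repeated[OF assms(1), of pre x "post @ vs"] that assms(2) by simp
qed

lemma form_prepend:
  assumes "is_form (l + k) f" "length vs = l"
  shows "is_form k (\<lambda>us. f (vs @ us))"
proof (rule is_formI)
  show "linear (\<lambda>v. f (vs @ pre @ v # post))" if "Suc (length pre + length post) = k" for pre post
    using form_linear[OF assms(1), of "vs @ pre" post] that assms(2) by simp
  show "f (vs @ pre @ x # x # post) = 0" if "length pre + length post + 2 = k" for pre x post
    using form_repeated[OF assms(1), of "vs @ pre" x post] that assms(2) by simp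
qed

lemma finite_incr: "finite (incr k)"
  by (rule finite_subset[OF _ finite_lists_length_eq[of "{1..7}" k]]) (auto simp: incr_def)

lemma hodge_form:
  assumes b: "inner_product b" and e: "on_frame b e"
  shows "is_form 4 (hodge b e 3 \<alpha>)"
  unfolding hodge_def
proof (rule form_sum[OF finite_incr])
  show "is_form 4 (\<lambda>vs. ewedge b e [1..<8] (map e I @ vs))" if "I \<in> incr 3" for I
    by (rule form_prepend[where l = 3 and k = 4])
      (use that volume_form(1)[OF b e] in \<open>simp_all add: incr_def del: upt.simps\<close>)
qed

text \<open>The value of the star is the inner product of \<alpha> with the three-form obtained by
  filling the last four slots of the volume form with \<open>vs\<close>; volume form and inner
  product are independent of the frame.\<close>

lemma hodge_invariant:
  assumes b: "inner_product b" and e: "on_frame b e" and e': "on_frame b e'"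
    and \<alpha>: "is_form 3 \<alpha>" and vs: "length vs = 4"
  shows "hodge b e' 3 \<alpha> vs = hodge b e 3 \<alpha> vs"
proof -
  have "hodge b e' 3 \<alpha> vs = form_inner 3 e' \<alpha> (\<lambda>us. ewedge b e [1..<8] (us @ vs))"
    unfolding hodge_def form_inner_def
    by (rule sum.cong) (use volume_invariant[OF b e e'] vs in \<open>auto simp: incr_def simp del: upt.simps\<close>)
  also have "\<dots> = form_inner 3 e \<alpha> (\<lambda>us. ewedge b e [1..<8] (us @ vs))"
    by (rule form_inner3_invariant[OF b e e' \<alpha> form_append[where l = 4]])
      (use volume_form(1)[OF b e] vs in \<open>auto simp del: upt.simps\<close>)
  finally show ?thesis by (simp add: hodge_def form_inner_def del: upt.simps)
qed


section \<open>The algebra of the model form\<close>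

text \<open>The multiplication table of the imaginary octonions: \<open>e\<^sub>i e\<^sub>j = \<plusminus> e\<^sub>k\<close> is recorded as
  \<open>oct i j = \<plusminus> k\<close>.\<close>

definition oct :: "nat \<Rightarrow> nat \<Rightarrow> int" where
  "oct i j =
    [[0, 7, 5, -6, -3, 4, -2],
     [-7, 0, -6, -5, 4, 3, 1],
     [-5, 6, 0, 7, 1, -2, -4],
     [6, 5, -7, 0, -2, -1, 3],
     [3, -4, -1, 2, 0, 7, -6],
     [-4, -3, 2, 1, -7, 0, 5],
     [2, -1, 4, -3, 6, -5, 0]] ! (i - 1) ! (j - 1)"

lemma oct_simps:
  "oct 1 1 = 0" "oct 1 2 = 7" "oct 1 3 = 5" "oct 1 4 = -6" "oct 1 5 = -3" "oct 1 6 = 4" "oct 1 7 = -2"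
  "oct 2 1 = -7" "oct 2 2 = 0" "oct 2 3 = -6" "oct 2 4 = -5" "oct 2 5 = 4" "oct 2 6 = 3" "oct 2 7 = 1"
  "oct 3 1 = -5" "oct 3 2 = 6" "oct 3 3 = 0" "oct 3 4 = 7" "oct 3 5 = 1" "oct 3 6 = -2" "oct 3 7 = -4"
  "oct 4 1 = 6" "oct 4 2 = 5" "oct 4 3 = -7" "oct 4 4 = 0" "oct 4 5 = -2" "oct 4 6 = -1" "oct 4 7 = 3"
  "oct 5 1 = 3" "oct 5 2 = -4" "oct 5 3 = -1" "oct 5 4 = 2" "oct 5 5 = 0" "oct 5 6 = 7" "oct 5 7 = -6"
  "oct 6 1 = -4" "oct 6 2 = -3" "oct 6 3 = 2" "oct 6 4 = 1" "oct 6 5 = -7" "oct 6 6 = 0" "oct 6 7 = 5"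
  "oct 7 1 = 2" "oct 7 2 = -1" "oct 7 3 = 4" "oct 7 4 = -3" "oct 7 5 = 6" "oct 7 6 = -5" "oct 7 7 = 0"
  by (simp_all add: oct_def)

definition phc :: "nat \<Rightarrow> nat \<Rightarrow> nat \<Rightarrow> real" where
  "phc i j k = (if oct i j = int k then 1 else if oct i j = - int k then -1 else 0)"

text \<open>The contraction identity \<phi>_ijp \<phi>_pkl = \<psi>_ijkl + \<delta>_ik \<delta>_jl -
  \<delta>_il \<delta>_jk, solved for \<psi>. That these numbers are the components of the Hodge
  dual of the model form is the content of \<open>hodge_components\<close>.\<close>

definition psc :: "nat \<Rightarrow> nat \<Rightarrow> nat \<Rightarrow> nat \<Rightarrow> real" where
  "psc i j k l = (\<Sum>p=1..7. phc i j p * phc p k l)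
     - (if i = k \<and> j = l then 1 else 0) + (if i = l \<and> j = k then 1 else 0)"

lemma phc_antisym:
  assumes "i \<in> {1..7}" "j \<in> {1..7}" "k \<in> {1..7}"
  shows "phc i j k = - phc j i k" "phc i j k = - phc i k j"
proof -
  have "\<forall>i\<in>{1..7}. \<forall>j\<in>{1..7}. \<forall>k\<in>{1..7}. phc i j k = - phc j i k \<and> phc i j k = - phc i k j"
    unfolding ball7 by (simp add: phc_def oct_simps)
  then show "phc i j k = - phc j i k" "phc i j k = - phc i k j" using assms by blast+
qed

lemma phc_phc:
  assumes "i \<in> {1..7}" "j \<in> {1..7}"
  shows "(\<Sum>u=1..7. \<Sum>v=1..7. phc i u v * phc j u v) = (if i = j then 6 else 0)"
proof -
  have "\<forall>i\<in>{1..7}. \<forall>j\<in>{1..7}. (\<Sum>u=1..7. \<Sum>v=1..7. phc i u v * phc j u v) = (if i = j then 6 else 0)"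
    unfolding ball7 by (simp add: sum7 phc_def oct_simps)
  then show ?thesis using assms by blast
qed

lemma phi_form:
  assumes "\<And>u. linear (b u)"
  shows "is_form 3 (phi b e)"
proof -
  have w: "is_form 3 (ewedge b e [i, j, k])" for i j k
    using form_ewedge[where I = "[i, j, k]" and e = e, OF assms] by (simp only: length_Cons list.size(3) numeral_3_eq_3)
  have "is_form 3 (\<lambda>vs. 1 * (1 * (1 * (1 * (1 * (1 * ewedge b e [1,2,7] vs + 1 * ewedge b e [1,3,5] vs)
      + (-1) * ewedge b e [1,4,6] vs) + (-1) * ewedge b e [2,3,6] vs) + (-1) * ewedge b e [2,4,5] vs)
      + 1 * ewedge b e [3,4,7] vs) + 1 * ewedge b e [5,6,7] vs)"
    by (intro form_lincomb w)
  then show ?thesis by (simp add: phi_def[abs_def])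
qed

lemma form3_eq_phc:
  fixes e :: "nat \<Rightarrow> real^7"
  assumes w: "is_form 3 w" and eq: "\<And>i j k. [i, j, k] \<in> incr 3 \<Longrightarrow> w [e i, e j, e k] = phc i j k"
    and ijk: "i \<in> {1..7}" "j \<in> {1..7}" "k \<in> {1..7}"
  shows "w [e i, e j, e k] = phc i j k"
proof -
  define f where "f = (\<lambda>i j k. w [e i, e j, e k] - phc i j k)"
  have 1: "f i j k = - f j i k" "f i j k = - f i k j"
    if "i \<in> {1..7}" "j \<in> {1..7}" "k \<in> {1..7}" for i j k
    using phc_antisym[OF that] form3_symmetric(1,2)[OF w, of "e i" "e j" "e k"] by (simp_all add: f_def)
  have 2: "f i j k = 0" if "i < j" "j < k" "i \<in> {1..7}" "k \<in> {1..7}" for i j k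
    using eq[of i j k] that by (simp add: f_def incr_def)
  have 3: "f i j k = 0" if "i < j" "i \<in> {1..7}" "j \<in> {1..7}" "k \<in> {1..7}" for i j k
    using 2[of i j k] 2[of i k j] 2[of k i j] 1(1)[of i j k] 1(2)[of i j k] 1(1)[of i k j] 1(1)[of i i j] 1(2)[of i j j] that
    by (cases j k rule: linorder_cases; cases i k rule: linorder_cases) auto
  have "f i j k = 0"
    using 3[of i j k] 3[of j i k] 1(1)[of i j k] 1(1)[of i i k] ijk
    by (cases i j rule: linorder_cases) auto
  then show ?thesis by (simp add: f_def)
qed

lemma phi_orth:
  fixes e :: "nat \<Rightarrow> real^7"
  assumes b: "inner_product b" and e: "on_frame b e" and ijk: "i \<in> {1..7}" "j \<in> {1..7}" "k \<in> {1..7}"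
  shows "phi b e [e i, e j, e k] = phc i j k"
proof (rule form3_eq_phc[OF phi_form[OF inner_product_rules(2)[OF b]] _ ijk])
  have *: "\<forall>i\<in>{1..7}. \<forall>j\<in>{1..7}. i < j \<longrightarrow> (\<forall>k\<in>{1..7}. j < k \<longrightarrow> phc i j k =
      (if [1, 2, 7] = [i, j, k] then 1 else 0) + (if [1, 3, 5] = [i, j, k] then 1 else 0)
      - (if [1, 4, 6] = [i, j, k] then 1 else 0) - (if [2, 3, 6] = [i, j, k] then 1 else 0)
      - (if [2, 4, 5] = [i, j, k] then 1 else 0) + (if [3, 4, 7] = [i, j, k] then 1 else 0)
      + (if [5, 6, 7] = [i, j, k] then 1 else 0))"
    unfolding ball7 by (simp add: phc_def oct_simps)
  fix i j k :: nat assume I: "[i, j, k] \<in> incr 3"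
  have in3: "[a, b, c] \<in> incr 3 \<longleftrightarrow> 1 \<le> a \<and> a < b \<and> b < c \<and> c \<le> 7" for a b c by (auto simp: incr_def)
  note ew = ewedge_incr[where g = b and e = e and J = "[i, j, k]", OF on_frame_orth[OF e] _ I, simplified list.map]
  have "phi b e [e i, e j, e k] =
      (if [1, 2, 7] = [i, j, k] then 1 else 0) + (if [1, 3, 5] = [i, j, k] then 1 else 0)
      - (if [1, 4, 6] = [i, j, k] then 1 else 0) - (if [2, 3, 6] = [i, j, k] then 1 else 0)
      - (if [2, 4, 5] = [i, j, k] then 1 else 0) + (if [3, 4, 7] = [i, j, k] then 1 else 0)
      + (if [5, 6, 7] = [i, j, k] then 1 else 0)"
    unfolding phi_def by (simp add: ew in3 del: ewedge.simps)
  also have "\<dots> = phc i j k" using * I by (auto simp: in3)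
  finally show "phi b e [e i, e j, e k] = phc i j k" .
qed

text \<open>The stabiliser of the model form in the general linear Lie algebra is contained in the
  orthogonal one, and annihilates the cross product.\<close>

locale g2_matrix =
  fixes a :: "nat \<Rightarrow> nat \<Rightarrow> real"
  assumes stab: "i \<in> {1..7} \<Longrightarrow> j \<in> {1..7} \<Longrightarrow> k \<in> {1..7} \<Longrightarrow>
    (\<Sum>l=1..7. a i l * phc l j k + a j l * phc i l k + a k l * phc i j l) = 0"
begin

text \<open>The condition is alternating in its indices, so increasing triples carry all of it: 35
  linear equations for 49 entries. They are independent, as the orbit of the model form is open in
  the three-forms, and leave the 14 dimensions of the Lie algebra of G2. Skewness and the vanishing
  contraction follow by linear arithmetic.\<close>

lemma stab_all: "\<forall>i\<in>{1..7}. \<forall>j\<in>{1..7}. i < j \<longrightarrow> (\<forall>k\<in>{1..7}. j < k \<longrightarrow>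
    (\<Sum>l=1..7. a i l * phc l j k + a j l * phc i l k + a k l * phc i j l) = 0)"
  using stab by blast

lemmas stab_eqs = stab_all[unfolded ball7, simplified, unfolded sum7 phc_def, simplified oct_simps, simplified]

lemma antisym:
  assumes "i \<in> {1..7}" "j \<in> {1..7}"
  shows "a i j = - a j i"
proof -
  have "\<forall>i\<in>{1..7}. \<forall>j\<in>{1..7}. a i j = - a j i"
    unfolding ball7 using stab_eqs by (intro conjI; linarith)
  then show ?thesis using assms by blast
qed

lemma contract_phc:
  assumes "m \<in> {1..7}"
  shows "(\<Sum>i=1..7. \<Sum>j=1..7. a i j * phc i j m) = 0"
proof -
  have "\<forall>m\<in>{1..7}. (\<Sum>i=1..7. \<Sum>j=1..7. a i j * phc i j m) = 0"
    unfolding ball7 using stab_eqs by (simp add: sum7 phc_def oct_simps; linarith)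
  then show ?thesis using assms by blast
qed

text \<open>The quadratic part of \<open>psc\<close> contributes a contraction of \<open>a\<close>
  with \<open>phc\<close>, which vanishes; the delta terms give - a_mn + a_nm, and \<open>a\<close>
  is skew.\<close>

lemma contract_psc:
  assumes mn: "m \<in> {1..7}" "n \<in> {1..7}"
  shows "(\<Sum>k=1..7. \<Sum>l=1..7. a k l * psc k l m n) = - 2 * a m n"
proof -
  have "(\<Sum>k=1..7. \<Sum>l=1..7. a k l * psc k l m n) =
     (\<Sum>k=1..7. \<Sum>l=1..7. \<Sum>p=1..7. a k l * phc k l p * phc p m n)
     - (\<Sum>k=1..7. \<Sum>l=1..7. if k = m then if l = n then a k l else 0 else 0)
     + (\<Sum>k=1..7. \<Sum>l=1..7. if k = n then if l = m then a k l else 0 else 0)"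
    unfolding psc_def sum_subtractf[symmetric] sum.distrib[symmetric]
    by (intro sum.cong refl) (auto simp: algebra_simps sum_distrib_left)
  also have "(\<Sum>k=1..7. \<Sum>l=1..7. \<Sum>p=1..7. a k l * phc k l p * phc p m n) =
     (\<Sum>p=1..7. (\<Sum>k=1..7. \<Sum>l=1..7. a k l * phc k l p) * phc p m n)"
  proof -
    have "(\<Sum>k=1..7. \<Sum>l=1..7. \<Sum>p=1..7. a k l * phc k l p * phc p m n)
      = (\<Sum>k=1..7. \<Sum>p=1..7. \<Sum>l=1..7. a k l * phc k l p * phc p m n)" by (rule sum.cong[OF refl sum.swap])
    also have "\<dots> = (\<Sum>p=1..7. \<Sum>k=1..7. \<Sum>l=1..7. a k l * phc k l p * phc p m n)" by (rule sum.swap)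
    finally show ?thesis by (simp only: sum_distrib_right)
  qed
  also have "\<dots> = 0" using contract_phc by simp
  also have "(\<Sum>k=1..7. \<Sum>l=1..7. if k = m then if l = n then a k l else 0 else 0) = a m n"
    using mn by (subst sum.swap) simp
  also have "(\<Sum>k=1..7. \<Sum>l=1..7. if k = n then if l = m then a k l else 0 else 0) = a n m"
    using mn by (subst sum.swap) simp
  finally show ?thesis using antisym[OF mn] by simp
qed

end


text \<open>Only the index given by the absolute value of \<open>oct i j\<close> contributes to the
  sum, which makes \<open>psc\<close> cheap to evaluate. For \<open>i = j\<close> the table entry is
  0 and \<open>sgn\<close> removes the meaningless index 0.\<close>

lemma psc_oct:
  assumes "i \<in> {1..7}" "j \<in> {1..7}"
  shows "psc i j k l = sgn (oct i j) * phc (nat \<bar>oct i j\<bar>) k l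
     - (if i = k \<and> j = l then 1 else 0) + (if i = l \<and> j = k then 1 else 0)"
proof -
  have "\<forall>i\<in>{1..7}. \<forall>j\<in>{1..7}. (\<Sum>p=1..7. phc i j p * h p) = sgn (oct i j) * h (nat \<bar>oct i j\<bar>)"
    for h :: "nat \<Rightarrow> real"
    unfolding ball7 by (simp add: sum7 phc_def oct_simps flip: One_nat_def)
  then show ?thesis using assms by (simp add: psc_def)
qed

lemma volume_list:
  assumes b: "inner_product b" and e: "on_frame b e" and L: "length L = 7" "set L \<subseteq> {1..7}"
  shows "ewedge b e [1..<8] (map e L) = (if distinct L then (- 1) ^ inversions L else 0)"
proof (cases "distinct L")
  case True
  then have "sort L \<in> incr 7" using L by (simp add: incr_def strict_sorted_iff)
  then have "sort L = [1..<8]" by (simp add: incr7 del: upt.simps)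
  then show ?thesis
    using form_sort[OF volume_form(1)[OF b e], of "[]" e L] volume_form(2)[OF b e] L True by (simp del: upt.simps)
next
  case False
  then obtain i j where "i < j" "j < length L" "L ! i = L ! j"
    unfolding distinct_conv_nth by (metis linorder_neqE_nat)
  then have "ewedge b e [1..<8] (map e L) = 0"
    using L by (intro form_repeated_nth[OF volume_form(1)[OF b e], of _ i j]) auto
  then show ?thesis using False by simp
qed

lemma psc_antisym:
  assumes "i \<in> {1..7}" "j \<in> {1..7}" "k \<in> {1..7}" "l \<in> {1..7}"
  shows "psc i j k l = - psc j i k l" "psc i j k l = - psc i j l k"
proof -
  have 1: "X = - Y \<Longrightarrow> X - (if P \<and> Q then 1 else 0) + (if R \<and> S then 1 else 0) =
      - (Y - (if S \<and> R then 1 else 0) + (if Q \<and> P then 1 else 0))"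
    and 2: "X = - Y \<Longrightarrow> X - (if P \<and> Q then 1 else 0) + (if R \<and> S then 1 else 0) =
      - (Y - (if R \<and> S then 1 else 0) + (if P \<and> Q then 1 else 0))" for X Y :: real and P Q R S
    by auto
  have "(\<Sum>p=1..7. phc i j p * phc p k l) = (\<Sum>p=1..7. - (phc j i p * phc p k l))"
    by (intro sum.cong refl) (simp add: phc_antisym(1)[OF assms(1,2)])
  then show "psc i j k l = - psc j i k l" unfolding psc_def sum_negf by (rule 1)
  have "(\<Sum>p=1..7. phc i j p * phc p k l) = (\<Sum>p=1..7. - (phc i j p * phc p l k))"
    by (intro sum.cong refl) (simp add: phc_antisym(2)[OF _ assms(3,4)])
  then show "psc i j k l = - psc i j l k" unfolding psc_def sum_negf by (rule 2)
qed

lemma antisym2_eq: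
  fixes f h :: "nat \<Rightarrow> nat \<Rightarrow> real"
  assumes "f i j = - f j i" "h i j = - h j i" "i < j \<Longrightarrow> f i j = h i j" "j < i \<Longrightarrow> f j i = h j i"
  shows "f i j = h i j"
  using assms by (cases i j rule: linorder_cases) auto

lemma form4_symmetric:
  assumes "is_form 4 \<alpha>"
  shows "\<alpha> [x, y, z, w] = - \<alpha> [y, x, z, w]" "\<alpha> [x, y, z, w] = - \<alpha> [x, z, y, w]"
    "\<alpha> [x, y, z, w] = - \<alpha> [x, y, w, z]"
  using form_swap[OF assms, of "[]" x y "[z, w]"] form_swap[OF assms, of "[x]" y z "[w]"]
    form_swap[OF assms, of "[x, y]" z w "[]"] by simp_all

text \<open>The values of \<open>*\<omega>\<close> on increasing quadruples of vectors of an adapted frame.\<close>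

definition psi_incr :: "nat list \<Rightarrow> real" where
  "psi_incr I = (if I \<in> {[3,4,5,6], [2,3,5,7], [1,4,5,7], [1,3,6,7], [1,2,5,6], [1,2,3,4]} then 1
     else if I = [2,4,6,7] then -1 else 0)"

lemma psi_incr_psc:
  assumes "i \<in> {1..7}" "j \<in> {1..7}" "k \<in> {1..7}" "l \<in> {1..7}" "i < j" "k < l"
  shows "(if distinct [i, j, k, l] then (- 1) ^ inversions [i, j, k, l] * psi_incr (sort [i, j, k, l]) else 0) = psc i j k l"
proof -
  have "\<forall>i\<in>{1..7}. \<forall>j\<in>{i<..7}. \<forall>k\<in>{1..7}. \<forall>l\<in>{k<..7}.
    (if distinct [i, j, k, l] then (- 1) ^ inversions [i, j, k, l] * psi_incr (sort [i, j, k, l]) else 0) = psc i j k l"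
    unfolding ball7 ball_greater7
    by (intro conjI TrueI; simp add: psi_incr_def psc_oct phc_def oct_simps flip: One_nat_def)
  from this[rule_format, of i j k l] show ?thesis using assms by simp
qed

text \<open>\<open>Q\<close> evaluates the star through the seven terms of the model form and signs
  of permutations. It is compared with \<open>psi_incr\<close> at the 35 increasing quadruples only
  and extended by alternation. Since \<open>psc\<close> is known to be skew only within its first
  and within its last pair of indices, \<open>psi_incr_psc\<close> covers all quadruples with
  \<open>i < j\<close> and \<open>k < l\<close>.\<close>

lemma hodge_components:
  assumes b: "inner_product b" and e: "on_frame b e"
    and w: "\<And>i j k. i \<in> {1..7} \<Longrightarrow> j \<in> {1..7} \<Longrightarrow> k \<in> {1..7} \<Longrightarrow> w [e i, e j, e k] = phc i j k"
    and ijkl: "i \<in> {1..7}" "j \<in> {1..7}" "k \<in> {1..7}" "l \<in> {1..7}"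
  shows "hodge b e 3 w [e i, e j, e k, e l] = psc i j k l"
proof -
  define P where "P = (\<lambda>i j k l. hodge b e 3 w [e i, e j, e k, e l])"
  define s where "s = (\<lambda>L. if distinct L then (- 1) ^ inversions L else (0::real))"
  define Q where "Q = (\<lambda>i j k l. s [1,2,7,i,j,k,l] + s [1,3,5,i,j,k,l] - s [1,4,6,i,j,k,l] - s [2,3,6,i,j,k,l]
      - s [2,4,5,i,j,k,l] + s [3,4,7,i,j,k,l] + s [5,6,7,i,j,k,l])"
  note an = form4_symmetric[OF hodge_form[OF b e, of w]]
  have P: "P i j k l = Q i j k l"
    if ijkl: "i \<in> {1..7}" "j \<in> {1..7}" "k \<in> {1..7}" "l \<in> {1..7}" for i j k l
  proof -
    have v: "ewedge b e [1..<8] (map e [p, q, r] @ [e i, e j, e k, e l]) = s [p, q, r, i, j, k, l]"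
      if "p \<in> {1..7}" "q \<in> {1..7}" "r \<in> {1..7}" for p q r
      using volume_list[OF b e, of "[p, q, r, i, j, k, l]"] that ijkl
      unfolding s_def by (simp only: list.map append.simps) simp
    have "P i j k l = (\<Sum>p=1..7. \<Sum>q\<in>{p<..7}. \<Sum>r\<in>{q<..7}. phc p q r * s [p, q, r, i, j, k, l])"
      unfolding P_def hodge_def sum_incr3 by (intro sum.cong refl, subst v) (auto simp: w)
    also have "\<dots> = Q i j k l"
      unfolding sum7 sum_greater7 Q_def by (simp add: phc_def oct_simps)
    finally show ?thesis .
  qed
  have *: "\<forall>i\<in>{1..7}. \<forall>j\<in>{i<..7}. \<forall>k\<in>{j<..7}. \<forall>l\<in>{k<..7}. Q i j k l = psi_incr [i, j, k, l]"
    unfolding ball7 ball_greater7 by (intro conjI TrueI; simp add: Q_def s_def psi_incr_def)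
  have inc: "hodge b e 3 w (map e I) = psi_incr I" if I4: "I \<in> incr 4" for I
  proof -
    obtain i j k l where I: "I = [i, j, k, l]" "1 \<le> i" "i < j" "j < k" "k < l" "l \<le> 7"
      using I4 unfolding incr4_iff by auto
    then have "i \<in> {1..7}" "j \<in> {1..7}" "k \<in> {1..7}" "l \<in> {1..7}" by auto
    then show ?thesis using P[of i j k l] *[rule_format, of i j k l] I unfolding P_def by simp
  qed
  have 1: "P i j k l = psc i j k l"
    if ijkl: "i \<in> {1..7}" "j \<in> {1..7}" "k \<in> {1..7}" "l \<in> {1..7}" "i < j" "k < l" for i j k l
  proof -
    let ?I = "[i, j, k, l]"
    have "P i j k l = (if distinct ?I then (- 1) ^ inversions ?I * psi_incr (sort ?I) else 0)"
    proof (cases "distinct ?I")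
      case True
      then have "sort ?I \<in> incr 4" using ijkl by (simp add: incr_def strict_sorted_iff)
      have "P i j k l = hodge b e 3 w ([] @ map e ?I)" by (simp only: P_def list.map append_Nil)
      also have "\<dots> = (- 1) ^ inversions ?I * hodge b e 3 w ([] @ map e (sort ?I))"
        by (rule form_sort[OF hodge_form[OF b e]]) simp
      also have "hodge b e 3 w ([] @ map e (sort ?I)) = psi_incr (sort ?I)"
        unfolding append_Nil by (rule inc) fact
      finally show ?thesis using True by (simp only: if_True)
    next
      case False
      then obtain m n where mn: "m < n" "n < length ?I" "?I ! m = ?I ! n"
        unfolding distinct_conv_nth by (metis linorder_neqE_nat)
      have eq: "map e ?I ! m = map e ?I ! n"
        using mn(3) by (simp only: nth_map[OF mn(2)] nth_map[OF order.strict_trans[OF mn(1,2)]])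
      have "hodge b e 3 w (map e ?I) = 0"
        by (rule form_repeated_nth[OF hodge_form[OF b e] _ mn(1) _ eq]) (use mn(2) in simp_all)
      then show ?thesis using False by (simp only: P_def list.map if_False)
    qed
    also have "\<dots> = psc i j k l" by (rule psi_incr_psc[OF ijkl])
    finally show ?thesis .
  qed
  have 2: "P i j k l = psc i j k l" if "i \<in> {1..7}" "j \<in> {1..7}" "k \<in> {1..7}" "l \<in> {1..7}" "i < j" for i j k l
  proof (rule antisym2_eq[where f = "P i j" and h = "psc i j"])
    show "P i j k l = - P i j l k" unfolding P_def by (rule an(3))
  qed (use that 1 psc_antisym(2) in blast)+
  have "P i j k l = psc i j k l"
  proof (rule antisym2_eq[where f = "\<lambda>i j. P i j k l" and h = "\<lambda>i j. psc i j k l"])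
    show "P i j k l = - P j i k l" unfolding P_def by (rule an(1))
  qed (use ijkl 2 psc_antisym(1) in blast)+
  then show ?thesis by (simp add: P_def)
qed


section \<open>Second derivatives and curvature\<close>

context mfd begin

text \<open>Both sides are mixed partial derivatives of one function in the chart at
  \<open>p\<close>, because the fields have constant components there.\<close>

lemma mixed_dir_deriv:
  fixes F :: "'m \<Rightarrow> real"
  assumes F: "smooth_fun A (fst (chart_at A p)) F"
  shows "dir_deriv A p y (\<lambda>r. dir_deriv A r (const_ext A p x r) F)
    = dir_deriv A p x (\<lambda>r. dir_deriv A r (const_ext A p y r) F)"
proof -
  let ?c = "chart_at A p"
  let ?f = "F \<circ> chart_inv ?c" and ?V = "snd ?c ` fst ?c"
  note V = chart_image_open[OF chart_at(1), of p]
  have f: "smooth_on ?V ?f" by (rule smooth_fun_chartD[OF F chart_at(1) order_refl])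
  have pV: "snd ?c p \<in> ?V" using chart_at(2) by auto
  have d: "dir_deriv A r (const_ext A p x r) F = frechet_derivative ?f (at (snd ?c r)) x"
    if "r \<in> fst ?c" for r x
    using frechet_derivative_eqI[OF has_mderiv_in_chart[OF chart_at(1) that smooth_fun_mdiff[OF F that]]]
    by (simp add: const_ext_def)
  have "dir_deriv A p y (\<lambda>r. dir_deriv A r (const_ext A p x r) F)
      = frechet_derivative (\<lambda>y. frechet_derivative ?f (at y) x) (at (snd ?c p)) y" for x y
    unfolding dir_deriv_def[of A p y]
    by (subst frechet_derivative_cong_open[OF V pV]) (auto simp: d chart_at)
  then show ?thesis using second_derivative_symmetric[OF V f pV] by simp
qed

end

context conn begin

lemma conn_diff:
  assumes "open U" "p \<in> U" "smooth_vf A U Y" "smooth_vf A U Z"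
  shows "smooth_vf A U (\<lambda>q. Y q - Z q)" "D p v (\<lambda>q. Y q - Z q) = D p v Y - D p v Z"
proof -
  have "smooth_vf A U (\<lambda>q. (-1) *\<^sub>R Z q)"
    by (rule smooth_vf_scaleR[OF assms(1) smooth_fun_const assms(4)])
  then show "smooth_vf A U (\<lambda>q. Y q - Z q)" "D p v (\<lambda>q. Y q - Z q) = D p v Y - D p v Z"
    using smooth_vf_add[OF assms(1,3)] conn_add[OF assms(1-3)] conn_scaleR_const[OF assms(1,2,4), of v "-1"]
    by fastforce+
qed

text \<open>The second covariant derivative of the coordinate field \<open>z\<close>, which is not tensorial.\<close>

definition hd :: "'m \<Rightarrow> real^'n \<Rightarrow> real^'n \<Rightarrow> real^'n \<Rightarrow> real^'n" where
  "hd p x y z = D p x (\<lambda>q. D q (const_ext A p y q) (const_ext A p z))"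

lemma cderiv_smooth: "smooth_vf A (fst (chart_at A p)) (\<lambda>q. D q (const_ext A p y q) (const_ext A p z))"
  by (rule conn_smooth[OF chart_open[OF chart_at(1)] smooth_vf_const_ext smooth_vf_const_ext])

lemma cderiv_linear:
  assumes "q \<in> fst (chart_at A p)"
  shows "linear (\<lambda>y. D q (const_ext A p y q) (const_ext A p z))"
    "linear (\<lambda>z. D q (const_ext A p y q) (const_ext A p z))"
proof -
  note U = chart_open[OF chart_at(1)] assms
  have l: "linear (\<lambda>v. D q v (const_ext A p z))" for z by (rule conn_linear[OF U smooth_vf_const_ext])
  show "linear (\<lambda>y. D q (const_ext A p y q) (const_ext A p z))"
    using linear_compose[OF const_ext_linear[OF assms] l] by (simp add: o_def)
  show "linear (\<lambda>z. D q (const_ext A p y q) (const_ext A p z))"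
  proof
    show "D q v (const_ext A p (a + b)) = D q v (const_ext A p a) + D q v (const_ext A p b)" for v a b
      by (subst conn_add[OF U smooth_vf_const_ext smooth_vf_const_ext, symmetric],
          rule conn_local[OF U smooth_vf_const_ext])
        (simp add: linear_add[OF const_ext_linear])
    show "D q v (const_ext A p (k *\<^sub>R a)) = k *\<^sub>R D q v (const_ext A p a)" for v k a
      by (subst conn_scaleR_const[OF U smooth_vf_const_ext, symmetric],
          rule conn_local[OF U smooth_vf_const_ext])
        (simp add: linear_scale[OF const_ext_linear])
  qed
qed

lemma hd_linear: "linear (\<lambda>x. hd p x y z)" "linear (\<lambda>y. hd p x y z)" "linear (\<lambda>z. hd p x y z)"
proof -
  note U = chart_open[OF chart_at(1)] chart_at(2)
  note s = cderiv_smooth[of p]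
  show "linear (\<lambda>x. hd p x y z)" unfolding hd_def by (rule conn_linear[OF U s])
  show "linear (\<lambda>y. hd p x y z)"
  proof
    show "hd p x (a + b) z = hd p x a z + hd p x b z" for a b
      unfolding hd_def by (subst conn_add[OF U s s, symmetric], rule conn_local[OF U s])
        (simp add: linear_add[OF cderiv_linear(1)])
    show "hd p x (k *\<^sub>R a) z = k *\<^sub>R hd p x a z" for k a
      unfolding hd_def by (subst conn_scaleR_const[OF U s, symmetric], rule conn_local[OF U s])
        (simp add: linear_scale[OF cderiv_linear(1)])
  qed
  show "linear (\<lambda>z. hd p x y z)"
  proof
    show "hd p x y (a + b) = hd p x y a + hd p x y b" for a b
      unfolding hd_def by (subst conn_add[OF U s s, symmetric], rule conn_local[OF U s])
        (simp add: linear_add[OF cderiv_linear(2)])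
    show "hd p x y (k *\<^sub>R a) = k *\<^sub>R hd p x y a" for k a
      unfolding hd_def by (subst conn_scaleR_const[OF U s, symmetric], rule conn_local[OF U s])
        (simp add: linear_scale[OF cderiv_linear(2)])
  qed
qed

lemma curvature_hd: "curvature A D p x y z = hd p x y z - hd p y x z"
proof -
  note U = chart_open[OF chart_at(1)] chart_at(2)
  have "D p 0 (const_ext A p z) = 0" using linear_0[OF conn_linear[OF U smooth_vf_const_ext]] .
  then show ?thesis
    by (simp add: curvature_def Let_def const_ext_self lie_bracket_const_ext[OF chart_at(2)] hd_def)
qed

lemma torsion_form_const_ext:
  assumes "r \<in> fst (chart_at A p)"
  shows "torsion_form A g D r [const_ext A p x r, const_ext A p y r, z] =
    g r (D r (const_ext A p x r) (const_ext A p y) - D r (const_ext A p y r) (const_ext A p x)) z"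
  unfolding torsion_form_chr
  using torsion_fields[OF chart_open[OF chart_at(1)] assms smooth_vf_const_ext smooth_vf_const_ext]
  by (simp add: lie_bracket_const_ext[OF assms])

end

lemma form_smooth_const_ext:
  assumes "oriented_manifold A" "smooth_form A 3 \<alpha>"
  shows "smooth_fun A (fst (chart_at A p)) (\<lambda>r. \<alpha> r [const_ext A p x r, const_ext A p y r, const_ext A p z r])"
proof -
  interpret mfd A by unfold_locales (rule assms)
  have "smooth_on (snd (chart_at A p) ` fst (chart_at A p))
     ((\<lambda>r. \<alpha> r (map (from_chart A (chart_at A p) r) [x, y, z])) \<circ> chart_inv (chart_at A p))"
    by (rule bspec[OF conjunct2[OF assms(2)[unfolded smooth_form_def]] chart_at(1), rule_format]) simp
  from smooth_fun_chartI[OF chart_at(1) chart_open[OF chart_at(1)] order_refl this]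
  show ?thesis by (simp add: const_ext_def)
qed

lemma form3I:
  assumes "\<And>y z. linear (\<lambda>x. f [x, y, z])" "\<And>x z. linear (\<lambda>y. f [x, y, z])" "\<And>x y. linear (\<lambda>z. f [x, y, z])"
    and "\<And>x z. f [x, x, z] = 0" "\<And>x z. f [z, x, x] = 0"
  shows "is_form 3 f"
proof (rule is_formI)
  show "linear (\<lambda>v. f (pre @ v # post))" if "Suc (length pre + length post) = 3" for pre post
  proof -
    have "(\<exists>y z. pre = [] \<and> post = [y, z]) \<or> (\<exists>y z. pre = [y] \<and> post = [z]) \<or> (\<exists>y z. pre = [y, z] \<and> post = [])"
      using that by (cases pre rule: remdups_adj.cases; cases post rule: remdups_adj.cases) auto
    then show ?thesis using assms(1-3) by auto
  qed
  show "f (pre @ x # x # post) = 0" if "length pre + length post + 2 = 3" for pre x post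
  proof -
    have "(\<exists>z. pre = [] \<and> post = [z]) \<or> (\<exists>z. pre = [z] \<and> post = [])"
      using that by (cases pre rule: remdups_adj.cases; cases post rule: remdups_adj.cases) auto
    then show ?thesis using assms(4,5) by auto
  qed
qed

text \<open>In the next two lemmas \<open>h a b c d\<close> stands for \<open>g (hd a b c) d\<close> and \<open>m a b c d\<close> for
  \<open>g (\<nabla>\<^sub>a b) (\<nabla>\<^sub>c d)\<close>; \<open>dt\<close> is the derivative of the components of the torsion and \<open>n\<close> its
  covariant derivative. The first one is the Bianchi identity, summed in such a way that the term
  quadratic in the torsion drops out.\<close>

lemma bianchi_algebra:
  fixes h m :: "'v \<Rightarrow> 'v \<Rightarrow> 'v \<Rightarrow> 'v \<Rightarrow> real"
  assumes m: "\<And>a b c d. m a b c d = m c d a b"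
    and dt: "\<And>a b c d. dt a b c d = h a b c d - h a c b d + m b c a d - m c b a d"
    and alt: "\<And>a b c d. dt a b c d = - dt a b d c"
    and n: "\<And>a b c d. n a b c d = dt a b c d - (m c d a b - m d c a b) - (m d b a c - m b d a c) - (m b c a d - m c b a d)"
    and R: "\<And>a b c d. R a b c d = h a b c d - h b a c d" "\<And>a b c d. R a b c d = - R a b d c"
  shows "dt x i k l - dt i x k l + dt k x i l - dt l x i k + 2 * n x i k l
    = 2 * (R x i k l + R x k l i + R x l i k)"
  \<comment> \<open>The values of \<open>h\<close> and \<open>m\<close> are treated as unknown
    reals; with these instances of the symmetries the claim is a consequence of linear
    equations.\<close>
  using alt[of x i k l] alt[of x k i l] alt[of i x k l] alt[of i k l x] alt[of k x i l] alt[of k i l x]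
    alt[of l x i k] alt[of l i k x] R(2)[of i x k l] R(2)[of i k l x] R(2)[of i l k x]
    R(2)[of k x i l] R(2)[of k l i x] R(2)[of l x i k]
    m[of i x k l] m[of i x l k] m[of i k x l] m[of i k l x] m[of i l x k] m[of i l k x]
    m[of k x l i] m[of k i x l] m[of k i l x] m[of k l x i] m[of l i x k] m[of l k x i]
  unfolding R(1) n dt by argo

lemma levi_civita_algebra:
  fixes h m :: "'v \<Rightarrow> 'v \<Rightarrow> 'v \<Rightarrow> 'v \<Rightarrow> real"
  assumes m: "\<And>a b c d. m a b c d = m c d a b"
    and dt: "\<And>a b c d. dt a b c d = h a b c d - h a c b d + m b c a d - m c b a d"
    and n: "\<And>a b c d. n a b c d = dt a b c d - (m c d a b - m d c a b) - (m d b a c - m b d a c) - (m b c a d - m c b a d)"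
    and R: "\<And>a b c d. R a b c d = h a b c d - h b a c d"
    and kg: "\<And>x y z v. kg x y z v = 1/2 * (h x y z v + h x z y v)
      - 1/4 * (m v x y z - m x v y z + m v x z y - m x v z y)"
    and P: "\<And>a b c d. P a b c d = m a b c d - m b a c d - m a b d c + m b a d c"
  shows "R x i k l = kg x i k l - kg i x k l + 1/2 * n x i k l - 1/2 * n i x k l
     + 1/2 * P x i k l + 1/4 * P x l i k - 1/4 * P i l x k"
  unfolding R n dt kg P
  using m[of i x k l] m[of i x l k] m[of k l x i] m[of l k x i] by argo


section \<open>The characteristic connection\<close>

locale g2_conn = conn A D for A :: "('m::{t2_space, second_countable_topology}, 7) chart set" and D +
  fixes g :: "'m \<Rightarrow> real^7 \<Rightarrow> real^7 \<Rightarrow> real" and \<omega> :: "'m \<Rightarrow> (real^7) form"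
  assumes metric: "riemannian_metric A g" and g2: "G2_structure A g \<omega>"
    and parallel: "\<And>p v vs. length vs = 3 \<Longrightarrow> cov_form A D \<omega> p v vs = 0"
    and skew: "\<And>p. is_form 3 (torsion_form A g D p)"
begin

abbreviation T :: "'m \<Rightarrow> (real^7) form" where "T \<equiv> torsion_form A g D"

lemma ip: "inner_product (g p)"
  using metric by (simp add: riemannian_metric_def)

lemmas g_lin = inner_product_rules(1,2)[OF ip] and g_sym = inner_product_rules(3)[OF ip]

lemmas g_simps = linear_add[OF g_lin(1)] linear_add[OF g_lin(2)] linear_diff[OF g_lin(1)] linear_diff[OF g_lin(2)]
  linear_scale[OF g_lin(1)] linear_scale[OF g_lin(2)] linear_0[OF g_lin(1)] linear_0[OF g_lin(2)]

lemma \<omega>_smooth: "smooth_form A 3 \<omega>"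
  using g2 by (simp add: G2_structure_def)

lemma \<omega>_form: "is_form 3 (\<omega> p)"
  using \<omega>_smooth by (simp add: smooth_form_def)

lemma ex_local_frame: "\<exists>U e. p \<in> U \<and> local_adapted_frame A g \<omega> U e"
  using g2 by (simp add: G2_structure_def)

lemma ex_adapted_frame: "\<exists>e. adapted_frame (g p) (\<omega> p) e"
  using ex_local_frame[of p] by (auto simp: local_adapted_frame_def)

lemma adapted_on_frame: "adapted_frame b w e \<Longrightarrow> on_frame b e"
  by (simp add: adapted_frame_def)

lemma \<omega>_components:
  assumes "adapted_frame (g p) (\<omega> p) e" "i \<in> {1..7}" "j \<in> {1..7}" "k \<in> {1..7}"
  shows "\<omega> p [e i, e j, e k] = phc i j k"
  using assms phi_orth[OF ip, of p e i j k] by (simp add: adapted_frame_def)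

lemma frame_sum: "on_frame (g p) e \<Longrightarrow> x = (\<Sum>i=1..7. g p x (e i) *\<^sub>R e i)"
  by (rule frame_expand[OF ip])

lemma \<omega>_expand:
  assumes e: "adapted_frame (g p) (\<omega> p) e" and ij: "i \<in> {1..7}" "j \<in> {1..7}"
  shows "\<omega> p [x, e i, e j] = (\<Sum>l=1..7. g p x (e l) * phc l i j)"
    "\<omega> p [e i, x, e j] = (\<Sum>l=1..7. g p x (e l) * phc i l j)"
    "\<omega> p [e i, e j, x] = (\<Sum>l=1..7. g p x (e l) * phc i j l)"
proof -
  note on = adapted_on_frame[OF e]
  note lin = form3_linear[OF \<omega>_form, of p]
  show "\<omega> p [x, e i, e j] = (\<Sum>l=1..7. g p x (e l) * phc l i j)"
    by (subst frame_sum[OF on, of x])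
      (simp add: linear_sum[OF lin(1)] linear_scale[OF lin(1)], intro sum.cong refl, simp add: \<omega>_components[OF e _ ij])
  show "\<omega> p [e i, x, e j] = (\<Sum>l=1..7. g p x (e l) * phc i l j)"
    by (subst frame_sum[OF on, of x])
      (simp add: linear_sum[OF lin(2)] linear_scale[OF lin(2)], intro sum.cong refl, simp add: \<omega>_components[OF e ij(1) _ ij(2)])
  show "\<omega> p [e i, e j, x] = (\<Sum>l=1..7. g p x (e l) * phc i j l)"
    by (subst frame_sum[OF on, of x])
      (simp add: linear_sum[OF lin(3)] linear_scale[OF lin(3)], intro sum.cong refl, simp add: \<omega>_components[OF e ij])
qed

section \<open>Connection matrices and curvature in the stabiliser algebra\<close>

lemma g2_matrix_endomorphism:
  assumes e: "adapted_frame (g p) (\<omega> p) e"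
    and L: "\<And>i j k. i \<in> {1..7} \<Longrightarrow> j \<in> {1..7} \<Longrightarrow> k \<in> {1..7} \<Longrightarrow>
      \<omega> p [L i, e j, e k] + \<omega> p [e i, L j, e k] + \<omega> p [e i, e j, L k] = 0"
  shows "g2_matrix (\<lambda>i j. g p (L i) (e j))"
proof
  fix i j k :: nat assume ijk: "i \<in> {1..7}" "j \<in> {1..7}" "k \<in> {1..7}"
  show "(\<Sum>l=1..7. g p (L i) (e l) * phc l j k + g p (L j) (e l) * phc i l k + g p (L k) (e l) * phc i j l) = 0"
    using L[OF ijk]
    by (simp add: sum.distrib \<omega>_expand(1)[OF e ijk(2,3)] \<omega>_expand(2)[OF e ijk(1,3)] \<omega>_expand(3)[OF e ijk(1,2)])
qed

lemma \<omega>_deriv: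
  assumes "open U" "q \<in> U" "smooth_vf A U X" "smooth_vf A U Y" "smooth_vf A U Z"
  shows "dir_deriv A q v (\<lambda>r. \<omega> r [X r, Y r, Z r]) =
      \<omega> q [D q v X, Y q, Z q] + \<omega> q [X q, D q v Y, Z q] + \<omega> q [X q, Y q, D q v Z]"
  using cov_form_fields(2)[OF \<omega>_smooth assms, of v] parallel[of "[X q, Y q, Z q]"] by simp

text \<open>The components of \<omega> in an adapted frame are constants; differentiating them by
  the product rule for a parallel form gives the stabiliser condition.\<close>

lemma frame_connection:
  assumes e: "local_adapted_frame A g \<omega> U e" and q: "q \<in> U"
  shows "g2_matrix (\<lambda>i j. g q (D q v (\<lambda>r. e r i)) (e q j))"
proof (rule g2_matrix_endomorphism)
  note U = e[unfolded local_adapted_frame_def]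
  show "adapted_frame (g q) (\<omega> q) (e q)" using U q by blast
  fix i j k :: nat assume ijk: "i \<in> {1..7}" "j \<in> {1..7}" "k \<in> {1..7}"
  have "dir_deriv A q v (\<lambda>r. \<omega> r [e r i, e r j, e r k]) = dir_deriv A q v (\<lambda>r. phc i j k)"
    using U q ijk by (intro dir_deriv_cong[of U]) (auto intro: \<omega>_components)
  also have "\<dots> = 0" by (simp add: dir_deriv_eq[OF has_mderiv_const])
  finally show "\<omega> q [D q v (\<lambda>r. e r i), e q j, e q k] + \<omega> q [e q i, D q v (\<lambda>r. e r j), e q k]
      + \<omega> q [e q i, e q j, D q v (\<lambda>r. e r k)] = 0"
    using \<omega>_deriv[of U q "\<lambda>r. e r i" "\<lambda>r. e r j" "\<lambda>r. e r k" v] U q ijk by simp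
qed

lemma bilinear_zero:
  fixes f :: "real^7 \<Rightarrow> real^7 \<Rightarrow> real"
  assumes "on_frame (g p) e" "\<And>y. linear (\<lambda>x. f x y)" "\<And>x. linear (f x)"
    and "\<And>i j. i \<in> {1..7} \<Longrightarrow> j \<in> {1..7} \<Longrightarrow> f (e i) (e j) = 0"
  shows "f x y = 0"
proof -
  have 1: "f x (e j) = 0" if "j \<in> {1..7}" for x j
    by (subst frame_sum[OF assms(1), of x])
      (simp add: linear_sum[OF assms(2)] linear_scale[OF assms(2)], intro sum.neutral ballI, simp add: assms(4)[OF _ that])
  show ?thesis
    by (subst frame_sum[OF assms(1), of y]) (simp add: linear_sum[OF assms(3)] linear_scale[OF assms(3)] 1)
qed

text \<open>Metric compatibility is inherited from \<omega>: in an adapted frame the metric has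
  constant components, and the connection matrix is skew because it stabilises the model
  form.\<close>

lemma metric_parallel: "cov_metric g q v x y = 0"
proof -
  obtain U e where q: "q \<in> U" and e: "local_adapted_frame A g \<omega> U e" using ex_local_frame by blast
  note U = e[unfolded local_adapted_frame_def]
  interpret a: g2_matrix "\<lambda>i j. g q (D q v (\<lambda>r. e r i)) (e q j)" by (rule frame_connection[OF e q])
  show ?thesis
  proof (rule bilinear_zero[OF _ cov_metric_linear[OF metric]])
    show "on_frame (g q) (e q)" using U q adapted_on_frame by blast
    fix i j :: nat assume ij: "i \<in> {1..7}" "j \<in> {1..7}"
    have "dir_deriv A q v (\<lambda>r. g r (e r i) (e r j)) = dir_deriv A q v (\<lambda>r. if i = j then 1 else 0)"
      using U q ij by (intro dir_deriv_cong[of U]) (auto simp: on_frame_orth[OF adapted_on_frame])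
    also have "\<dots> = 0" by (simp add: dir_deriv_eq[OF has_mderiv_const])
    finally show "cov_metric g q v (e q i) (e q j) = 0"
      using cov_metric_fields(2)[OF metric, of U q "\<lambda>r. e r i" "\<lambda>r. e r j" v] U q ij a.antisym[OF ij]
      by (simp add: g_sym[of q "e q i"])
  qed
qed

lemma g_deriv:
  assumes "open U" "q \<in> U" "smooth_vf A U X" "smooth_vf A U Y"
  shows "dir_deriv A q v (\<lambda>r. g r (X r) (Y r)) = g q (D q v X) (Y q) + g q (X q) (D q v Y)"
  using cov_metric_fields(2)[OF metric assms, of v] metric_parallel by simp

text \<open>Differentiate \<omega>(u, v, w) along two coordinate fields. The mixed derivatives agree
  and the products of first derivatives are symmetric in \<open>x\<close> and \<open>y\<close>, so
  antisymmetrising leaves the curvature acting as a derivation.\<close>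

lemma curvature_stabilises:
  "\<omega> p [curvature A D p x y u, v, w] + \<omega> p [u, curvature A D p x y v, w] + \<omega> p [u, v, curvature A D p x y w] = 0"
proof -
  let ?U = "fst (chart_at A p)" and ?E = "const_ext A p"
  note U = chart_open[OF chart_at(1), of p] and p = chart_at(2)[of p]
  note s = smooth_vf_const_ext[of p] cderiv_smooth[of p]
  note lin = form3_linear[OF \<omega>_form, of p]
  have d2: "dir_deriv A p x (\<lambda>r. dir_deriv A r (?E y r) (\<lambda>r. \<omega> r [?E u r, ?E v r, ?E w r])) =
     (\<omega> p [hd p x y u, v, w] + \<omega> p [chr p y u, chr p x v, w] + \<omega> p [chr p y u, v, chr p x w]) +
     (\<omega> p [chr p x u, chr p y v, w] + \<omega> p [u, hd p x y v, w] + \<omega> p [u, chr p y v, chr p x w]) +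
     (\<omega> p [chr p x u, v, chr p y w] + \<omega> p [u, chr p x v, chr p y w] + \<omega> p [u, v, hd p x y w])" for x y
  proof -
    let ?D = "\<lambda>z r. D r (?E y r) (?E z)"
    have m: "has_mderiv p (\<lambda>r. \<omega> r [X r, Y r, Z r]) (\<lambda>v. \<omega> p [D p v X, Y p, Z p] + \<omega> p [X p, D p v Y, Z p] + \<omega> p [X p, Y p, D p v Z])"
      if "smooth_vf A ?U X" "smooth_vf A ?U Y" "smooth_vf A ?U Z" for X Y Z
      using cov_form_fields(1)[OF \<omega>_smooth U p that] \<omega>_deriv[OF U p that] by (simp add: mdiff_def)
    have "dir_deriv A p x (\<lambda>r. dir_deriv A r (?E y r) (\<lambda>r. \<omega> r [?E u r, ?E v r, ?E w r])) =
      dir_deriv A p x (\<lambda>r. \<omega> r [?D u r, ?E v r, ?E w r] + \<omega> r [?E u r, ?D v r, ?E w r] + \<omega> r [?E u r, ?E v r, ?D w r])"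
      by (rule dir_deriv_cong[OF U p]) (rule \<omega>_deriv[OF U _ s(1) s(1) s(1)])
    also have "\<dots> = (\<omega> p [hd p x y u, v, w] + \<omega> p [chr p y u, chr p x v, w] + \<omega> p [chr p y u, v, chr p x w]) +
     (\<omega> p [chr p x u, chr p y v, w] + \<omega> p [u, hd p x y v, w] + \<omega> p [u, chr p y v, chr p x w]) +
     (\<omega> p [chr p x u, v, chr p y w] + \<omega> p [u, chr p x v, chr p y w] + \<omega> p [u, v, hd p x y w])"
      using dir_deriv_eq[OF has_mderiv_add[OF has_mderiv_add[OF m[OF s(2) s(1) s(1)] m[OF s(1) s(2) s(1)]]
          m[OF s(1) s(1) s(2)]], where v = x]
      by (simp add: const_ext_self chr_def hd_def)
    finally show ?thesis .
  qed
  show ?thesis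
    using d2[of x y] d2[of y x] mixed_dir_deriv[OF form_smooth_const_ext[OF mfd \<omega>_smooth], of p x y u v w]
    by (simp add: curvature_hd linear_diff[OF lin(1)] linear_diff[OF lin(2)] linear_diff[OF lin(3)])
qed

definition R :: "'m \<Rightarrow> real^7 \<Rightarrow> real^7 \<Rightarrow> real^7 \<Rightarrow> real^7 \<Rightarrow> real" where
  "R p x y z v = g p (curvature A D p x y z) v"

lemma R_linear: "linear (\<lambda>x. R p x y z v)" "linear (\<lambda>y. R p x y z v)" "linear (\<lambda>z. R p x y z v)" "linear (\<lambda>v. R p x y z v)"
  by (auto intro!: linearI simp: R_def curvature_hd g_simps linear_add[OF hd_linear(1)] linear_add[OF hd_linear(2)]
      linear_add[OF hd_linear(3)] linear_scale[OF hd_linear(1)] linear_scale[OF hd_linear(2)]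
      linear_scale[OF hd_linear(3)] algebra_simps)

lemma R_g2:
  assumes "adapted_frame (g p) (\<omega> p) e"
  shows "g2_matrix (\<lambda>i j. R p x y (e i) (e j))"
  unfolding R_def by (rule g2_matrix_endomorphism[OF assms]) (rule curvature_stabilises)

lemma R_antisym: "R p x y z v = - R p x y v z" "R p x y z v = - R p y x z v"
proof -
  obtain e where e: "adapted_frame (g p) (\<omega> p) e" using ex_adapted_frame by blast
  have "R p x y z v + R p x y v z = 0"
  proof (rule bilinear_zero[OF adapted_on_frame[OF e]])
    show "linear (\<lambda>z. R p x y z v + R p x y v z)" for v
      by (intro linear_compose_add R_linear)
    show "linear (\<lambda>v. R p x y z v + R p x y v z)" for z
      by (intro linear_compose_add R_linear)
    show "R p x y (e i) (e j) + R p x y (e j) (e i) = 0" if "i \<in> {1..7}" "j \<in> {1..7}" for i j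
      using g2_matrix.antisym[OF R_g2[OF e, of x y] that] by simp
  qed
  then show "R p x y z v = - R p x y v z" by simp
  show "R p x y z v = - R p y x z v" by (simp add: R_def curvature_hd g_simps)
qed

subsection \<open>Derivatives of the torsion\<close>

definition h :: "'m \<Rightarrow> real^7 \<Rightarrow> real^7 \<Rightarrow> real^7 \<Rightarrow> real^7 \<Rightarrow> real" where
  "h p a b c d = g p (hd p a b c) d"

definition m :: "'m \<Rightarrow> real^7 \<Rightarrow> real^7 \<Rightarrow> real^7 \<Rightarrow> real^7 \<Rightarrow> real" where
  "m p a b c d = g p (chr p a b) (chr p c d)"

definition dt :: "'m \<Rightarrow> real^7 \<Rightarrow> real^7 \<Rightarrow> real^7 \<Rightarrow> real^7 \<Rightarrow> real" where
  "dt p a b c d = h p a b c d - h p a c b d + m p b c a d - m p c b a d"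

lemma m_sym: "m p a b c d = m p c d a b"
  by (simp add: m_def g_sym[of p "chr p a b"])

lemma T_chr: "T p [x, y, z] = g p (chr p x y) z - g p (chr p y x) z"
  by (simp add: torsion_form_chr g_simps)

lemma T_antisym: "T p [x, y, z] = - T p [y, x, z]" "T p [x, y, z] = - T p [x, z, y]"
  "T p [x, y, z] = T p [y, z, x]" "T p [x, y, z] = T p [z, x, y]"
  using form3_symmetric(1,2)[OF skew] by (metis minus_equation_iff)+

text \<open>The bracket of coordinate fields vanishes near \<open>p\<close>, so there the torsion is
  the metric product of D_y z - D_z y with w. This also supplies the differentiability of the
  torsion components.\<close>

lemma T_deriv: "has_mderiv p (\<lambda>r. T r [const_ext A p y r, const_ext A p z r, const_ext A p w r]) (\<lambda>x. dt p x y z w)"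
proof -
  let ?U = "fst (chart_at A p)" and ?E = "const_ext A p"
  note U = chart_open[OF chart_at(1), of p] and p = chart_at(2)[of p]
  note E = smooth_vf_const_ext[of p]
  note s = conn_diff[OF U p cderiv_smooth[of p y z] cderiv_smooth[of p z y]]
  have "mdiff p (\<lambda>r. g r (D r (?E y r) (?E z) - D r (?E z r) (?E y)) (?E w r))"
    by (rule cov_metric_fields(1)[OF metric U p s(1) E])
  moreover have "dir_deriv A p x (\<lambda>r. g r (D r (?E y r) (?E z) - D r (?E z r) (?E y)) (?E w r)) = dt p x y z w" for x
    unfolding g_deriv[OF U p s(1) E] s(2)
    by (simp add: const_ext_self dt_def h_def m_def g_simps hd_def chr_def)
  ultimately have "has_mderiv p (\<lambda>r. g r (D r (?E y r) (?E z) - D r (?E z r) (?E y)) (?E w r)) (\<lambda>x. dt p x y z w)"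
    by (simp add: mdiff_def)
  then show ?thesis
    by (rule has_mderiv_cong[OF U p, rotated]) (simp add: torsion_form_const_ext)
qed

lemma dt_alt: "dt p a b c d = - dt p a b d c"
proof -
  have "has_mderiv p (\<lambda>r. (-1) * T r [const_ext A p b r, const_ext A p d r, const_ext A p c r]) (\<lambda>x. (-1) * dt p x b d c)"
    by (rule has_mderiv_linear[OF bounded_linear_mult_right T_deriv])
  moreover have "(-1) * T r [const_ext A p b r, const_ext A p d r, const_ext A p c r]
    = T r [const_ext A p b r, const_ext A p c r, const_ext A p d r]" for r
    using T_antisym(2)[of r "const_ext A p b r" "const_ext A p c r" "const_ext A p d r"] by simp
  ultimately have "has_mderiv p (\<lambda>r. T r [const_ext A p b r, const_ext A p c r, const_ext A p d r]) (\<lambda>x. - dt p x b d c)"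
    by simp
  from dir_deriv_eq[OF this, of a] dir_deriv_eq[OF T_deriv, of p a b c d] show ?thesis by simp
qed

lemma cov_T: "cov_form A D T p a [b, c, d] =
    dt p a b c d - (m p c d a b - m p d c a b) - (m p d b a c - m p b d a c) - (m p b c a d - m p c b a d)"
proof -
  have "cov_form A D T p a [b, c, d] =
      dt p a b c d - T p [chr p a b, c, d] - T p [b, chr p a c, d] - T p [b, c, chr p a d]"
    using dir_deriv_eq[OF T_deriv, of p a b c d]
    by (simp add: cov_form_def chr_def lessThan_Suc eval_nat_numeral)
  \<comment> \<open>Cyclic symmetry moves each differentiated argument into the last slot, where
    \<open>T_chr\<close> turns the torsion into values of \<open>m\<close>.\<close>
  also have "\<dots> = dt p a b c d - T p [c, d, chr p a b] - T p [d, b, chr p a c] - T p [b, c, chr p a d]"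
    using T_antisym(3)[of p "chr p a b" c d] T_antisym(4)[of p b "chr p a c" d] by simp
  finally show ?thesis by (simp add: T_chr m_def)
qed

lemma ext_deriv_T: "ext_deriv A T p [a, b, c, d] = dt p a b c d - dt p b a c d + dt p c a b d - dt p d a b c"
proof -
  have l: "length [a, b, c, d] = Suc (Suc (Suc (Suc 0)))" by simp
  show ?thesis
    unfolding ext_deriv_def l sum.lessThan_Suc by (simp add: dir_deriv_eq[OF T_deriv])
qed

lemma bianchi:
  "ext_deriv A T p [x, u, v, w] + 2 * cov_form A D T p x [u, v, w] = 2 * (R p x u v w + R p x v w u + R p x w u v)"
  unfolding ext_deriv_T
  by (rule bianchi_algebra[where h = "h p" and m = "m p" and n = "\<lambda>a b c d. cov_form A D T p a [b, c, d]",
      OF m_sym dt_def dt_alt cov_T])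
    (simp_all add: R_antisym(1)[symmetric], simp add: R_def h_def curvature_hd g_simps)

definition \<theta> :: "'m \<Rightarrow> real^7 \<Rightarrow> (real^7) form" where
  "\<theta> p x = (\<lambda>vs. contract x (ext_deriv A T p) vs + 2 * cov_form A D T p x vs)"

lemma \<theta>_R: "\<theta> p x [u, v, w] = 2 * (R p x u v w + R p x v w u + R p x w u v)"
  using bianchi by (simp add: \<theta>_def contract_def)

text \<open>Alternation is read off from the curvature: the cyclic sum of \<open>R\<close> vanishes
  on equal arguments because \<open>R\<close> is skew in its last pair.\<close>

lemma \<theta>_form: "is_form 3 (\<theta> p x)"
proof (rule form3I)
  note l = R_linear[THEN linear_add] R_linear[THEN linear_scale]
  show "linear (\<lambda>u. \<theta> p x [u, v, w])" "linear (\<lambda>v. \<theta> p x [u, v, w])" "linear (\<lambda>w. \<theta> p x [u, v, w])" for u v w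
    by (auto intro!: linearI simp: \<theta>_R l algebra_simps)
  show "\<theta> p x [u, u, w] = 0" "\<theta> p x [w, u, u] = 0" for u w
    using R_antisym(1)[of p x u u w] R_antisym(1)[of p x u w u] R_antisym(1)[of p x w u u]
    by (simp_all add: \<theta>_R)
qed

end


section \<open>Ricci tensors\<close>

lemma cyclic_sum3:
  "(\<Sum>i=1..7. \<Sum>k=1..7. \<Sum>l=1..7. f k l i) = (\<Sum>i=1..7. \<Sum>k=1..7. \<Sum>l=1..(7::nat). f i k l :: real)"
proof -
  have "(\<Sum>i=1..7. \<Sum>k=1..7. \<Sum>l=1..7. f k l i) = (\<Sum>k=1..7. \<Sum>i=1..7. \<Sum>l=1..7. f k l i)" by (rule sum.swap)
  also have "\<dots> = (\<Sum>k=1..7. \<Sum>l=1..7. \<Sum>i=1..7. f k l i)" by (rule sum.cong[OF refl sum.swap])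
  finally show ?thesis .
qed

context g2_conn begin

lemma hodge_contract_form: "on_frame (g p) e \<Longrightarrow> is_form 3 (contract y (hodge (g p) e 3 (\<omega> p)))"
  by (rule form_contract) (simp add: hodge_form[OF ip])

text \<open>Each of the three curvature terms of \<open>\<theta>\<close> gives the same sum after a
  cyclic renaming of the indices; the factors 2 and 3 cancel 1/6.\<close>

lemma cyclic_\<theta>:
  fixes f :: "nat \<Rightarrow> nat \<Rightarrow> nat \<Rightarrow> real"
  assumes "\<And>i k l. i \<in> {1..7} \<Longrightarrow> k \<in> {1..7} \<Longrightarrow> l \<in> {1..7} \<Longrightarrow> f k l i = f i k l"
  shows "1/6 * (\<Sum>i=1..7. \<Sum>k=1..7. \<Sum>l=1..7. \<theta> p x [e i, e k, e l] * f i k l)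
    = (\<Sum>i=1..7. \<Sum>k=1..7. \<Sum>l=1..7. R p x (e i) (e k) (e l) * f i k l)"
proof -
  define F where "F = (\<lambda>i k l. R p x (e i) (e k) (e l) * f i k l)"
  have "(\<Sum>i=1..7. \<Sum>k=1..7. \<Sum>l=1..7. \<theta> p x [e i, e k, e l] * f i k l)
    = (\<Sum>i=1..7. \<Sum>k=1..7. \<Sum>l=1..7. 2 * F i k l + 2 * F k l i + 2 * F l i k)"
  proof (intro sum.cong refl)
    fix i k l :: nat assume "i \<in> {1..7}" "k \<in> {1..7}" "l \<in> {1..7}"
    then have "f k l i = f i k l" "f l i k = f i k l" using assms by metis+
    then show "\<theta> p x [e i, e k, e l] * f i k l = 2 * F i k l + 2 * F k l i + 2 * F l i k"
      by (simp add: \<theta>_R F_def algebra_simps)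
  qed
  also have "\<dots> = 6 * (\<Sum>i=1..7. \<Sum>k=1..7. \<Sum>l=1..7. F i k l)"
    using cyclic_sum3[of F] cyclic_sum3[of "\<lambda>i k l. F k l i"]
    by (simp add: sum.distrib flip: sum_distrib_left)
  finally show ?thesis by (simp add: F_def)
qed

lemma R_phi:
  assumes e: "adapted_frame (g p) (\<omega> p) e"
  shows "form_inner 3 e (\<theta> p x) (\<omega> p) = 0"
proof -
  have "form_inner 3 e (\<theta> p x) (\<omega> p) = 1/6 * (\<Sum>i=1..7. \<Sum>k=1..7. \<Sum>l=1..7. \<theta> p x [e i, e k, e l] * phc i k l)"
    unfolding form_inner3[OF \<theta>_form \<omega>_form]
    by (intro arg_cong2[of _ _ _ _ "(*)"] refl sum.cong) (simp add: \<omega>_components[OF e])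
  also have "\<dots> = (\<Sum>i=1..7. \<Sum>k=1..7. \<Sum>l=1..7. R p x (e i) (e k) (e l) * phc i k l)"
    by (rule cyclic_\<theta>) (metis phc_antisym minus_minus)
  also have "\<dots> = (\<Sum>i=1..7. \<Sum>k=1..7. \<Sum>l=1..7. R p x (e i) (e k) (e l) * phc k l i)"
  proof (intro sum.cong refl)
    fix i k l :: nat assume "i \<in> {1..7}" "k \<in> {1..7}" "l \<in> {1..7}"
    then have "phc i k l = phc k l i" by (metis phc_antisym minus_minus)
    then show "R p x (e i) (e k) (e l) * phc i k l = R p x (e i) (e k) (e l) * phc k l i" by simp
  qed
  also have "\<dots> = 0"
    by (rule sum.neutral, rule ballI) (rule g2_matrix.contract_phc[OF R_g2[OF e]])
  finally show ?thesis .
qed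

text \<open>Contracting the last pair of the curvature with \<psi>_klni gives - 2 R(x, e_i, e_n,
  e_i) by \<open>contract_psc\<close>, and summation over i yields twice the Ricci component. As
  \<psi>_nikl is invariant under cyclic shifts of i, k, l, the curvature may be replaced by its
  cyclic sum, that is, by \<open>\<theta>\<close>.\<close>

lemma ricci_adapted:
  assumes e: "adapted_frame (g p) (\<omega> p) e" and n: "n \<in> {1..7}"
  shows "(\<Sum>i=1..7. R p (e i) x (e n) (e i)) =
    1/2 * form_inner 3 e (\<theta> p x) (contract (e n) (hodge (g p) e 3 (\<omega> p)))"
proof -
  note on = adapted_on_frame[OF e]
  define f where "f = (\<lambda>i k l. hodge (g p) e 3 (\<omega> p) [e n, e i, e k, e l])"
  note an = form4_symmetric[OF hodge_form[OF ip on, of "\<omega> p"]]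
  have cyc: "f k l i = f i k l" for i k l
    unfolding f_def using an(2)[of "e n" "e i" "e k" "e l"] an(3)[of "e n" "e k" "e i" "e l"] by simp
  have pair: "psc k l n i = f i k l" if "i \<in> {1..7}" "k \<in> {1..7}" "l \<in> {1..7}" for i k l
  proof -
    have "psc k l n i = hodge (g p) e 3 (\<omega> p) [e k, e l, e n, e i]"
      using hodge_components[OF ip on \<omega>_components[OF e]] that n by simp
    also have "\<dots> = f i k l"
      unfolding f_def using an(2)[of "e k" "e l" "e n" "e i"] an(1)[of "e k" "e n" "e l" "e i"]
       an(3)[of "e n" "e k" "e l" "e i"] an(2)[of "e n" "e k" "e i" "e l"] by simp
    finally show ?thesis .
  qed
  have "(\<Sum>i=1..7. R p (e i) x (e n) (e i)) = (\<Sum>i=1..7. 1/2 * (\<Sum>k=1..7. \<Sum>l=1..7. R p x (e i) (e k) (e l) * f i k l))"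
  proof (intro sum.cong refl)
    fix i :: nat assume i: "i \<in> {1..7}"
    have "(\<Sum>k=1..7. \<Sum>l=1..7. R p x (e i) (e k) (e l) * f i k l) = (\<Sum>k=1..7. \<Sum>l=1..7. R p x (e i) (e k) (e l) * psc k l n i)"
      by (intro sum.cong refl) (simp add: pair[OF i])
    also have "\<dots> = - 2 * R p x (e i) (e n) (e i)"
      by (rule g2_matrix.contract_psc[OF R_g2[OF e] n i])
    finally show "R p (e i) x (e n) (e i) = 1/2 * (\<Sum>k=1..7. \<Sum>l=1..7. R p x (e i) (e k) (e l) * f i k l)"
      using R_antisym(2)[of p "e i" x] by simp
  qed
  also have "\<dots> = 1/2 * (\<Sum>i=1..7. \<Sum>k=1..7. \<Sum>l=1..7. R p x (e i) (e k) (e l) * f i k l)"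
    by (simp only: sum_distrib_left)
  also have "\<dots> = 1/2 * (1/6 * (\<Sum>i=1..7. \<Sum>k=1..7. \<Sum>l=1..7. \<theta> p x [e i, e k, e l] * f i k l))"
    by (subst cyclic_\<theta>) (simp_all add: cyc)
  also have "1/6 * (\<Sum>i=1..7. \<Sum>k=1..7. \<Sum>l=1..7. \<theta> p x [e i, e k, e l] * f i k l) =
      form_inner 3 e (\<theta> p x) (contract (e n) (hodge (g p) e 3 (\<omega> p)))"
    unfolding form_inner3[OF \<theta>_form hodge_contract_form[OF on]] by (simp add: contract_def f_def)
  finally show ?thesis .
qed

lemma form_inner_hodge_invariant:
  assumes "on_frame (g p) e" "on_frame (g p) e'"
  shows "form_inner 3 e' (\<theta> p x) (contract y (hodge (g p) e' 3 (\<omega> p)))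
     = form_inner 3 e (\<theta> p x) (contract y (hodge (g p) e 3 (\<omega> p)))"
proof -
  have "form_inner 3 e' (\<theta> p x) (contract y (hodge (g p) e' 3 (\<omega> p)))
     = form_inner 3 e' (\<theta> p x) (contract y (hodge (g p) e 3 (\<omega> p)))"
    unfolding form_inner_def contract_def
    by (intro sum.cong refl arg_cong2[of _ _ _ _ "(*)"] hodge_invariant[OF ip assms \<omega>_form])
      (simp add: incr_def)
  also have "\<dots> = form_inner 3 e (\<theta> p x) (contract y (hodge (g p) e 3 (\<omega> p)))"
    by (rule form_inner3_invariant[OF ip assms \<theta>_form hodge_contract_form[OF assms(1)]])
  finally show ?thesis .
qed

lemma ricci_R: "ricci A g D p e x y = (\<Sum>i=1..7. R p (e i) x y (e i))"
  by (simp add: ricci_def R_def)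

text \<open>Both sides are linear in \<open>y\<close>, so the vectors of an adapted frame suffice;
  trace, inner product and star carry the result to any oriented orthonormal frame.\<close>

theorem ricci_torsion:
  assumes e': "on_frame (g p) e'"
  shows "ricci A g D p e' x y = 1/2 * form_inner 3 e' (\<theta> p x) (contract y (hodge (g p) e' 3 (\<omega> p)))"
proof -
  obtain e where e: "adapted_frame (g p) (\<omega> p) e" using ex_adapted_frame by blast
  note on = adapted_on_frame[OF e]
  let ?f = "\<lambda>y. form_inner 3 e (\<theta> p x) (contract y (hodge (g p) e 3 (\<omega> p)))"
  have lI: "linear (\<lambda>y. \<theta> p x (map e I) * hodge (g p) e 3 (\<omega> p) (y # map e I))" if "I \<in> incr 3" for I
  proof -
    have l: "linear (\<lambda>y. hodge (g p) e 3 (\<omega> p) (y # map e I))"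
      using form_linear[OF hodge_form[OF ip on], of "[]" "map e I"] that by (simp add: incr_def)
    show ?thesis by (rule linearI) (simp_all add: linear_add[OF l] linear_scale[OF l] algebra_simps)
  qed
  have lf: "linear ?f"
    unfolding form_inner_def contract_def by (intro linear_compose_sum ballI lI)
  have lr: "linear (\<lambda>y. \<Sum>i=1..7. R p (e i) x y (e i))"
    by (intro linear_compose_sum ballI R_linear)
  have "ricci A g D p e' x y = (\<Sum>i=1..7. R p (e i) x y (e i))"
    unfolding ricci_R by (rule trace_invariant[OF ip on e' R_linear(1,4)])
  also have "\<dots> = (\<Sum>n=1..7. g p y (e n) * (\<Sum>i=1..7. R p (e i) x (e n) (e i)))"
    by (subst frame_sum[OF on, of y], subst linear_sum[OF lr], subst linear_scale[OF lr]) simp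
  also have "\<dots> = (\<Sum>n=1..7. g p y (e n) * (1/2 * ?f (e n)))"
    by (intro sum.cong refl) (simp add: ricci_adapted[OF e])
  also have "\<dots> = 1/2 * ?f y"
    by (subst (2) frame_sum[OF on, of y], subst linear_sum[OF lf], subst linear_scale[OF lf])
      (simp add: sum_distrib_left)
  finally show ?thesis using form_inner_hodge_invariant[OF on e'] by simp
qed

theorem torsion_phi:
  assumes e': "on_frame (g p) e'"
  shows "form_inner 3 e' (contract x (ext_deriv A T p)) (\<omega> p) = - 2 * form_inner 3 e' (cov_form A D T p x) (\<omega> p)"
proof -
  obtain e where e: "adapted_frame (g p) (\<omega> p) e" using ex_adapted_frame by blast
  have "form_inner 3 e' (\<theta> p x) (\<omega> p) = 0"
    using R_phi[OF e, of x] form_inner3_invariant[OF ip adapted_on_frame[OF e] e' \<theta>_form \<omega>_form] by simp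
  then show ?thesis
    by (simp add: form_inner_def \<theta>_def algebra_simps sum.distrib flip: sum_distrib_left)
qed

lemma cov_T_antisym: "cov_form A D T p a [b, c, d] = - cov_form A D T p a [b, d, c]"
  "cov_form A D T p a [b, c, d] = - cov_form A D T p a [c, b, d]"
  unfolding cov_T using dt_alt[of p a b c d] by (simp_all add: dt_def)

end

section \<open>Comparison with the Levi-Civita connection\<close>

locale g2_lc = g2_conn A D g \<omega>
  for A :: "('m::{t2_space, second_countable_topology}, 7) chart set" and D g \<omega> +
  fixes Dg :: "('m, 7) cov_deriv"
  assumes lc: "levi_civita A g Dg"
begin

sublocale lc: conn A Dg
  by unfold_locales (use lc in \<open>simp add: levi_civita_def\<close>)

definition \<tau> :: "'m \<Rightarrow> real^7 \<Rightarrow> real^7 \<Rightarrow> real^7" where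
  "\<tau> p x y = chr p x y - chr p y x"

lemma g_\<tau>: "g p (\<tau> p x y) z = T p [x, y, z]"
  by (simp add: torsion_form_chr \<tau>_def)

lemma lc_rules:
  assumes "open U" "p \<in> U" "smooth_vf A U X" "smooth_vf A U Y"
  shows "Dg p (X p) Y - Dg p (Y p) X = lie_bracket A X Y p"
    "dir_deriv A p v (\<lambda>q. g q (X q) (Y q)) = g p (Dg p v X) (Y p) + g p (X p) (Dg p v Y)"
  using lc assms unfolding levi_civita_def by blast+

lemma g_eqI: "(\<And>z. g p x z = g p y z) \<Longrightarrow> x = y"
proof -
  assume *: "\<And>z. g p x z = g p y z"
  obtain e where "adapted_frame (g p) (\<omega> p) e" using ex_adapted_frame by blast
  then have on: "on_frame (g p) e" by (rule adapted_on_frame)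
  show "x = y"
    by (subst frame_sum[OF on, of x], subst frame_sum[OF on, of y]) (simp add: *)
qed

text \<open>Both connections are metric, so their difference is skew in the last two arguments; its
  antisymmetrisation in the first two is the torsion.\<close>

lemma lc_chr: "lc.chr p v w = chr p v w - (1/2) *\<^sub>R \<tau> p v w"
proof (rule g_eqI)
  fix z
  note U = chart_open[OF chart_at(1), of p] chart_at(2)[of p]
  note E = smooth_vf_const_ext[of p]
  define s where "s = (\<lambda>v y z. g p (chr p v y - lc.chr p v y) z)"
  have 1: "s v y z = - s v z y" for v y z
    using lc_rules(2)[OF U E[of y] E[of z], of v] g_deriv[OF U E[of y] E[of z], of v]
    by (simp add: s_def const_ext_self chr_def lc.chr_def g_simps g_sym[of p y])
  have 2: "s v y z - s y v z = T p [v, y, z]" for v y z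
    using lc_rules(1)[OF U E[of v] E[of y]]
    by (simp add: s_def T_chr const_ext_self lie_bracket_const_ext[OF U(2)] flip: lc.chr_def)
      (simp add: g_simps)
  have "s v w z = 1/2 * T p [v, w, z]"
    using 1[of v w z] 1[of w z v] 1[of z v w] 2[of v w z] 2[of w z v] 2[of z v w]
      T_antisym(3,4)[of p v w z] by simp
  then show "g p (lc.chr p v w) z = g p (chr p v w - (1/2) *\<^sub>R \<tau> p v w) z"
    by (simp add: s_def g_simps g_\<tau>)
qed

lemma lc_conn:
  assumes "open U" "q \<in> U" "smooth_vf A U Y"
  shows "Dg q v Y = D q v Y - (1/2) *\<^sub>R \<tau> q v (Y q)"
  using conn_expand[OF assms, of v] lc.conn_expand[OF assms, of v] by (simp add: lc_chr)

text \<open>Coordinate fields commute, so \<open>\<tau>\<close> is the antisymmetrised covariant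
  derivative and subtracting half of it symmetrises. The formula holds throughout the chart and can
  therefore be differentiated again.\<close>

lemma lc_cderiv:
  assumes "r \<in> fst (chart_at A p)"
  shows "Dg r (const_ext A p y r) (const_ext A p z) =
    (1/2) *\<^sub>R D r (const_ext A p y r) (const_ext A p z) + (1/2) *\<^sub>R D r (const_ext A p z r) (const_ext A p y)"
proof -
  note U = chart_open[OF chart_at(1), of p] assms
  have "\<tau> r (const_ext A p y r) (const_ext A p z r) =
     D r (const_ext A p y r) (const_ext A p z) - D r (const_ext A p z r) (const_ext A p y)"
    using torsion_fields[OF U smooth_vf_const_ext smooth_vf_const_ext, of y z]
    by (simp add: \<tau>_def lie_bracket_const_ext[OF assms])
  moreover have "a - (1/2) *\<^sub>R (a - b) = (1/2) *\<^sub>R a + (1/2) *\<^sub>R b" for a b :: "real^7"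
    by (simp add: scaleR_diff_right)
  ultimately show ?thesis using lc_conn[OF U smooth_vf_const_ext] by simp
qed

lemma lc_hd: "lc.hd p x y z = (1/2) *\<^sub>R (hd p x y z - (1/2) *\<^sub>R \<tau> p x (chr p y z))
    + (1/2) *\<^sub>R (hd p x z y - (1/2) *\<^sub>R \<tau> p x (chr p z y))"
proof -
  let ?U = "fst (chart_at A p)" and ?E = "const_ext A p"
  note U = chart_open[OF chart_at(1), of p] chart_at(2)[of p]
  have s: "smooth_vf A ?U (\<lambda>r. (1/2) *\<^sub>R D r (?E y r) (?E z))" for y z
    by (rule smooth_vf_scaleR[OF U(1) smooth_fun_const cderiv_smooth])
  have "lc.hd p x y z = Dg p x (\<lambda>r. (1/2) *\<^sub>R D r (?E y r) (?E z) + (1/2) *\<^sub>R D r (?E z r) (?E y))"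
    unfolding lc.hd_def by (rule lc.conn_local[OF U lc.cderiv_smooth lc_cderiv])
  also have "\<dots> = (1/2) *\<^sub>R Dg p x (\<lambda>r. D r (?E y r) (?E z)) + (1/2) *\<^sub>R Dg p x (\<lambda>r. D r (?E z r) (?E y))"
    unfolding lc.conn_add[OF U s s] lc.conn_scaleR_const[OF U cderiv_smooth] ..
  finally show ?thesis
    unfolding lc_conn[OF U cderiv_smooth] by (simp add: const_ext_self hd_def chr_def)
qed

text \<open>The curvature of \<nabla> is the Riemannian one plus derivatives and squares of the
  torsion; the trace leaves the divergence of the torsion and a single quadratic term.\<close>

lemma ricci_levi_civita:
  assumes e: "on_frame (g p) e"
  shows "ricci A g D p e x y = ricci A g Dg p e x y - 1/2 * codiff A Dg T p e [x, y]
    - 1/4 * (\<Sum>i=1..7. \<Sum>j=1..7. T p [x, e i, e j] * T p [y, e i, e j])"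
proof -
  let ?n = "\<lambda>a b c d. cov_form A D T p a [b, c, d]"
  let ?Rg = "\<lambda>x y z v. g p (curvature A Dg p x y z) v"
  let ?P = "\<lambda>a b c d. g p (\<tau> p a b) (\<tau> p c d)"
  have P: "?P a b c d = m p a b c d - m p b a c d - m p a b d c + m p b a d c" for a b c d
    by (simp add: \<tau>_def m_def g_simps)
  have \<tau>: "\<tau> p a a = 0" "\<tau> p a b = - \<tau> p b a" for a b by (simp_all add: \<tau>_def)
  have gneg: "g p (- u) v = - g p u v" "g p u (- v) = - g p u v" for u v
    by (simp_all add: linear_neg[OF g_lin(1)] linear_neg[OF g_lin(2)])
  \<comment> \<open>Cyclic symmetry of the torsion turns the products with \<open>\<tau>\<close> in
    \<open>lc_hd\<close> into differences of values of \<open>m\<close>.\<close>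
  have kg: "g p (lc.hd p x y z) v = 1/2 * (h p x y z v + h p x z y v)
      - 1/4 * (m p v x y z - m p x v y z + m p v x z y - m p x v z y)" for x y z v
  proof -
    have "g p (\<tau> p x u) v = g p (chr p v x) u - g p (chr p x v) u" for u
      using T_antisym(4)[of p x u v] by (simp add: g_\<tau> T_chr)
    from this[of "chr p y z"] this[of "chr p z y"] show ?thesis
      unfolding lc_hd g_simps h_def m_def real_scaleR_def by argo
  qed
  have RRg: "R p x i k l = ?Rg x i k l + 1/2 * ?n x i k l - 1/2 * ?n i x k l
     + 1/2 * ?P x i k l + 1/4 * ?P x l i k - 1/4 * ?P i l x k" for x i k l
    unfolding lc.curvature_hd g_simps
    by (rule levi_civita_algebra[where h = "h p" and m = "m p" and dt = "dt p", OF m_sym dt_def cov_T _ kg P])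
      (simp add: R_def h_def curvature_hd g_simps)
  have one: "R p a x y a = ?Rg a x y a + 1/2 * ?n a a x y - 1/4 * ?P a x a y" for a
  proof -
    have "?n x a y a = 0" using cov_T_antisym[of p x a y a] cov_T_antisym[of p x a a y] by simp
    moreover have "?n a x y a = ?n a a x y"
      using cov_T_antisym(1)[of p a x y a] cov_T_antisym(2)[of p a x a y] by simp
    moreover have "?P a x y a = - ?P a x a y" "?P x a a y = - ?P a x a y"
      using \<tau>(2)[of y a] \<tau>(2)[of x a] by (simp_all add: gneg)
    ultimately show ?thesis using RRg[of a x y a] \<tau>(1)[of a] by (simp add: g_simps)
  qed
  \<comment> \<open>Passing to the Levi-Civita connection changes this component of \<nabla>T by
    three terms: one contains \<open>\<tau> p a a\<close>, which is 0, and the other two cancel. So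
    either connection computes the codifferential of the torsion.\<close>
  have codiff: "cov_form A Dg T p a [a, x, y] = ?n a a x y" for a
  proof -
    have l: "T p [x, u - (1/2) *\<^sub>R v, z] = T p [x, u, z] - 1/2 * T p [x, v, z]"
      "T p [u - (1/2) *\<^sub>R v, x, z] = T p [u, x, z] - 1/2 * T p [v, x, z]"
      "T p [x, z, u - (1/2) *\<^sub>R v] = T p [x, z, u] - 1/2 * T p [x, z, v]" for x z u v
      by (simp_all add: linear_diff[OF form3_linear(1)[OF skew]] linear_diff[OF form3_linear(2)[OF skew]]
          linear_diff[OF form3_linear(3)[OF skew]] linear_scale[OF form3_linear(1)[OF skew]]
          linear_scale[OF form3_linear(2)[OF skew]] linear_scale[OF form3_linear(3)[OF skew]])
    have "cov_form A Dg T p a [a, x, y] = ?n a a x y + 1/2 * T p [\<tau> p a a, x, y]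
        + 1/2 * T p [a, \<tau> p a x, y] + 1/2 * T p [a, x, \<tau> p a y]"
      by (simp add: cov_form_def lessThan_Suc eval_nat_numeral l flip: chr_def lc.chr_def)
        (simp add: lc_chr l)
    moreover have "T p [a, \<tau> p a x, y] = - ?P a y a x"
      using T_antisym(4)[of p a "\<tau> p a x" y] \<tau>(2)[of y a] g_\<tau>[of p y a] by (simp add: gneg)
    moreover have "T p [a, x, \<tau> p a y] = ?P a y a x" by (subst g_sym) (simp only: g_\<tau>)
    moreover have "T p [\<tau> p a a, x, y] = 0" by (simp add: \<tau>(1) linear_0[OF form3_linear(1)[OF skew]])
    ultimately show ?thesis by simp
  qed
  have "(\<Sum>i=1..7. ?P (e i) x (e i) y) = (\<Sum>i=1..7. \<Sum>j=1..7. T p [x, e i, e j] * T p [y, e i, e j])"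
  proof (intro sum.cong refl)
    fix i
    have "?P (e i) x (e i) y = (\<Sum>j=1..7. g p (\<tau> p (e i) x) (e j) * g p (\<tau> p (e i) y) (e j))"
      by (rule frame_parseval[OF ip e, symmetric])
    also have "\<dots> = (\<Sum>j=1..7. T p [x, e i, e j] * T p [y, e i, e j])"
      by (intro sum.cong refl) (simp add: g_\<tau> T_antisym(1)[of p "e i"])
    finally show "?P (e i) x (e i) y = (\<Sum>j=1..7. T p [x, e i, e j] * T p [y, e i, e j])" .
  qed
  moreover have "codiff A Dg T p e [x, y] = - (\<Sum>i=1..7. ?n (e i) (e i) x y)"
    by (simp add: codiff_def contract_def codiff)
  moreover have "ricci A g D p e x y = ricci A g Dg p e x y + 1/2 * (\<Sum>i=1..7. ?n (e i) (e i) x y)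
     - 1/4 * (\<Sum>i=1..7. ?P (e i) x (e i) y)"
    unfolding ricci_R one ricci_def[of A g Dg] by (simp add: sum.distrib sum_subtractf sum_distrib_left)
  ultimately show ?thesis by simp
qed

end


section \<open>Spinors\<close>

locale spin =
  fixes c :: "nat \<Rightarrow> real^8^8"
  assumes spin: "spin_rep c"
begin

definition C :: "nat \<Rightarrow> real^8 \<Rightarrow> real^8" where "C i x = c i *v x"

lemma C_simps: "C i (x + y) = C i x + C i y" "C i (x - y) = C i x - C i y" "C i (- x) = - C i x"
  "C i (r *\<^sub>R x) = r *\<^sub>R C i x" "C i 0 = 0" "C i (\<Sum>k\<in>K. f k) = (\<Sum>k\<in>K. C i (f k))"
  unfolding C_def
  by (simp_all add: matrix_vector_right_distrib matrix_vector_mult_diff_distrib vec.neg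
      matrix_vector_mult_scaleR vec.sum)

lemma C_clifford:
  assumes "i \<in> {1..7}" "j \<in> {1..7}"
  shows "C i (C j x) = - C j (C i x) + (if i = j then - 2 *\<^sub>R x else 0)"
proof -
  have "c i ** c j + c j ** c i = mat (if i = j then - 2 else 0)"
    using spin assms by (simp add: spin_rep_def)
  then have "(c i ** c j + c j ** c i) *v x = mat (if i = j then - 2 else 0) *v x" by simp
  moreover have "mat r *v x = r *\<^sub>R x" for r
  proof -
    have "(\<Sum>j\<in>UNIV. (if i = j then r else 0) * x $ j) = (\<Sum>j\<in>UNIV. if i = j then r * x $ j else 0)" for i
      by (rule sum.cong) auto
    then show ?thesis by (simp add: vec_eq_iff matrix_vector_mult_def mat_def)
  qed
  ultimately have "C i (C j x) + C j (C i x) = (if i = j then - 2 else 0) *\<^sub>R x"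
    by (simp add: C_def matrix_vector_mult_add_rdistrib matrix_vector_mul_assoc)
  then have "C i (C j x) = (if i = j then - 2 else 0) *\<^sub>R x - C j (C i x)" by (simp only: eq_diff_eq)
  then show ?thesis by simp
qed

lemma C_sq: "i \<in> {1..7} \<Longrightarrow> C i (C i x) = - x"
proof -
  assume "i \<in> {1..7}"
  then have "2 *\<^sub>R C i (C i x) = 2 *\<^sub>R (- x)" using C_clifford[of i i x] by (simp add: scaleR_2)
  then show ?thesis by (simp only: scaleR_cancel_left) simp
qed

lemma C_swap: "i \<in> {1..7} \<Longrightarrow> j \<in> {1..7} \<Longrightarrow> i \<noteq> j \<Longrightarrow> C i (C j x) = - C j (C i x)"
  using C_clifford[of i j x] by simp

lemma C_volume: "C 1 (C 2 (C 3 (C 4 (C 5 (C 6 (C 7 x)))))) = x"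
proof -
  have "cliff_prod c [1,2,3,4,5,6,7] *v x = x"
    using spin by (simp add: spin_rep_def upt_rec)
  then show ?thesis by (simp add: C_def cliff_prod_def matrix_vector_mul_assoc)
qed

lemma C_eq_0: "i \<in> {1..7} \<Longrightarrow> C i x = 0 \<longleftrightarrow> x = 0"
  using C_sq[of i x] by (auto simp: C_simps)

text \<open>As rewrite rules these sort a product of generators, smallest index outermost, and
  cancel squares; identities between products are decided in this way.\<close>

lemma C_sort: "j < i \<Longrightarrow> 1 \<le> j \<Longrightarrow> i \<le> 7 \<Longrightarrow> C i (C j x) = - C j (C i x)"
  "1 \<le> i \<Longrightarrow> i \<le> 7 \<Longrightarrow> C i (C i x) = - x"
  using C_swap[of i j x] C_sq[of i x] by auto

subsection \<open>An invariant inner product\<close>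

text \<open>\<open>avg 7\<close> sums the standard inner product over the products of generators
  indexed by all subsets of {1..7}; up to sign these products form a finite group, which makes the
  sum invariant.\<close>

primrec avg :: "nat \<Rightarrow> real^8 \<Rightarrow> real^8 \<Rightarrow> real" where
  "avg 0 x y = x \<bullet> y"
| "avg (Suc k) x y = avg k x y + avg k (C (Suc k) x) (C (Suc k) y)"

lemma avg_linear: "linear (\<lambda>x. avg k x y)" "linear (avg k x)"
proof -
  have "linear (\<lambda>x. avg k x y) \<and> linear (avg k x)" for x y
  proof (induction k arbitrary: x y)
    case 0
    show ?case by (auto intro!: linearI simp: inner_add_left inner_add_right)
  next
    case (Suc k)
    then have l: "linear (\<lambda>x. avg k x y)" "linear (avg k x)" for x y by blast+
    show ?case
      by (auto intro!: linearI simp: linear_add[OF l(1)] linear_add[OF l(2)] linear_scale[OF l(1)]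
        linear_scale[OF l(2)] C_simps algebra_simps)
  qed
  then show "linear (\<lambda>x. avg k x y)" "linear (avg k x)" by blast+
qed

lemma avg_sym: "avg k x y = avg k y x"
  by (induction k arbitrary: x y) (simp_all add: inner_commute)

lemma avg_ge: "avg k x x \<ge> x \<bullet> x"
proof (induction k arbitrary: x)
  case (Suc k)
  have "avg k (C (Suc k) x) (C (Suc k) x) \<ge> 0" using Suc[of "C (Suc k) x"] inner_ge_zero order_trans by blast
  then show ?case using Suc[of x] by simp
qed simp

text \<open>The last generator exchanges the two summands since its square is -1; an earlier one
  anticommutes with it, and the sign occurs twice.\<close>

lemma avg_invariant:
  assumes "k \<le> 7" "1 \<le> i" "i \<le> k"
  shows "avg k (C i x) (C i y) = avg k x y"
  using assms
proof (induction k arbitrary: x y)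
  case (Suc k)
  note neg = linear_neg[OF avg_linear(1)] linear_neg[OF avg_linear(2)]
  show ?case
  proof (cases "i = Suc k")
    case True
    then show ?thesis using Suc.prems by (simp add: C_sq neg)
  next
    case False
    then have "avg k (C (Suc k) (C i x)) (C (Suc k) (C i y)) = avg k (C i (C (Suc k) x)) (C i (C (Suc k) y))"
      using Suc.prems by (simp add: C_swap[of "Suc k" i] neg)
    then show ?thesis using Suc False by simp
  qed
qed simp

definition B :: "real^8 \<Rightarrow> real^8 \<Rightarrow> real" where "B = avg 7"

lemma B_linear: "linear (\<lambda>x. B x y)" "linear (B x)"
  unfolding B_def by (rule avg_linear)+

lemmas B_simps = linear_add[OF B_linear(1)] linear_add[OF B_linear(2)] linear_diff[OF B_linear(1)]
  linear_diff[OF B_linear(2)] linear_scale[OF B_linear(1)] linear_scale[OF B_linear(2)]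
  linear_neg[OF B_linear(1)] linear_neg[OF B_linear(2)] linear_sum[OF B_linear(1)] linear_sum[OF B_linear(2)]
  linear_0[OF B_linear(1)] linear_0[OF B_linear(2)]

lemma B_sym: "B x y = B y x"
  unfolding B_def by (rule avg_sym)

lemma B_eq_0: "B x x = 0 \<longleftrightarrow> x = 0"
proof
  assume "B x x = 0"
  then have "x \<bullet> x \<le> 0" using avg_ge[of x 7] by (simp add: B_def)
  then show "x = 0" using inner_ge_zero[of x] inner_eq_zero_iff[of x] by linarith
qed (simp add: B_def linear_0[OF avg_linear(2)])

lemma B_invariant: "i \<in> {1..7} \<Longrightarrow> B (C i x) (C i y) = B x y"
  unfolding B_def by (rule avg_invariant) auto

lemma B_skew: "i \<in> {1..7} \<Longrightarrow> B (C i x) y = - B x (C i y)"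
  using B_invariant[of i "C i x" y] by (simp add: C_sq B_simps)

lemma B_C_self: "i \<in> {1..7} \<Longrightarrow> B x (C i x) = 0"
  using B_skew[of i x x] B_sym[of "C i x" x] by simp

subsection \<open>The distinguished spinor\<close>

text \<open>On \<psi> Clifford multiplication becomes the multiplication of octonions, with \<psi>
  as the unit and the \<open>C i \<psi>\<close> as imaginary units. The condition is linear in
  \<psi> and holds for 0, so being nonzero is demanded separately.\<close>

definition pure :: "real^8 \<Rightarrow> bool" where
  "pure \<psi> \<longleftrightarrow> (\<forall>j\<in>{1..7}. \<forall>k\<in>{1..7}.
     C j (C k \<psi>) = (if j = k then - \<psi> else 0) + (\<Sum>i=1..7. phc j k i *\<^sub>R C i \<psi>))"

lemma pure_rule: "pure \<psi> \<Longrightarrow> j \<in> {1..7} \<Longrightarrow> k \<in> {1..7} \<Longrightarrow>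
    C j (C k \<psi>) = (if j = k then - \<psi> else 0) + (\<Sum>i=1..7. phc j k i *\<^sub>R C i \<psi>)"
  by (simp add: pure_def)

text \<open>Each line of the Fano plane acts as an involution. The involutions of the lines 127, 135 and
  236 commute; if one of them fixes \<open>x\<close>, then \<open>Q x\<close> is an eigenvector for the eigenvalue \<open>- 1\<close>, where
  the product \<open>Q\<close> of generators anticommutes with this involution and commutes with the previous
  ones.\<close>

lemma involution_step:
  fixes P Q :: "'a::ab_group_add \<Rightarrow> 'a"
  assumes P: "\<And>x. P (P x) = x" "\<And>x y. P (x - y) = P x - P y" and x: "x \<noteq> 0"
    and Q: "Q x \<noteq> 0" "P x = x \<Longrightarrow> P (Q x) = - Q x"
  obtains y where "y \<noteq> 0" "P y = - y" "y = x - P x \<or> y = Q x"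
proof (cases "x - P x = 0")
  case True
  then have "x = P x" by (simp only: right_minus_eq)
  then have "P x = x" by (rule sym)
  then show ?thesis using Q that[of "Q x"] by auto
next
  case False
  then show ?thesis using P that[of "x - P x"] by simp
qed

lemma ex_line_eigenvector:
  obtains \<psi> where "\<psi> \<noteq> 0" "C 1 (C 2 (C 7 \<psi>)) = - \<psi>" "C 1 (C 3 (C 5 \<psi>)) = - \<psi>" "C 2 (C 3 (C 6 \<psi>)) = \<psi>"
proof -
  have C_ne: "C i y \<noteq> 0" if "i \<in> {1..7}" "y \<noteq> 0" for i y using C_eq_0 that by simp
  obtain u :: "real^8" where u: "u \<noteq> 0" using axis_eq_0_iff[of 1 "1::real"] by (metis zero_neq_one)
  obtain x where x: "x \<noteq> 0" "C 1 (C 2 (C 7 x)) = - x"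
  proof (rule involution_step[where P = "\<lambda>x. C 1 (C 2 (C 7 x))" and Q = "C 3" and x = u])
    show "C 1 (C 2 (C 7 (C 3 u))) = - C 3 u" if *: "C 1 (C 2 (C 7 u)) = u"
    proof -
      have "C 1 (C 2 (C 7 (C 3 u))) = - C 3 (C 1 (C 2 (C 7 u)))" by (simp add: C_sort C_simps)
      then show ?thesis by (simp only: *)
    qed
  qed (use u C_ne in \<open>auto simp: C_sort C_simps\<close>)
  obtain y where y: "y \<noteq> 0" "C 1 (C 3 (C 5 y)) = - y" "y = x - C 1 (C 3 (C 5 x)) \<or> y = C 3 (C 4 x)"
  proof (rule involution_step[where P = "\<lambda>x. C 1 (C 3 (C 5 x))" and Q = "\<lambda>x. C 3 (C 4 x)" and x = x])
    show "C 1 (C 3 (C 5 (C 3 (C 4 x)))) = - C 3 (C 4 x)" if *: "C 1 (C 3 (C 5 x)) = x"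
    proof -
      have "C 1 (C 3 (C 5 (C 3 (C 4 x)))) = - C 3 (C 4 (C 1 (C 3 (C 5 x))))" by (simp add: C_sort C_simps)
      then show ?thesis by (simp only: *)
    qed
  qed (use x C_ne in \<open>auto simp: C_sort C_simps\<close>)
  have y1: "C 1 (C 2 (C 7 y)) = - y"
  proof -
    have "C 1 (C 2 (C 7 (C 1 (C 3 (C 5 x))))) = C 1 (C 3 (C 5 (C 1 (C 2 (C 7 x)))))"
      "C 1 (C 2 (C 7 (C 3 (C 4 x)))) = C 3 (C 4 (C 1 (C 2 (C 7 x))))" by (simp_all add: C_sort C_simps)
    then show ?thesis using y(3) x(2) by (auto simp: C_simps)
  qed
  obtain z where z: "z \<noteq> 0" "- C 2 (C 3 (C 6 z)) = - z" "z = y - - C 2 (C 3 (C 6 y)) \<or> z = C 4 (C 6 y)"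
  proof (rule involution_step[where P = "\<lambda>x. - C 2 (C 3 (C 6 x))" and Q = "\<lambda>x. C 4 (C 6 x)" and x = y])
    show "- C 2 (C 3 (C 6 (C 4 (C 6 y)))) = - C 4 (C 6 y)" if *: "- C 2 (C 3 (C 6 y)) = y"
    proof -
      have "- C 2 (C 3 (C 6 (C 4 (C 6 y)))) = - C 4 (C 6 (- C 2 (C 3 (C 6 y))))" by (simp add: C_sort C_simps)
      then show ?thesis by (simp only: *)
    qed
  qed (use y C_ne in \<open>auto simp: C_sort C_simps\<close>)
  have "C 1 (C 2 (C 7 (C 2 (C 3 (C 6 y))))) = C 2 (C 3 (C 6 (C 1 (C 2 (C 7 y)))))"
    "C 1 (C 2 (C 7 (C 4 (C 6 y)))) = C 4 (C 6 (C 1 (C 2 (C 7 y))))"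
    "C 1 (C 3 (C 5 (C 2 (C 3 (C 6 y))))) = C 2 (C 3 (C 6 (C 1 (C 3 (C 5 y)))))"
    "C 1 (C 3 (C 5 (C 4 (C 6 y)))) = C 4 (C 6 (C 1 (C 3 (C 5 y))))" by (simp_all add: C_sort C_simps)
  then have "C 1 (C 2 (C 7 z)) = - z" "C 1 (C 3 (C 5 z)) = - z"
    using z(3) y1 y(2) by (auto simp: C_simps)
  then show ?thesis using z(1,2) that by simp
qed

text \<open>A generator is its own inverse up to sign, and a product of three distinct generators is
  invariant under cyclic shifts.\<close>

lemma line_products:
  assumes "i \<in> {1..7}" "j \<in> {1..7}" "k \<in> {1..7}" "distinct [i, j, k]" "C i (C j (C k \<psi>)) = r *\<^sub>R \<psi>"
  shows "C j (C k \<psi>) = - r *\<^sub>R C i \<psi>" "C k (C j \<psi>) = r *\<^sub>R C i \<psi>"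
    "C i (C j \<psi>) = - r *\<^sub>R C k \<psi>" "C j (C i \<psi>) = r *\<^sub>R C k \<psi>"
    "C k (C i \<psi>) = - r *\<^sub>R C j \<psi>" "C i (C k \<psi>) = r *\<^sub>R C j \<psi>"
proof -
  have key: "C b (C d \<psi>) = - r *\<^sub>R C a \<psi>" if "a \<in> {1..7}" "C a (C b (C d \<psi>)) = r *\<^sub>R \<psi>" for a b d
    using arg_cong[OF that(2), of "C a"] that(1) by (simp add: C_sq C_simps) (metis minus_minus)
  have 1: "C i (C j (C k \<psi>)) = C k (C i (C j \<psi>))" "C i (C j (C k \<psi>)) = C j (C k (C i \<psi>))"
    using assms by (simp_all add: C_swap[of j k] C_swap[of i k] C_swap[of j i] C_simps)
  show a: "C j (C k \<psi>) = - r *\<^sub>R C i \<psi>" "C i (C j \<psi>) = - r *\<^sub>R C k \<psi>" "C k (C i \<psi>) = - r *\<^sub>R C j \<psi>"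
    using key assms 1 by auto
  show "C k (C j \<psi>) = r *\<^sub>R C i \<psi>" "C j (C i \<psi>) = r *\<^sub>R C k \<psi>" "C i (C k \<psi>) = r *\<^sub>R C j \<psi>"
    using a assms by (simp_all add: C_swap[of k j] C_swap[of j i] C_swap[of i k])
qed

text \<open>Three lines of the Fano plane through one point cover all seven points, so their product
  is the volume element up to sign and acts as a sign. Thus the eigenvalues on two of them determine
  the third, which yields the remaining four lines. As any two indices lie on exactly one line, all
  products \<open>C j (C k \<psi>)\<close> are then known.\<close>

lemma ex_pure: "\<exists>\<psi>. \<psi> \<noteq> 0 \<and> pure \<psi>"
proof -
  obtain \<psi> where \<psi>: "\<psi> \<noteq> 0" and p: "C 1 (C 2 (C 7 \<psi>)) = - \<psi>" "C 1 (C 3 (C 5 \<psi>)) = - \<psi>" "C 2 (C 3 (C 6 \<psi>)) = \<psi>"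
    by (rule ex_line_eigenvector)
  have p4: "C 1 (C 4 (C 6 \<psi>)) = \<psi>"
  proof -
    have "C 1 (C 4 (C 6 (C 1 (C 2 (C 7 (C 1 (C 3 (C 5 \<psi>)))))))) = \<psi>" by (simp add: C_sort C_simps C_volume)
    then show ?thesis by (simp add: p C_simps)
  qed
  have p5: "C 2 (C 4 (C 5 \<psi>)) = \<psi>"
  proof -
    have "C 2 (C 4 (C 5 (C 1 (C 2 (C 7 (C 2 (C 3 (C 6 \<psi>)))))))) = - \<psi>" by (simp add: C_sort C_simps C_volume)
    then show ?thesis by (simp add: p C_simps)
  qed
  have p6: "C 3 (C 4 (C 7 \<psi>)) = - \<psi>"
  proof -
    have "C 3 (C 4 (C 7 (C 1 (C 3 (C 5 (C 2 (C 3 (C 6 \<psi>)))))))) = \<psi>" by (simp add: C_sort C_simps C_volume)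
    then show ?thesis by (simp add: p C_simps) (metis minus_minus)
  qed
  have p7: "C 5 (C 6 (C 7 \<psi>)) = - \<psi>"
  proof -
    have "C 5 (C 6 (C 7 (C 1 (C 2 (C 7 (C 3 (C 4 (C 7 \<psi>)))))))) = - \<psi>" by (simp add: C_sort C_simps C_volume)
    then show ?thesis by (simp add: p p6 C_simps)
  qed
  note l1 = line_products[of 1 2 7 \<psi> "-1", simplified, OF p(1)]
  note l2 = line_products[of 1 3 5 \<psi> "-1", simplified, OF p(2)]
  note l3 = line_products[of 2 3 6 \<psi> 1, simplified, OF p(3)]
  note l4 = line_products[of 1 4 6 \<psi> 1, simplified, OF p4]
  note l5 = line_products[of 2 4 5 \<psi> 1, simplified, OF p5]
  note l6 = line_products[of 3 4 7 \<psi> "-1", simplified, OF p6]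
  note l7 = line_products[of 5 6 7 \<psi> "-1", simplified, OF p7]
  have "pure \<psi>"
    unfolding pure_def ball7 sum7
    by (simp add: C_sq l1 l2 l3 l4 l5 l6 l7 phc_def oct_simps)
  then show ?thesis using \<psi> by blast
qed

end


section \<open>Clifford action of two-forms and three-forms on a pure spinor\<close>

context spin begin

text \<open>Products of two generators reduce on \<psi> to degree at most one, so a two-tensor acts
  through its trace and its contraction with \<phi>.\<close>

lemma pure_sum2:
  assumes "pure \<psi>"
  shows "(\<Sum>j=1..7. \<Sum>k=1..7. a j k *\<^sub>R C j (C k \<psi>)) =
    - (\<Sum>j=1..7. a j j) *\<^sub>R \<psi> + (\<Sum>i=1..7. (\<Sum>j=1..7. \<Sum>k=1..7. a j k * phc j k i) *\<^sub>R C i \<psi>)"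
proof -
  have "(\<Sum>j=1..7. \<Sum>k=1..7. a j k *\<^sub>R C j (C k \<psi>)) =
    (\<Sum>j=1..7. \<Sum>k=1..7. (if j = k then - a j k *\<^sub>R \<psi> else 0) + (\<Sum>i=1..7. (a j k * phc j k i) *\<^sub>R C i \<psi>))"
    by (intro sum.cong refl) (simp add: pure_rule[OF assms] scaleR_right_distrib scaleR_sum_right)
  also have "\<dots> = (\<Sum>j=1..7. \<Sum>k=1..7. if j = k then - a j k *\<^sub>R \<psi> else 0) +
      (\<Sum>j=1..7. \<Sum>k=1..7. \<Sum>i=1..7. (a j k * phc j k i) *\<^sub>R C i \<psi>)"
    by (simp only: sum.distrib)
  also have "(\<Sum>j=1..7. \<Sum>k=1..7. if j = k then - a j k *\<^sub>R \<psi> else 0) = - (\<Sum>j=1..7. a j j) *\<^sub>R \<psi>"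
    by (simp add: scaleR_sum_left sum_negf)
  also have "(\<Sum>j=1..7. \<Sum>k=1..7. \<Sum>i=1..7. (a j k * phc j k i) *\<^sub>R C i \<psi>)
    = (\<Sum>j=1..7. \<Sum>i=1..7. \<Sum>k=1..7. (a j k * phc j k i) *\<^sub>R C i \<psi>)" by (rule sum.cong[OF refl sum.swap])
  also have "\<dots> = (\<Sum>i=1..7. \<Sum>j=1..7. \<Sum>k=1..7. (a j k * phc j k i) *\<^sub>R C i \<psi>)" by (rule sum.swap)
  finally show ?thesis by (simp only: scaleR_sum_left)
qed

lemma pure_sum_less:
  assumes "\<And>i j. i \<in> {1..7} \<Longrightarrow> j \<in> {1..7} \<Longrightarrow> a i j = - a j i"
  shows "(\<Sum>i=1..7. \<Sum>j\<in>{i<..7}. a i j *\<^sub>R C i (C j \<psi>)) = (1/2) *\<^sub>R (\<Sum>i=1..7. \<Sum>j=1..7. a i j *\<^sub>R C i (C j \<psi>))"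
proof -
  have "(\<Sum>i=1..7. \<Sum>j\<in>{i<..7}. a i j *\<^sub>R C i (C j \<psi>)) $ n = ((1/2) *\<^sub>R (\<Sum>i=1..7. \<Sum>j=1..7. a i j *\<^sub>R C i (C j \<psi>))) $ n" for n
  proof -
    \<comment> \<open>\<open>sum_symmetric2\<close> is about real sums, hence the passage to the
      component \<open>n\<close>; it asks for symmetry at all natural numbers, hence the value 0
      outside the range 1 to 7.\<close>
    define f where "f = (\<lambda>i j. if i \<in> {1..7} \<and> j \<in> {1..7} then a i j * C i (C j \<psi>) $ n else 0)"
    have "f i j = f j i" for i j
    proof (cases "i \<in> {1..7} \<and> j \<in> {1..7} \<and> i \<noteq> j")
      case True
      then have "a j i = - a i j" "C j (C i \<psi>) = - C i (C j \<psi>)"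
        using assms[of j i] C_swap[of j i] by auto
      then show ?thesis by (simp add: f_def)
    qed (auto simp: f_def)
    moreover have "f i i = 0" for i using assms[of i i] by (auto simp: f_def)
    ultimately have "(\<Sum>i=1..7. \<Sum>j=1..7. f i j) = 2 * (\<Sum>i=1..7. \<Sum>j\<in>{i<..7}. f i j)" by (rule sum_symmetric2)
    moreover have "(\<Sum>i=1..7. \<Sum>j=1..7. f i j) = (\<Sum>i=1..7. \<Sum>j=1..7. a i j * C i (C j \<psi>) $ n)"
      "(\<Sum>i=1..7. \<Sum>j\<in>{i<..7}. f i j) = (\<Sum>i=1..7. \<Sum>j\<in>{i<..7}. a i j * C i (C j \<psi>) $ n)"
      by (auto intro!: sum.cong simp: f_def)
    ultimately show ?thesis by simp
  qed
  then show ?thesis by (simp only: vec_eq_iff) blast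
qed

lemma pure_g2:
  assumes \<psi>: "pure \<psi>" and a: "g2_matrix a"
  shows "(\<Sum>i=1..7. \<Sum>j\<in>{i<..7}. a i j *\<^sub>R C i (C j \<psi>)) = 0"
proof -
  have "a i i = 0" if "i \<in> {1..7}" for i using g2_matrix.antisym[OF a that that] by simp
  then have "(\<Sum>i=1..7. a i i) = 0" by (intro sum.neutral) blast
  moreover have "(\<Sum>n=1..7. (\<Sum>i=1..7. \<Sum>j=1..7. a i j * phc i j n) *\<^sub>R C n \<psi>) = 0"
    by (intro sum.neutral ballI) (simp only: g2_matrix.contract_phc[OF a] scaleR_zero_left)
  moreover have "(\<Sum>i=1..7. \<Sum>j\<in>{i<..7}. a i j *\<^sub>R C i (C j \<psi>))
      = (1/2) *\<^sub>R (\<Sum>i=1..7. \<Sum>j=1..7. a i j *\<^sub>R C i (C j \<psi>))"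
    by (rule pure_sum_less) (rule g2_matrix.antisym[OF a])
  ultimately show ?thesis by (simp add: pure_sum2[OF \<psi>])
qed

lemma cliff_form_full:
  assumes \<alpha>: "is_form 3 \<alpha>"
  shows "cliff_form c 3 e \<alpha> \<psi> =
    (1/6) *\<^sub>R (\<Sum>i=1..7. \<Sum>j=1..7. \<Sum>k=1..7. \<alpha> [e i, e j, e k] *\<^sub>R C i (C j (C k \<psi>)))"
proof -
  have 0: "cliff_form c 3 e \<alpha> \<psi> = (\<Sum>i=1..7. \<Sum>j\<in>{i<..7}. \<Sum>k\<in>{j<..7}. \<alpha> [e i, e j, e k] *\<^sub>R C i (C j (C k \<psi>)))"
    by (simp add: cliff_form_def sum_incr3 cliff_prod_def C_def matrix_vector_mul_assoc)
  have "(\<Sum>i=1..7. \<Sum>j\<in>{i<..7}. \<Sum>k\<in>{j<..7}. \<alpha> [e i, e j, e k] *\<^sub>R C i (C j (C k \<psi>))) $ n =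
    ((1/6) *\<^sub>R (\<Sum>i=1..7. \<Sum>j=1..7. \<Sum>k=1..7. \<alpha> [e i, e j, e k] *\<^sub>R C i (C j (C k \<psi>)))) $ n" for n
  proof -
    define f where "f = (\<lambda>i j k. if i \<in> {1..7} \<and> j \<in> {1..7} \<and> k \<in> {1..7} then \<alpha> [e i, e j, e k] * C i (C j (C k \<psi>)) $ n else 0)"
    note sym = form3_symmetric[OF \<alpha>]
    have "f i j k = f j i k" for i j k
    proof (cases "i \<in> {1..7} \<and> j \<in> {1..7} \<and> i \<noteq> j")
      case True
      then have "\<alpha> [e j, e i, e k] = - \<alpha> [e i, e j, e k]" "C j (C i (C k \<psi>)) = - C i (C j (C k \<psi>))"
        using sym(1)[of "e j" "e i"] C_swap[of j i] by auto
      then show ?thesis by (simp add: f_def)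
    qed (auto simp: f_def)
    moreover have "f i j k = f i k j" for i j k
    proof (cases "j \<in> {1..7} \<and> k \<in> {1..7} \<and> j \<noteq> k")
      case True
      then have "\<alpha> [e i, e k, e j] = - \<alpha> [e i, e j, e k]" "C i (C k (C j \<psi>)) = - C i (C j (C k \<psi>))"
        using sym(2)[of "e i" "e k" "e j"] C_swap[of k j] by (auto simp: C_simps)
      then show ?thesis by (simp add: f_def)
    qed (auto simp: f_def)
    moreover have "f i i k = 0" for i k by (simp add: f_def sym(3))
    ultimately have "(\<Sum>i=1..7. \<Sum>j=1..7. \<Sum>k=1..7. f i j k) = 6 * (\<Sum>i=1..7. \<Sum>j\<in>{i<..7}. \<Sum>k\<in>{j<..7}. f i j k)"
      by (rule sum_symmetric3)
    moreover have "(\<Sum>i=1..7. \<Sum>j=1..7. \<Sum>k=1..7. f i j k) = (\<Sum>i=1..7. \<Sum>j=1..7. \<Sum>k=1..7. \<alpha> [e i, e j, e k] * C i (C j (C k \<psi>)) $ n)"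
      "(\<Sum>i=1..7. \<Sum>j\<in>{i<..7}. \<Sum>k\<in>{j<..7}. f i j k) = (\<Sum>i=1..7. \<Sum>j\<in>{i<..7}. \<Sum>k\<in>{j<..7}. \<alpha> [e i, e j, e k] * C i (C j (C k \<psi>)) $ n)"
      by (auto intro!: sum.cong simp: f_def)
    ultimately show ?thesis by simp
  qed
  then show ?thesis unfolding 0 by (simp only: vec_eq_iff) blast
qed

text \<open>Two applications of \<open>pure_sum2\<close>: a three-form acts on \<psi> only through
  the matrix of its contractions with \<phi>. This matrix is a parameter \<open>b\<close>, so that a
  simplified form of it can be supplied; for \<open>b = 0\<close> the action is trivial.\<close>

lemma cliff_form_pure:
  fixes e :: "nat \<Rightarrow> 'v::real_vector" and b :: "nat \<Rightarrow> nat \<Rightarrow> real"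
  assumes \<alpha>: "is_form 3 \<alpha>" and \<psi>: "pure \<psi>"
    and b: "\<And>i l. i \<in> {1..7} \<Longrightarrow> l \<in> {1..7} \<Longrightarrow> b i l = (\<Sum>j=1..7. \<Sum>k=1..7. \<alpha> [e i, e j, e k] * phc j k l)"
  shows "cliff_form c 3 e \<alpha> \<psi> = (1/6) *\<^sub>R (- (\<Sum>i=1..7. b i i) *\<^sub>R \<psi> +
     (\<Sum>n=1..7. (\<Sum>i=1..7. \<Sum>l=1..7. b i l * phc i l n) *\<^sub>R C n \<psi>))"
proof -
  have z: "\<alpha> [x, y, y] = 0" for x y using form3_symmetric(2)[OF \<alpha>, of x y y] by simp
  have "(\<Sum>i=1..7. \<Sum>j=1..7. \<Sum>k=1..7. \<alpha> [e i, e j, e k] *\<^sub>R C i (C j (C k \<psi>))) =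
    (\<Sum>i=1..7. C i (\<Sum>j=1..7. \<Sum>k=1..7. \<alpha> [e i, e j, e k] *\<^sub>R C j (C k \<psi>)))"
    by (simp only: C_simps)
  also have "\<dots> = (\<Sum>i=1..7. \<Sum>l=1..7. b i l *\<^sub>R C i (C l \<psi>))"
    by (intro sum.cong refl) (simp add: pure_sum2[OF \<psi>] z C_simps b)
  also have "\<dots> = - (\<Sum>i=1..7. b i i) *\<^sub>R \<psi> + (\<Sum>n=1..7. (\<Sum>i=1..7. \<Sum>l=1..7. b i l * phc i l n) *\<^sub>R C n \<psi>)"
    by (rule pure_sum2[OF \<psi>])
  finally show ?thesis by (simp only: cliff_form_full[OF \<alpha>])
qed

lemma phc_cyclic: "i \<in> {1..7} \<Longrightarrow> j \<in> {1..7} \<Longrightarrow> k \<in> {1..7} \<Longrightarrow> phc j k i = phc i j k"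
  by (metis phc_antisym minus_minus)

text \<open>Here \<open>b\<close> is 6 times the identity by \<open>phc_phc\<close>; its trace 42
  divided by 6 gives 7, and its contraction with \<phi> vanishes by alternation.\<close>

lemma cliff_phi:
  fixes e :: "nat \<Rightarrow> 'v::real_vector"
  assumes w: "is_form 3 w" and \<psi>: "pure \<psi>"
    and wc: "\<And>i j k. i \<in> {1..7} \<Longrightarrow> j \<in> {1..7} \<Longrightarrow> k \<in> {1..7} \<Longrightarrow> w [e i, e j, e k] = phc i j k"
  shows "cliff_form c 3 e w \<psi> = - 7 *\<^sub>R \<psi>"
proof -
  have "(if i = l then 6 else 0) = (\<Sum>j=1..7. \<Sum>k=1..7. w [e i, e j, e k] * phc j k l)"
    if "i \<in> {1..7}" "l \<in> {1..7}" for i l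
  proof -
    have "(\<Sum>j=1..7. \<Sum>k=1..7. w [e i, e j, e k] * phc j k l) = (\<Sum>j=1..7. \<Sum>k=1..7. phc i j k * phc l j k)"
      by (intro sum.cong refl) (simp add: wc[OF that(1)] phc_cyclic[OF that(2)])
    then show ?thesis using phc_phc[OF that] by simp
  qed
  note * = cliff_form_pure[OF w \<psi> this]
  have "(\<Sum>n=1..7. (\<Sum>i=1..7. \<Sum>l=1..7. (if i = l then 6 else 0) * phc i l n) *\<^sub>R C n \<psi>) = 0"
  proof (rule sum.neutral, rule ballI)
    fix n :: nat assume n: "n \<in> {1..7}"
    have "phc i i n = 0" if "i \<in> {1..7}" for i using phc_antisym(1)[OF that that n] by simp
    then have "(\<Sum>i=1..7. \<Sum>l=1..7. (if i = l then 6 else 0) * phc i l n) = 0"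
      by (intro sum.neutral ballI) auto
    then show "(\<Sum>i=1..7. \<Sum>l=1..7. (if i = l then 6 else 0) * phc i l n) *\<^sub>R C n \<psi> = 0" by simp
  qed
  then show ?thesis using * by simp
qed


subsection \<open>The lift of the stabiliser\<close>

lemma pure_triple:
  assumes "pure \<psi>" "i \<in> {1..7}" "j \<in> {1..7}" "k \<in> {1..7}" "j \<noteq> k"
    and "\<And>l. l \<in> {1..7} \<Longrightarrow> phc j k l = (if l = i then 1 else 0)"
  shows "C i (C j (C k \<psi>)) = - \<psi>"
proof -
  have "(\<Sum>l=1..7. phc j k l *\<^sub>R C l \<psi>) = (\<Sum>l=1..7. if l = i then C l \<psi> else 0)"
    by (intro sum.cong refl) (simp add: assms(6))
  then have "C j (C k \<psi>) = C i \<psi>" using assms by (simp add: pure_rule)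
  then show ?thesis using assms by (simp add: C_sq)
qed

lemma pure_B_C:
  assumes \<psi>: "pure \<psi>" and i: "i \<in> {1..7}" and j: "j \<in> {1..7}"
  shows "B (C i \<psi>) (C j \<psi>) = (if i = j then B \<psi> \<psi> else 0)"
proof (cases "i = j")
  case True
  then show ?thesis using B_invariant[OF i] by simp
next
  case False
  have "B (C i \<psi>) (C j \<psi>) = - B \<psi> (\<Sum>k=1..7. phc i j k *\<^sub>R C k \<psi>)"
    using B_skew[OF i, of \<psi> "C j \<psi>"] pure_rule[OF \<psi> i j] False by simp
  also have "\<dots> = 0" by (simp add: B_simps) (intro sum.neutral ballI, simp add: B_C_self)
  finally show ?thesis using False by simp
qed

text \<open>For a line \<open>{j, k, l}\<close> that does not contain \<open>i\<close>, the product \<open>C j (C k (C l _))\<close> is an isometry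
  that acts as \<open>- 1\<close> on \<open>\<xi>\<close> and \<open>\<psi>\<close>, but anticommutes with \<open>C i\<close>.\<close>

lemma pure_B_C_other:
  assumes \<psi>: "pure \<psi>" and \<xi>: "pure \<xi>" and i: "i \<in> {1..7}"
  shows "B \<xi> (C i \<psi>) = 0"
proof -
  have *: "B \<xi> (C i \<psi>) = 0"
    if "j \<in> {1..7}" "k \<in> {1..7}" "l \<in> {1..7}" "distinct [i, j, k, l]"
      "\<And>n. n \<in> {1..7} \<Longrightarrow> phc k l n = (if n = j then 1 else 0)" for j k l
  proof -
    have t: "C j (C k (C l \<psi>)) = - \<psi>" "C j (C k (C l \<xi>)) = - \<xi>"
      using pure_triple[OF _ that(1-3) _ that(5)] \<psi> \<xi> that(4) by auto
    have "C j (C k (C l (C i \<psi>))) = - C i (C j (C k (C l \<psi>)))"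
      using that i C_swap[of l i] C_swap[of k i] C_swap[of j i] by (simp add: C_simps)
    then have "B (C j (C k (C l \<xi>))) (C j (C k (C l (C i \<psi>)))) = - B \<xi> (C i \<psi>)"
      unfolding t by (simp add: B_simps C_simps)
    then show ?thesis using that(1-3) by (simp add: B_invariant)
  qed
  have p: "\<forall>n\<in>{1..7}. phc 4 7 n = (if n = 3 then 1 else 0)" "\<forall>n\<in>{1..7}. phc 2 7 n = (if n = 1 then 1 else 0)"
    "\<forall>n\<in>{1..7}. phc 3 5 n = (if n = 1 then 1 else 0)"
    unfolding ball7 by (simp_all add: phc_def oct_simps)
  have "i = 1 \<or> i = 2 \<or> i = 3 \<or> i = 4 \<or> i = 5 \<or> i = 6 \<or> i = 7" using i by auto
  then show ?thesis
    using *[of 3 4 7] *[of 1 2 7] *[of 1 3 5] p by auto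
qed

lemma pure_lincomb: "pure \<psi> \<Longrightarrow> pure \<xi> \<Longrightarrow> pure (\<xi> - t *\<^sub>R \<psi>)"
  unfolding pure_def
  by (auto simp: C_simps scaleR_right_diff_distrib sum_subtractf scaleR_sum_right mult.commute)

lemma of_nat_8: "x = 8 \<or> x \<in> (of_nat :: nat \<Rightarrow> 8) ` {1..7}"
proof -
  have 1: "{1..7::nat} = {1,2,3,4,5,6,7}" by auto
  have "card {1,2,3,4,5,6,7,8::8} = 8" by simp
  then have "{1,2,3,4,5,6,7,8::8} = UNIV" by (intro card_subset_eq) auto
  then have "x \<in> {1,2,3,4,5,6,7,8::8}" by blast
  then show ?thesis by (auto simp: 1)
qed

text \<open>The eight vectors are orthogonal for \<open>B\<close> and of equal positive length,
  hence independent in an eight-dimensional space.\<close>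

lemma pure_spans:
  assumes \<psi>: "pure \<psi>" "\<psi> \<noteq> 0"
  shows "\<exists>r a. x = r *\<^sub>R \<psi> + (\<Sum>i=1..7. a i *\<^sub>R C i \<psi>)"
proof -
  define L where "L = (\<lambda>x::real^8. x $ 8 *\<^sub>R \<psi> + (\<Sum>i=1..7. x $ of_nat i *\<^sub>R C i \<psi>))"
  have lin: "linear L"
    unfolding L_def by (auto intro!: linearI simp: algebra_simps sum.distrib scaleR_sum_right)
  have "inj L"
  proof (rule linear_injective_0[OF lin, THEN iffD2], intro allI impI)
    fix x assume x: "L x = 0"
    have B0: "B \<psi> \<psi> \<noteq> 0" using B_eq_0 \<psi>(2) by simp
    have "B \<psi> (L x) = x $ 8 * B \<psi> \<psi> + (\<Sum>i=1..7. x $ of_nat i * B \<psi> (C i \<psi>))"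
      by (simp add: L_def B_simps)
    also have "(\<Sum>i=1..7. x $ of_nat i * B \<psi> (C i \<psi>)) = 0"
      by (intro sum.neutral ballI) (simp add: B_C_self)
    finally have 8: "x $ 8 = 0" using x B0 by (simp add: B_simps)
    have "x $ of_nat j = 0" if j: "j \<in> {1..7}" for j
    proof -
      have "B (C j \<psi>) (L x) = x $ 8 * B (C j \<psi>) \<psi> + (\<Sum>i=1..7. x $ of_nat i * B (C j \<psi>) (C i \<psi>))"
        by (simp add: L_def B_simps)
      also have "(\<Sum>i=1..7. x $ of_nat i * B (C j \<psi>) (C i \<psi>)) = (\<Sum>i=1..7. if i = j then x $ of_nat i * B \<psi> \<psi> else 0)"
        by (intro sum.cong refl) (simp add: pure_B_C[OF \<psi>(1) j])
      also have "\<dots> = x $ of_nat j * B \<psi> \<psi>" using j by simp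
      finally show ?thesis using x 8 B0 by (simp add: B_simps)
    qed
    then have "x $ i = 0" for i using 8 of_nat_8[of i] by auto
    then show "x = 0" by (simp add: vec_eq_iff)
  qed
  then have "surj L" using lin linear_injective_imp_surjective by blast
  then obtain y where "x = L y" by blast
  then show ?thesis unfolding L_def by (intro exI[of _ "y $ 8"] exI[of _ "\<lambda>i. y $ of_nat i"])
qed

text \<open>The part of \<xi> orthogonal to \<psi> is pure because purity is linear; by
  \<open>pure_B_C_other\<close> it is also orthogonal to all \<open>C i \<psi>\<close>, hence to
  everything.\<close>

lemma pure_unique:
  assumes \<psi>: "pure \<psi>" "\<psi> \<noteq> 0" and \<xi>: "pure \<xi>"
  shows "\<exists>t. \<xi> = t *\<^sub>R \<psi>"
proof -
  define t where "t = B \<xi> \<psi> / B \<psi> \<psi>"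
  let ?d = "\<xi> - t *\<^sub>R \<psi>"
  have "B \<psi> \<psi> \<noteq> 0" using B_eq_0 \<psi>(2) by simp
  then have 1: "B ?d \<psi> = 0" by (simp add: B_simps t_def)
  have 2: "B ?d (C i \<psi>) = 0" if "i \<in> {1..7}" for i
    by (rule pure_B_C_other[OF \<psi>(1) pure_lincomb[OF \<psi>(1) \<xi>] that])
  obtain r a where d: "?d = r *\<^sub>R \<psi> + (\<Sum>i=1..7. a i *\<^sub>R C i \<psi>)" using pure_spans[OF \<psi>] by blast
  have "B ?d (r *\<^sub>R \<psi> + (\<Sum>i=1..7. a i *\<^sub>R C i \<psi>)) = r * B ?d \<psi> + (\<Sum>i=1..7. a i * B ?d (C i \<psi>))"
    by (simp only: linear_add[OF B_linear(2)] linear_scale[OF B_linear(2)] linear_sum[OF B_linear(2)] real_scaleR_def)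
  also have "\<dots> = 0" unfolding 1 by (simp, intro sum.neutral ballI) (simp add: 2)
  finally have "B ?d ?d = 0" by (simp only: d[symmetric])
  then show ?thesis by (auto simp: B_eq_0)
qed

text \<open>For a unit vector the mixed terms cancel in pairs and the others add up to the squared
  length. The invariance will restrict the factor on the pure line to a sign.\<close>

lemma spin_group_isometry:
  assumes "s \<in> spin_group c"
  shows "B (s *v x) (s *v y) = B x y"
proof -
  obtain xs :: "(nat \<Rightarrow> real) list"
    where s: "s = foldr (\<lambda>x M. (\<Sum>i=1..7. x i *\<^sub>R c i) ** M) xs (mat 1)"
      and u: "\<forall>x\<in>set xs. (\<Sum>i=1..7. (x i)\<^sup>2) = 1"
    using assms by (auto simp: spin_group_def)
  have unit: "B ((\<Sum>i=1..7. v i *\<^sub>R c i) *v x) ((\<Sum>i=1..7. v i *\<^sub>R c i) *v y) = B x y"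
    if v: "(\<Sum>i=1..7. (v i)\<^sup>2) = 1" for v x y
  proof -
    have e: "(\<Sum>i=1..7. v i *\<^sub>R c i) *v x = (\<Sum>i=1..7. v i *\<^sub>R C i x)" for x
    proof -
      have "(\<Sum>i\<in>I. M i) *v x = (\<Sum>i\<in>I. M i *v x)" for I and M :: "nat \<Rightarrow> real^8^8"
        by (induction I rule: infinite_finite_induct) (auto simp: matrix_vector_mult_add_rdistrib)
      then show ?thesis by (simp add: C_def scaleR_matrix_vector_assoc)
    qed
    define f where "f = (\<lambda>i j. v i * v j * B (C j x) (C i y))"
    have "B (\<Sum>i=1..7. v i *\<^sub>R C i x) (\<Sum>j=1..7. v j *\<^sub>R C j y) = (\<Sum>i=1..7. \<Sum>j=1..7. f i j)"
      by (simp add: B_simps f_def sum_distrib_left mult.assoc)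
    moreover have "(\<Sum>i=1..7. \<Sum>j=1..7. f i j) = (\<Sum>i=1..7. \<Sum>j=1..7. f j i)" by (rule sum.swap)
    moreover have "(\<Sum>i=1..7. \<Sum>j=1..7. f i j) + (\<Sum>i=1..7. \<Sum>j=1..7. f j i)
       = (\<Sum>i=1..7. \<Sum>j=1..7. if i = j then 2 * (v i)\<^sup>2 * B x y else 0)"
      unfolding sum.distrib[symmetric]
    proof (intro sum.cong refl)
      fix i j :: nat assume ij: "i \<in> {1..7}" "j \<in> {1..7}"
      show "f i j + f j i = (if i = j then 2 * (v i)\<^sup>2 * B x y else 0)"
      proof (cases "i = j")
        case True
        then show ?thesis using ij by (simp add: f_def B_invariant power2_eq_square)
      next
        case False
        have "B (C i x) (C j y) = - B (C j x) (C i y)"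
          using ij False by (simp add: B_skew C_swap[of i j] B_simps)
        then show ?thesis using False by (simp add: f_def)
      qed
    qed
    moreover have "(\<Sum>i=1..7. \<Sum>j=1..7. if i = j then 2 * (v i)\<^sup>2 * B x y else 0) = 2 * B x y"
    proof -
      have "(\<Sum>i=1..7. \<Sum>j=1..7. if i = j then 2 * (v i)\<^sup>2 * B x y else 0) = (\<Sum>i=1..7. (v i)\<^sup>2) * (2 * B x y)"
        by (simp add: sum_distrib_left sum_distrib_right mult_ac)
      then show ?thesis by (simp add: v)
    qed
    ultimately show ?thesis unfolding e by simp
  qed
  show ?thesis unfolding s using u
    by (induction xs arbitrary: x y) (simp_all add: unit flip: matrix_vector_mul_assoc)
qed

end

section \<open>The standard frame and the action of the stabiliser on pure spinors\<close>

lemma inner_inner_product: "inner_product ((\<bullet>) :: real^7 \<Rightarrow> real^7 \<Rightarrow> real)"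
  by (auto simp: inner_product_def bilinear_def inner_commute intro!: linearI simp: inner_add_left inner_add_right)

lemma std_frame_on_frame: "on_frame (\<bullet>) std_frame"
proof -
  have "(\<Sum>k=1..7. x $ of_nat k *\<^sub>R axis (of_nat k) 1) = x" for x :: "real^7"
  proof -
    have "(\<Sum>k=1..7. x $ of_nat k *\<^sub>R axis (of_nat k) 1) = (\<Sum>i\<in>(of_nat :: nat \<Rightarrow> 7) ` {1..7}. x $ i *\<^sub>R axis i (1::real))"
      by (simp add: sum.reindex[OF of_nat_7(1)])
    then show ?thesis by (simp add: of_nat_7(2) basis_expansion flip: scalar_mult_eq_scaleR)
  qed
  then have "det (matrix (\<lambda>x::real^7. \<Sum>k=1..7. x $ of_nat k *\<^sub>R std_frame k)) = 1"
    by (simp add: std_frame_def matrix_id_mat_1[unfolded id_def])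
  moreover have "std_frame i \<bullet> std_frame j = (if i = j then 1 else 0)" if "i \<in> {1..7}" "j \<in> {1..7}" for i j
    using inj_on_eq_iff[OF of_nat_7(1) that] by (auto simp: std_frame_def inner_axis_axis)
  ultimately show ?thesis by (simp add: on_frame_def)
qed

lemma phi_expand:
  assumes b: "inner_product b" and f: "on_frame b f"
  shows "phi b f [x, y, z] = (\<Sum>j=1..7. \<Sum>k=1..7. \<Sum>i=1..7. b x (f j) * b y (f k) * b z (f i) * phc j k i)"
proof -
  note l = form3_linear[OF phi_form[where e = f, OF inner_product_rules(2)[OF b]]]
  have e1: "phi b f [x, y, z] = (\<Sum>j=1..7. b x (f j) * phi b f [f j, y, z])" for x y z
    by (subst frame_expand[OF b f, of x]) (simp add: linear_sum[OF l(1)] linear_scale[OF l(1)])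
  have e2: "phi b f [x, y, z] = (\<Sum>k=1..7. b y (f k) * phi b f [x, f k, z])" for x y z
    by (subst frame_expand[OF b f, of y]) (simp add: linear_sum[OF l(2)] linear_scale[OF l(2)])
  have e3: "phi b f [x, y, z] = (\<Sum>i=1..7. b z (f i) * phi b f [x, y, f i])" for x y z
    by (subst frame_expand[OF b f, of z]) (simp add: linear_sum[OF l(3)] linear_scale[OF l(3)])
  have "phi b f [x, y, z] = (\<Sum>j=1..7. b x (f j) * phi b f [f j, y, z])" by (rule e1)
  also have "\<dots> = (\<Sum>j=1..7. b x (f j) * (\<Sum>k=1..7. b y (f k) * phi b f [f j, f k, z]))"
    by (intro sum.cong refl arg_cong2[of _ _ _ _ "(*)"] e2)
  also have "\<dots> = (\<Sum>j=1..7. b x (f j) * (\<Sum>k=1..7. b y (f k) * (\<Sum>i=1..7. b z (f i) * phi b f [f j, f k, f i])))"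
    by (intro sum.cong refl arg_cong2[of _ _ _ _ "(*)"] e3)
  also have "\<dots> = (\<Sum>j=1..7. \<Sum>k=1..7. \<Sum>i=1..7. b x (f j) * b y (f k) * b z (f i) * phc j k i)"
    unfolding sum_distrib_left by (intro sum.cong refl) (simp add: phi_orth[OF b f] mult.assoc)
  finally show ?thesis .
qed

lemma sum4_out:
  fixes v :: "nat \<Rightarrow> 'a::real_vector"
  shows "(\<Sum>j\<in>J. \<Sum>k\<in>K. \<Sum>i\<in>I. \<Sum>n\<in>N. f j k i n *\<^sub>R v n) = (\<Sum>n\<in>N. (\<Sum>j\<in>J. \<Sum>k\<in>K. \<Sum>i\<in>I. f j k i n) *\<^sub>R v n)"
proof -
  have "(\<Sum>j\<in>J. \<Sum>k\<in>K. \<Sum>i\<in>I. \<Sum>n\<in>N. f j k i n *\<^sub>R v n) = (\<Sum>j\<in>J. \<Sum>k\<in>K. \<Sum>n\<in>N. \<Sum>i\<in>I. f j k i n *\<^sub>R v n)"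
    by (intro sum.cong refl sum.swap)
  also have "\<dots> = (\<Sum>j\<in>J. \<Sum>n\<in>N. \<Sum>k\<in>K. \<Sum>i\<in>I. f j k i n *\<^sub>R v n)" by (intro sum.cong refl sum.swap)
  also have "\<dots> = (\<Sum>n\<in>N. \<Sum>j\<in>J. \<Sum>k\<in>K. \<Sum>i\<in>I. f j k i n *\<^sub>R v n)" by (rule sum.swap)
  finally show ?thesis by (simp only: scaleR_sum_left)
qed

context spin begin

text \<open>Purity involves only the Kronecker delta and \<phi>. Conjugation by \<open>s\<close>
  transforms the generators by \<open>a\<close>, and the hypothesis on the frame says that
  \<open>a\<close> is orthogonal and preserves \<phi>.\<close>

lemma covers_pure:
  assumes \<psi>: "pure \<psi>" and s: "covers c s a"
    and a: "adapted_frame (\<bullet>) (phi (\<bullet>) std_frame) (frame_act std_frame a)"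
  shows "pure (s *v \<psi>)"
proof -
  let ?F = "frame_act std_frame a" and ?\<xi> = "s *v \<psi>"
  have F: "on_frame (\<bullet>) ?F" and phi: "phi (\<bullet>) std_frame [x, y, z] = phi (\<bullet>) ?F [x, y, z]" for x y z
    using a by (simp_all add: adapted_frame_def)
  have comp: "std_frame i \<bullet> ?F j = a i j" if "i \<in> {1..7}" for i j
  proof -
    have "std_frame i \<bullet> ?F j = (\<Sum>k=1..7. a k j * (std_frame i \<bullet> std_frame k))"
      by (simp add: frame_act_def inner_sum_right)
    also have "\<dots> = (\<Sum>k=1..7. if k = i then a k j else 0)"
      by (intro sum.cong refl) (simp add: on_frame_orth[OF std_frame_on_frame that])
    finally show ?thesis using that by simp
  qed
  have orth: "(\<Sum>j=1..7. a p j * a q j) = (if p = q then 1 else 0)" if pq: "p \<in> {1..7}" "q \<in> {1..7}" for p q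
    using frame_parseval[OF inner_inner_product F, of "std_frame p" "std_frame q"]
    unfolding comp[OF pq(1)] comp[OF pq(2)] on_frame_orth[OF std_frame_on_frame pq] .
  have phc: "phc p q n = (\<Sum>j=1..7. \<Sum>k=1..7. \<Sum>i=1..7. a p j * a q k * a n i * phc j k i)"
    if pqn: "p \<in> {1..7}" "q \<in> {1..7}" "n \<in> {1..7}" for p q n
    using phi_orth[OF inner_inner_product std_frame_on_frame pqn]
    unfolding phi phi_expand[OF inner_inner_product F] comp[OF pqn(1)] comp[OF pqn(2)] comp[OF pqn(3)] by simp
  have mv: "(\<Sum>i\<in>I. M i) *v x = (\<Sum>i\<in>I. M i *v x)" for I x and M :: "nat \<Rightarrow> real^8^8"
    by (induction I rule: infinite_finite_induct) (auto simp: matrix_vector_mult_add_rdistrib)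
  have sC: "s *v C j x = (\<Sum>i=1..7. a i j *\<^sub>R C i (s *v x))" if "j \<in> {1..7}" for j x
  proof -
    have "(s ** c j) *v x = ((\<Sum>i=1..7. a i j *\<^sub>R c i) ** s) *v x" using s that by (simp add: covers_def)
    then show ?thesis
      by (simp add: C_def mv scaleR_matrix_vector_assoc flip: matrix_vector_mul_assoc)
  qed
  \<comment> \<open>The relation \<open>sC\<close> solved for the generators: the inverse of an
    orthogonal matrix is its transpose.\<close>
  have Cs: "C p (s *v x) = (\<Sum>j=1..7. a p j *\<^sub>R (s *v C j x))" if p: "p \<in> {1..7}" for p x
  proof -
    have "(\<Sum>j=1..7. a p j *\<^sub>R (s *v C j x)) = (\<Sum>j=1..7. \<Sum>i=1..7. (a p j * a i j) *\<^sub>R C i (s *v x))"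
      by (intro sum.cong refl) (simp add: sC scaleR_sum_right)
    also have "\<dots> = (\<Sum>i=1..7. (\<Sum>j=1..7. a p j * a i j) *\<^sub>R C i (s *v x))"
      by (subst sum.swap) (simp add: scaleR_sum_left)
    also have "\<dots> = (\<Sum>i=1..7. if i = p then C i (s *v x) else 0)"
      by (intro sum.cong refl) (simp add: orth[OF p])
    finally show ?thesis using p by simp
  qed
  have smv: "s *v (x + y) = s *v x + s *v y" "s *v (- x) = - (s *v x)" "s *v (r *\<^sub>R x) = r *\<^sub>R (s *v x)"
    "s *v (\<Sum>k\<in>K. f k) = (\<Sum>k\<in>K. s *v f k)" "s *v 0 = 0" for x y r and K :: "nat set" and f
    by (simp_all add: matrix_vector_right_distrib vec.neg matrix_vector_mult_scaleR vec.sum)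
  show ?thesis unfolding pure_def
  proof (intro ballI)
    fix p q :: nat assume pq: "p \<in> {1..7}" "q \<in> {1..7}"
    have "C p (C q ?\<xi>) = (\<Sum>k=1..7. \<Sum>j=1..7. (a p j * a q k) *\<^sub>R (s *v C j (C k \<psi>)))"
      by (simp add: Cs[OF pq(1)] Cs[OF pq(2)] C_simps scaleR_sum_right mult.commute)
    also have "\<dots> = (\<Sum>j=1..7. \<Sum>k=1..7. (a p j * a q k) *\<^sub>R (s *v C j (C k \<psi>)))" by (rule sum.swap)
    also have "\<dots> = (\<Sum>j=1..7. \<Sum>k=1..7. (if j = k then - (a p j * a q k) *\<^sub>R ?\<xi> else 0) +
        (\<Sum>i=1..7. \<Sum>n=1..7. (a p j * a q k * a n i * phc j k i) *\<^sub>R C n ?\<xi>))"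
    proof (intro sum.cong refl)
      fix j k :: nat assume jk: "j \<in> {1..7}" "k \<in> {1..7}"
      have "s *v (\<Sum>i=1..7. phc j k i *\<^sub>R C i \<psi>) = (\<Sum>i=1..7. \<Sum>n=1..7. (a n i * phc j k i) *\<^sub>R C n ?\<xi>)"
        unfolding smv by (intro sum.cong refl) (simp add: sC scaleR_sum_right mult.commute)
      then show "(a p j * a q k) *\<^sub>R (s *v C j (C k \<psi>)) = (if j = k then - (a p j * a q k) *\<^sub>R ?\<xi> else 0) +
        (\<Sum>i=1..7. \<Sum>n=1..7. (a p j * a q k * a n i * phc j k i) *\<^sub>R C n ?\<xi>)"
        unfolding pure_rule[OF \<psi> jk] smv(1) by (simp add: smv scaleR_right_distrib scaleR_sum_right mult.assoc)
    qed
    also have "\<dots> = - (\<Sum>j=1..7. a p j * a q j) *\<^sub>R ?\<xi> +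
        (\<Sum>n=1..7. (\<Sum>j=1..7. \<Sum>k=1..7. \<Sum>i=1..7. a p j * a q k * a n i * phc j k i) *\<^sub>R C n ?\<xi>)"
      unfolding sum.distrib sum4_out by (simp add: scaleR_sum_left sum_negf)
    also have "\<dots> = (if p = q then - ?\<xi> else 0) + (\<Sum>n=1..7. phc p q n *\<^sub>R C n ?\<xi>)"
    proof -
      have "(\<Sum>n=1..7. (\<Sum>j=1..7. \<Sum>k=1..7. \<Sum>i=1..7. a p j * a q k * a n i * phc j k i) *\<^sub>R C n ?\<xi>)
        = (\<Sum>n=1..7. phc p q n *\<^sub>R C n ?\<xi>)"
        by (intro sum.cong refl) (simp only: phc[OF pq])
      then show ?thesis by (simp add: orth[OF pq])
    qed
    finally show "C p (C q ?\<xi>) = (if p = q then - ?\<xi> else 0) + (\<Sum>n=1..7. phc p q n *\<^sub>R C n ?\<xi>)" .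
  qed
qed

text \<open>An element over the stabiliser maps \<open>\<psi>\<close> to \<open>\<plusminus> \<psi>\<close>; on the component of the identity the sign is
  constant.\<close>

lemma G2_lift_fixes:
  assumes \<psi>: "pure \<psi>" "\<psi> \<noteq> 0" and s: "s \<in> G2_lift c"
  shows "s *v \<psi> = \<psi>"
proof -
  let ?K = "{s \<in> spin_group c. \<exists>a. covers c s a \<and> adapted_frame (\<bullet>) (phi (\<bullet>) std_frame) (frame_act std_frame a)}"
  have pm: "r *v \<psi> = \<psi> \<or> r *v \<psi> = - \<psi>" if r: "r \<in> ?K" for r
  proof -
    obtain a where a: "covers c r a" "adapted_frame (\<bullet>) (phi (\<bullet>) std_frame) (frame_act std_frame a)" and sg: "r \<in> spin_group c"
      using r by blast
    obtain t where t: "r *v \<psi> = t *\<^sub>R \<psi>" using pure_unique[OF \<psi> covers_pure[OF \<psi>(1) a]] by blast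
    have "t * (t * B \<psi> \<psi>) = B \<psi> \<psi>" using spin_group_isometry[OF sg, of \<psi> \<psi>] by (simp add: t B_simps)
    moreover have "B \<psi> \<psi> \<noteq> 0" using B_eq_0 \<psi>(2) by simp
    ultimately have "t * t = 1" by (simp flip: mult.assoc)
    then have "t = 1 \<or> t = -1" by (metis square_eq_1_iff)
    then show ?thesis using t by auto
  qed
  obtain X where X: "connected X" "X \<subseteq> ?K" "mat 1 \<in> X" "s \<in> X"
    using s unfolding G2_lift_def connected_component_def mem_Collect_eq by auto
  have lin: "linear (\<lambda>M::real^8^8. M *v \<psi>)"
    by (auto intro!: linearI simp: matrix_vector_mult_add_rdistrib scaleR_matrix_vector_assoc)
  have con: "connected ((\<lambda>M. M *v \<psi>) ` X)"
    by (rule connected_continuous_image[OF _ X(1)])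
      (rule linear_continuous_on[OF lin[unfolded linear_conv_bounded_linear]])
  have sub: "(\<lambda>M. M *v \<psi>) ` X \<subseteq> {\<psi>, - \<psi>}" using pm X(2) by blast
  then have "finite ((\<lambda>M. M *v \<psi>) ` X)" by (rule finite_subset) simp
  then obtain y where y: "(\<lambda>M. M *v \<psi>) ` X = {y}"
    using connected_finite_iff_sing[OF con] X(3) by blast
  have "mat 1 *v \<psi> = y" "s *v \<psi> = y" using y X(3,4) by blast+
  then show ?thesis by simp
qed

end


section \<open>The torsion in terms of the intrinsic torsion\<close>

text \<open>4 = 6 - 1 - 1: the quadratic part of \<open>psc\<close> contributes 6 by
  \<open>phc_phc\<close>, and each delta term contributes -1.\<close>

lemma psc_phc:
  assumes "u \<in> {1..7}" "i \<in> {1..7}" "l \<in> {1..7}"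
  shows "(\<Sum>j=1..7. \<Sum>k=1..7. psc u i j k * phc j k l) = 4 * phc u i l"
proof -
  have cyc: "phc j k l = phc l j k" if "j \<in> {1..7}" "k \<in> {1..7}" for j k
    using that assms by (metis phc_antisym minus_minus)
  have "(\<Sum>j=1..7. \<Sum>k=1..7. psc u i j k * phc j k l) =
     (\<Sum>j=1..7. \<Sum>k=1..7. \<Sum>p=1..7. phc u i p * (phc p j k * phc l j k))
     - (\<Sum>j=1..7. \<Sum>k=1..7. if j = u then if k = i then phc j k l else 0 else 0)
     + (\<Sum>j=1..7. \<Sum>k=1..7. if j = i then if k = u then phc j k l else 0 else 0)"
    unfolding psc_def sum_subtractf[symmetric] sum.distrib[symmetric]
    by (intro sum.cong refl) (auto simp: cyc algebra_simps sum_distrib_left)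
  also have "(\<Sum>j=1..7. \<Sum>k=1..7. \<Sum>p=1..7. phc u i p * (phc p j k * phc l j k))
    = (\<Sum>p=1..7. phc u i p * (\<Sum>j=1..7. \<Sum>k=1..7. phc p j k * phc l j k))"
  proof -
    have "(\<Sum>j=1..7. \<Sum>k=1..7. \<Sum>p=1..7. phc u i p * (phc p j k * phc l j k))
      = (\<Sum>j=1..7. \<Sum>p=1..7. \<Sum>k=1..7. phc u i p * (phc p j k * phc l j k))" by (rule sum.cong[OF refl sum.swap])
    also have "\<dots> = (\<Sum>p=1..7. \<Sum>j=1..7. \<Sum>k=1..7. phc u i p * (phc p j k * phc l j k))" by (rule sum.swap)
    finally show ?thesis by (simp only: sum_distrib_left)
  qed
  also have "\<dots> = (\<Sum>p=1..7. if p = l then 6 * phc u i p else 0)"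
    by (intro sum.cong refl) (simp add: phc_phc[OF _ assms(3)])
  also have "\<dots> = 6 * phc u i l" using assms by simp
  also have "(\<Sum>j=1..7. \<Sum>k=1..7. if j = u then if k = i then phc j k l else 0 else 0) = phc u i l"
    using assms by (subst sum.swap) simp
  also have "(\<Sum>j=1..7. \<Sum>k=1..7. if j = i then if k = u then phc j k l else 0 else 0) = phc i u l"
    using assms by (subst sum.swap) simp
  also have "phc i u l = - phc u i l" using phc_antisym(1)[OF assms(2,1,3)] .
  finally show ?thesis by simp
qed

text \<open>A two-form \<open>F\<close> acts on the model form as \<open>\<Sum> (F, e\<^sub>i \<lrcorner> \<omega>) e\<^sub>i \<lrcorner> *\<omega>\<close>. For every \<open>i\<close> there is a triple of
  indices at which only the \<open>i\<close>-th summand contributes.\<close>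

lemma two_form_action:
  assumes F: "\<And>u v. u \<in> {1..7} \<Longrightarrow> v \<in> {1..7} \<Longrightarrow> F u v = - F v u" and i: "i \<in> {1..7}"
  obtains j k l s where "j \<in> {1..7}" "k \<in> {1..7}" "l \<in> {1..7}" "s \<noteq> 0"
    "\<And>n. n \<in> {1..7} \<Longrightarrow> psc n j k l = (if n = i then s else 0)"
    "(\<Sum>m=1..7. F j m * phc m k l + F k m * phc j m l + F l m * phc j k m)
      = 1/2 * (\<Sum>u=1..7. \<Sum>v=1..7. F u v * phc u v i) * s"
proof -
  note fin = that
  have an: "\<forall>u\<in>{1..7}. \<forall>v\<in>{u<..7}. F v u = - F u v"
    by (intro ballI F) auto
  have d: "F u u = 0" if "u \<in> {1..7}" for u using F[OF that that] by simp
  have d7: "\<forall>u\<in>{1..7}. F u u = 0" using d by blast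
  note F_simps = an[unfolded ball7 ball_greater7, simplified] d7[unfolded ball7]
  define Q where "Q = (\<lambda>i j k l. (psc i j k l = 1 \<or> psc i j k l = -1) \<and>
    (\<forall>n\<in>{1..7}. psc n j k l = (if n = i then psc i j k l else 0)) \<and>
    (\<Sum>m=1..7. F j m * phc m k l + F k m * phc j m l + F l m * phc j k m)
      = 1/2 * (\<Sum>u=1..7. \<Sum>v=1..7. F u v * phc u v i) * psc i j k l)"
  \<comment> \<open>The four indices always form the complement of a line, where the four-form is
    nonzero; no other index completes the last three to such a complement.\<close>
  have Q: "Q 1 2 3 4" "Q 2 1 3 4" "Q 3 1 2 4" "Q 4 1 2 3" "Q 5 1 2 6" "Q 6 1 2 5" "Q 7 1 3 6"
    unfolding Q_def ball7 sum7
    by (simp_all add: F_simps psc_oct phc_def oct_simps flip: One_nat_def) (simp_all add: field_simps)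
  have res: thesis if "Q i j k l" "j \<in> {1..7}" "k \<in> {1..7}" "l \<in> {1..7}" for j k l
    using that(1) unfolding Q_def by (intro fin[OF that(2-4), of "psc i j k l"]) auto
  have "i = 1 \<or> i = 2 \<or> i = 3 \<or> i = 4 \<or> i = 5 \<or> i = 6 \<or> i = 7" using i by auto
  then show ?thesis
    using Q res[of 2 3 4] res[of 1 3 4] res[of 1 2 4] res[of 1 2 3] res[of 1 2 6] res[of 1 2 5] res[of 1 3 6]
    by auto
qed

lemma wedge_numeral_simps:
  "wedge 3 f h (v # vs) = wedge 2 (contract v f) h vs - wedge 3 f (contract v h) vs"
  "wedge 2 f h (v # vs) = wedge 1 (contract v f) h vs + wedge 2 f (contract v h) vs"
  "wedge 1 f h (v # vs) = f [v] * h vs - wedge 1 f (contract v h) vs"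
  "wedge 3 f h [] = 0" "wedge 2 f h [] = 0" "wedge 1 f h [] = 0"
  using wedge_Cons[of 2 f h v vs] wedge_Cons[of 1 f h v vs] wedge_Cons[of 0 f h v vs]
    wedge_Nil[of 2 f h] wedge_Nil[of 1 f h] wedge_Nil[of 0 f h]
  by (simp_all add: wedge_0 contract_def One_nat_def numeral_2_eq_2 numeral_3_eq_3)

lemma wedge_flat: "wedge 1 (flat b x) (flat b y) [u, v] = b x u * b y v - b x v * b y u"
  by (simp add: wedge_numeral_simps flat_def contract_def)

context spin begin

lemma pure_oct:
  assumes \<psi>: "pure \<psi>" and "j \<in> {1..7}" "k \<in> {1..7}"
  shows "C j (C k \<psi>) = (if j = k then - \<psi> else sgn (oct j k) *\<^sub>R C (nat \<bar>oct j k\<bar>) \<psi>)"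
proof -
  have "\<forall>j\<in>{1..7}. \<forall>k\<in>{1..7}. (\<Sum>i=1..7. phc j k i *\<^sub>R C i \<psi>) = (if j = k then 0 else sgn (oct j k) *\<^sub>R C (nat \<bar>oct j k\<bar>) \<psi>)"
    unfolding ball7 by (simp add: sum7 phc_def oct_simps flip: One_nat_def)
  then show ?thesis using pure_rule[OF assms] assms(2,3) by simp
qed

lemma cliff_form_lincomb:
  "cliff_form c k e (\<lambda>vs. a * \<alpha> vs + b * \<beta> vs) \<psi> = a *\<^sub>R cliff_form c k e \<alpha> \<psi> + b *\<^sub>R cliff_form c k e \<beta> \<psi>"
  by (simp add: cliff_form_def scaleR_left_distrib sum.distrib scaleR_sum_right)

text \<open>The product with the dual form gives \<open>E0\<close>; the one with the three-form, on
  the six frame vectors other than the i-th, gives \<open>E1\<close> to \<open>E7\<close>, each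
  solved for a component that occurs in no other. On \<psi> these seven remove the coefficients of
  the \<open>C i \<psi>\<close>, and \<open>E0\<close> removes that of \<psi>.\<close>

lemma cliff_Lambda27:
  assumes \<psi>: "pure \<psi>" and b: "inner_product b" and e: "on_frame b e"
    and w: "\<And>i j k. i \<in> {1..7} \<Longrightarrow> j \<in> {1..7} \<Longrightarrow> k \<in> {1..7} \<Longrightarrow> w [e i, e j, e k] = phc i j k"
    and \<gamma>: "\<gamma> \<in> Lambda3_27 b e w"
  shows "cliff_form c 3 e \<gamma> \<psi> = 0"
proof -
  have w': "w [e i, e j, e k] = phc i j k" if "1 \<le> i" "i \<le> 7" "1 \<le> j" "j \<le> 7" "1 \<le> k" "k \<le> 7" for i j k
    using w that by simp
  have h': "hodge b e 3 w [e i, e j, e k, e l] = psc i j k l"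
    if "1 \<le> i" "i \<le> 7" "1 \<le> j" "j \<le> 7" "1 \<le> k" "k \<le> 7" "1 \<le> l" "l \<le> 7" for i j k l
    using hodge_components[OF b e w] that by simp
  have six: "wedge 3 \<gamma> w vs = 0" if "length vs = 6" for vs using \<gamma> that by (simp add: Lambda3_27_def)
  have seven: "wedge 3 \<gamma> (hodge b e 3 w) vs = 0" if "length vs = 7" for vs using \<gamma> that by (simp add: Lambda3_27_def)
  note ev = wedge_numeral_simps contract_def w' h' psc_oct phc_def oct_simps
  define z where "z = (\<lambda>i j k. \<gamma> [e i, e j, e k])"
  have E0: "z 1 2 7 + z 1 3 5 - z 1 4 6 - z 2 3 6 - z 2 4 5 + z 3 4 7 + z 5 6 7 = 0"
    using seven[of "[e 1, e 2, e 3, e 4, e 5, e 6, e 7]"]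
    by (simp add: ev flip: One_nat_def) (simp add: z_def)
  have E1: "z 2 3 4 = - z 2 5 6 - z 3 6 7 - z 4 5 7"
    using six[of "[e 2, e 3, e 4, e 5, e 6, e 7]"] by (simp add: ev flip: One_nat_def) (simp add: z_def)
  have E2: "z 1 3 4 = - z 1 5 6 + z 3 5 7 - z 4 6 7"
    using six[of "[e 1, e 3, e 4, e 5, e 6, e 7]"] by (simp add: ev flip: One_nat_def) (simp add: z_def)
  have E3: "z 1 2 4 = z 1 6 7 + z 2 5 7 - z 4 5 6"
    using six[of "[e 1, e 2, e 4, e 5, e 6, e 7]"] by (simp add: ev flip: One_nat_def) (simp add: z_def)
  have E4: "z 1 2 3 = - z 1 5 7 + z 2 6 7 - z 3 5 6"
    using six[of "[e 1, e 2, e 3, e 5, e 6, e 7]"] by (simp add: ev flip: One_nat_def) (simp add: z_def)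
  have E5: "z 1 2 6 = - z 1 4 7 - z 2 3 7 - z 3 4 6"
    using six[of "[e 1, e 2, e 3, e 4, e 6, e 7]"] by (simp add: ev flip: One_nat_def) (simp add: z_def)
  have E6: "z 1 2 5 = z 1 3 7 - z 2 4 7 - z 3 4 5"
    using six[of "[e 1, e 2, e 3, e 4, e 5, e 7]"] by (simp add: ev flip: One_nat_def) (simp add: z_def)
  have E7: "z 1 3 6 = - z 1 4 5 - z 2 3 5 + z 2 4 6"
    using six[of "[e 1, e 2, e 3, e 4, e 5, e 6]"] by (simp add: ev flip: One_nat_def) (simp add: z_def)
  have "cliff_form c 3 e \<gamma> \<psi> = (\<Sum>i=1..7. \<Sum>j\<in>{i<..7}. \<Sum>k\<in>{j<..7}. z i j k *\<^sub>R C i (C j (C k \<psi>)))"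
    by (simp add: cliff_form_def sum_incr3 cliff_prod_def C_def matrix_vector_mul_assoc z_def)
  also have "\<dots> = - (z 1 2 7 + z 1 3 5 - z 1 4 6 - z 2 3 6 - z 2 4 5 + z 3 4 7 + z 5 6 7) *\<^sub>R \<psi>"
    unfolding sum7 sum_greater7
    by (simp add: pure_oct[OF \<psi>] oct_simps C_simps E1 E2 E3 E4 E5 E6 E7 algebra_simps flip: One_nat_def)
  finally show ?thesis by (simp add: E0)
qed

end

section \<open>Structures of the given type: torsion and Dirac operator on the spinor\<close>

locale g2_type = g2_lc A D g \<omega> Dg + spin c
  for A :: "('m::{t2_space, second_countable_topology}, 7) chart set" and D g \<omega> Dg c +
  fixes lam :: "'m \<Rightarrow> real" and \<beta> :: "'m \<Rightarrow> real^7" and \<Gamma> :: "'m \<Rightarrow> (real^7) form"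
  assumes type: "G2_type_1_7_27 A g \<omega> Dg lam \<beta> \<Gamma>"
begin

lemma \<Gamma>_form: "is_form 3 (\<Gamma> p)"
  using type by (simp add: G2_type_1_7_27_def smooth_form_def)

lemma \<Gamma>_27: "on_frame (g p) e \<Longrightarrow> \<Gamma> p \<in> Lambda3_27 (g p) e (\<omega> p)"
  using type by (simp add: G2_type_1_7_27_def)

lemma cov_lc_\<omega>: "cov_form A Dg \<omega> p x [u, v, w] =
  1/2 * (\<omega> p [\<tau> p x u, v, w] + \<omega> p [u, \<tau> p x v, w] + \<omega> p [u, v, \<tau> p x w])"
proof -
  have l: "\<omega> p [x, u - (1/2) *\<^sub>R v, z] = \<omega> p [x, u, z] - 1/2 * \<omega> p [x, v, z]"
    "\<omega> p [u - (1/2) *\<^sub>R v, x, z] = \<omega> p [u, x, z] - 1/2 * \<omega> p [v, x, z]"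
    "\<omega> p [x, z, u - (1/2) *\<^sub>R v] = \<omega> p [x, z, u] - 1/2 * \<omega> p [x, z, v]" for x z u v
    by (simp_all add: linear_diff[OF form3_linear(1)[OF \<omega>_form]] linear_diff[OF form3_linear(2)[OF \<omega>_form]]
        linear_diff[OF form3_linear(3)[OF \<omega>_form]] linear_scale[OF form3_linear(1)[OF \<omega>_form]]
        linear_scale[OF form3_linear(2)[OF \<omega>_form]] linear_scale[OF form3_linear(3)[OF \<omega>_form]])
  have "cov_form A Dg \<omega> p x [u, v, w] = cov_form A D \<omega> p x [u, v, w] +
    1/2 * (\<omega> p [\<tau> p x u, v, w] + \<omega> p [u, \<tau> p x v, w] + \<omega> p [u, v, \<tau> p x w])"
    by (simp add: cov_form_def lessThan_Suc eval_nat_numeral flip: chr_def lc.chr_def)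
      (simp add: lc_chr l)
  then show ?thesis by (simp add: parallel)
qed

text \<open>The inner product of two-forms is half of a full double sum, and the two terms of the
  wedge product with \<beta> agree by skewness of \<phi>; so both parts end up with the factor
  1/4.\<close>

lemma intrinsic_two_form:
  assumes e: "adapted_frame (g p) (\<omega> p) e" and i: "i \<in> {1..7}" and l: "l \<in> {1..7}"
  shows "form_inner 2 e (\<lambda>us. 1/4 * wedge 1 (flat (g p) (\<beta> p)) (flat (g p) (e i)) us + 1/2 * contract (e i) (\<Gamma> p) us)
      (contract (e l) (\<omega> p)) =
    1/4 * (\<Sum>u=1..7. g p (\<beta> p) (e u) * phc u i l)
    + 1/4 * (\<Sum>u=1..7. \<Sum>v=1..7. \<Gamma> p [e i, e u, e v] * phc u v l)"
proof -
  let ?b = "\<lambda>u. g p (\<beta> p) (e u)"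
  note on = adapted_on_frame[OF e]
  note \<omega>s = form3_symmetric[OF \<omega>_form] and \<Gamma>s = form3_symmetric[OF \<Gamma>_form]
  define f where "f = (\<lambda>u v. (1/4 * (?b u * g p (e i) (e v) - ?b v * g p (e i) (e u)) + 1/2 * \<Gamma> p [e i, e u, e v]) * \<omega> p [e l, e u, e v])"
  have sym: "f u v = f v u" for u v
    using \<omega>s(2)[of p "e l" "e u" "e v"] \<Gamma>s(2)[of p "e i" "e u" "e v"] by (simp add: f_def algebra_simps)
  have diag: "f u u = 0" for u using \<omega>s(2)[of p "e l" "e u" "e u"] by (simp add: f_def)
  have cyc: "phc l u v = phc u v l" if "u \<in> {1..7}" "v \<in> {1..7}" for u v
    using phc_cyclic[OF l that] by simp
  have "form_inner 2 e (\<lambda>us. 1/4 * wedge 1 (flat (g p) (\<beta> p)) (flat (g p) (e i)) us + 1/2 * contract (e i) (\<Gamma> p) us)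
      (contract (e l) (\<omega> p)) = (\<Sum>u=1..7. \<Sum>v\<in>{u<..7}. f u v)"
    by (simp add: form_inner_def sum_incr2 wedge_flat contract_def f_def)
  also have "\<dots> = 1/2 * (\<Sum>u=1..7. \<Sum>v=1..7. f u v)"
    by (simp add: sum_symmetric2[OF sym diag])
  also have "(\<Sum>u=1..7. \<Sum>v=1..7. f u v) = (\<Sum>u=1..7. \<Sum>v=1..7.
      (if v = i then 1/4 * ?b u * phc u i l else 0) + (if u = i then 1/4 * ?b v * phc v i l else 0)
      + 1/2 * (\<Gamma> p [e i, e u, e v] * phc u v l))"
  proof (intro sum.cong refl)
    fix u v :: nat assume uv: "u \<in> {1..7}" "v \<in> {1..7}"
    have "phc i v l = - phc v i l" using phc_antisym(1)[OF i uv(2) l] .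
    then show "f u v = (if v = i then 1/4 * ?b u * phc u i l else 0) + (if u = i then 1/4 * ?b v * phc v i l else 0)
      + 1/2 * (\<Gamma> p [e i, e u, e v] * phc u v l)"
      unfolding f_def \<omega>_components[OF e l uv] cyc[OF uv] on_frame_orth[OF on i uv(1)] on_frame_orth[OF on i uv(2)]
      by (cases "v = i"; cases "u = i") (auto simp: algebra_simps)
  qed
  also have "\<dots> = 1/2 * (\<Sum>u=1..7. ?b u * phc u i l) + 1/2 * (\<Sum>u=1..7. \<Sum>v=1..7. \<Gamma> p [e i, e u, e v] * phc u v l)"
  proof -
    have 1: "(\<Sum>u=1..7. \<Sum>v=1..7. if v = i then 1/4 * ?b u * phc u i l else 0) = 1/4 * (\<Sum>u=1..7. ?b u * phc u i l)"
      using i by (simp add: sum_distrib_left)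
    have 2: "(\<Sum>u=1..7. \<Sum>v=1..7. if u = i then 1/4 * ?b v * phc v i l else 0) = 1/4 * (\<Sum>u=1..7. ?b u * phc u i l)"
      using i by (subst sum.swap) (simp add: sum_distrib_left)
    show ?thesis unfolding sum.distrib 1 2 by (simp add: sum_distrib_left mult.commute)
  qed
  finally show ?thesis by simp
qed

text \<open>The two expressions for the Levi-Civita derivative of \<omega> are compared at the
  triple from \<open>two_form_action\<close>, where every sum over contractions collapses to the
  index \<open>l\<close>. In the result the terms with \<open>lam\<close> and \<open>\<beta>\<close>
  are those of S multiplied by 6 and 4, the values of the contractions with \<phi>.\<close>

lemma torsion_components:
  assumes e: "adapted_frame (g p) (\<omega> p) e" and i: "i \<in> {1..7}" and l: "l \<in> {1..7}"
  shows "(\<Sum>u=1..7. \<Sum>v=1..7. T p [e i, e u, e v] * phc u v l) + (\<Sum>u=1..7. \<Sum>v=1..7. \<Gamma> p [e i, e u, e v] * phc u v l)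
    + (\<Sum>u=1..7. g p (\<beta> p) (e u) * phc u i l) + (if i = l then lam p else 0) = 0"
proof -
  note on = adapted_on_frame[OF e]
  let ?F = "\<lambda>u v. T p [e i, e u, e v]"
  have F: "?F u v = - ?F v u" for u v by (rule T_antisym(2))
  obtain j k m s where jkm: "j \<in> {1..7}" "k \<in> {1..7}" "m \<in> {1..7}" and s: "s \<noteq> 0"
    and psc: "\<And>n. n \<in> {1..7} \<Longrightarrow> psc n j k m = (if n = l then s else 0)"
    and act: "(\<Sum>n=1..7. ?F j n * phc n k m + ?F k n * phc j n m + ?F m n * phc j k n)
      = 1/2 * (\<Sum>u=1..7. \<Sum>v=1..7. ?F u v * phc u v l) * s"
    by (rule two_form_action[of ?F l, OF F l]) (rule that; blast)
  let ?Y = "\<lambda>n. 1/4 * (\<Sum>u=1..7. g p (\<beta> p) (e u) * phc u i n) + 1/4 * (\<Sum>u=1..7. \<Sum>v=1..7. \<Gamma> p [e i, e u, e v] * phc u v n)"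
  have hodge: "hodge (g p) e 3 (\<omega> p) [e n, e j, e k, e m] = (if n = l then s else 0)" if "n \<in> {1..7}" for n
    using hodge_components[OF ip on \<omega>_components[OF e] that jkm] psc[OF that] by simp
  have "cov_form A Dg \<omega> p (e i) [e j, e k, e m] = 1/2 * (\<Sum>n=1..7. ?F j n * phc n k m + ?F k n * phc j n m + ?F m n * phc j k n)"
    unfolding cov_lc_\<omega> \<omega>_expand(1)[OF e jkm(2,3)] \<omega>_expand(2)[OF e jkm(1,3)] \<omega>_expand(3)[OF e jkm(1,2)]
    by (simp add: g_\<tau> sum.distrib)
  moreover have "cov_form A Dg \<omega> p (e i) [e j, e k, e m] = - (lam p / 4) * contract (e i) (hodge (g p) e 3 (\<omega> p)) [e j, e k, e m]
     - (\<Sum>n=1..7. form_inner 2 e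
           (\<lambda>us. 1/4 * wedge 1 (flat (g p) (\<beta> p)) (flat (g p) (e i)) us + 1/2 * contract (e i) (\<Gamma> p) us)
           (contract (e n) (\<omega> p)) * contract (e n) (hodge (g p) e 3 (\<omega> p)) [e j, e k, e m])"
    using type on by (simp add: G2_type_1_7_27_def)
  moreover have "(\<Sum>n=1..7. form_inner 2 e
           (\<lambda>us. 1/4 * wedge 1 (flat (g p) (\<beta> p)) (flat (g p) (e i)) us + 1/2 * contract (e i) (\<Gamma> p) us)
           (contract (e n) (\<omega> p)) * contract (e n) (hodge (g p) e 3 (\<omega> p)) [e j, e k, e m]) = ?Y l * s"
  proof -
    have "(\<Sum>n=1..7. form_inner 2 e
           (\<lambda>us. 1/4 * wedge 1 (flat (g p) (\<beta> p)) (flat (g p) (e i)) us + 1/2 * contract (e i) (\<Gamma> p) us)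
           (contract (e n) (\<omega> p)) * contract (e n) (hodge (g p) e 3 (\<omega> p)) [e j, e k, e m])
      = (\<Sum>n=1..7. if n = l then ?Y n * s else 0)"
    proof (intro sum.cong refl)
      fix n :: nat assume n: "n \<in> {1..7}"
      show "form_inner 2 e
           (\<lambda>us. 1/4 * wedge 1 (flat (g p) (\<beta> p)) (flat (g p) (e i)) us + 1/2 * contract (e i) (\<Gamma> p) us)
           (contract (e n) (\<omega> p)) * contract (e n) (hodge (g p) e 3 (\<omega> p)) [e j, e k, e m] = (if n = l then ?Y n * s else 0)"
        unfolding intrinsic_two_form[OF e i n] contract_def[of "e n" "hodge _ _ _ _"] hodge[OF n] by simp
    qed
    then show ?thesis using l by simp
  qed
  ultimately have "1/4 * (\<Sum>u=1..7. \<Sum>v=1..7. ?F u v * phc u v l) * s = (- (if i = l then lam p / 4 else 0) - ?Y l) * s"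
    unfolding act contract_def[of "e i" "hodge _ _ _ _"] hodge[OF i]
    by (cases "i = l") (simp_all add: algebra_simps)
  then have "1/4 * (\<Sum>u=1..7. \<Sum>v=1..7. ?F u v * phc u v l) = - (if i = l then lam p / 4 else 0) - ?Y l"
    using s by (simp only: mult_cancel_right) simp
  then show ?thesis by (simp split: if_splits)
qed

text \<open>The coefficient 7/6 is - 1/6 times the eigenvalue -7 of \<omega>.\<close>

lemma torsion_clifford:
  assumes \<psi>: "pure \<psi>" and e: "adapted_frame (g p) (\<omega> p) e"
  shows "cliff_form c 3 e (T p) \<psi> =
    (7/6 * lam p) *\<^sub>R \<psi> - (1/4) *\<^sub>R cliff_form c 3 e (contract (\<beta> p) (hodge (g p) e 3 (\<omega> p))) \<psi>"
proof -
  note on = adapted_on_frame[OF e]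
  let ?H = "contract (\<beta> p) (hodge (g p) e 3 (\<omega> p))"
  \<comment> \<open>Written as nested combinations of two terms, the shape to which
    \<open>form_lincomb\<close> and \<open>cliff_form_lincomb\<close> apply.\<close>
  define S where "S = (\<lambda>vs. 1 * (1 * T p vs + (lam p / 6) * \<omega> p vs) + 1 * (1 * \<Gamma> p vs + (1/4) * ?H vs))"
  have S_form: "is_form 3 S"
    unfolding S_def by (intro form_lincomb skew \<omega>_form \<Gamma>_form hodge_contract_form[OF on])
  have H: "?H [e i, e j, e k] = (\<Sum>u=1..7. g p (\<beta> p) (e u) * psc u i j k)"
    if "i \<in> {1..7}" "j \<in> {1..7}" "k \<in> {1..7}" for i j k
  proof -
    have l: "linear (\<lambda>x. hodge (g p) e 3 (\<omega> p) [x, e i, e j, e k])"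
      using form_linear[OF hodge_form[OF ip on], of "[]" "[e i, e j, e k]"] by simp
    have "?H [e i, e j, e k] = (\<Sum>u=1..7. g p (\<beta> p) (e u) * hodge (g p) e 3 (\<omega> p) [e u, e i, e j, e k])"
      unfolding contract_def
      by (subst frame_sum[OF on, of "\<beta> p"]) (simp add: linear_sum[OF l] linear_scale[OF l])
    also have "\<dots> = (\<Sum>u=1..7. g p (\<beta> p) (e u) * psc u i j k)"
      by (intro sum.cong refl arg_cong2[of _ _ _ _ "(*)"] hodge_components[OF ip on \<omega>_components[OF e] _ that])
    finally show ?thesis .
  qed
  have "0 = (\<Sum>j=1..7. \<Sum>k=1..7. S [e i, e j, e k] * phc j k l)" if i: "i \<in> {1..7}" and l: "l \<in> {1..7}" for i l
  proof -
    have "(\<Sum>j=1..7. \<Sum>k=1..7. S [e i, e j, e k] * phc j k l) = (\<Sum>j=1..7. \<Sum>k=1..7. T p [e i, e j, e k] * phc j k l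
        + lam p / 6 * (phc i j k * phc l j k) + \<Gamma> p [e i, e j, e k] * phc j k l
        + 1/4 * (\<Sum>u=1..7. g p (\<beta> p) (e u) * (psc u i j k * phc j k l)))"
    proof (intro sum.cong refl)
      fix j k :: nat assume jk: "j \<in> {1..7}" "k \<in> {1..7}"
      have "phc j k l = phc l j k" by (rule phc_cyclic[OF l jk])
      then show "S [e i, e j, e k] * phc j k l = T p [e i, e j, e k] * phc j k l
        + lam p / 6 * (phc i j k * phc l j k) + \<Gamma> p [e i, e j, e k] * phc j k l
        + 1/4 * (\<Sum>u=1..7. g p (\<beta> p) (e u) * (psc u i j k * phc j k l))"
        unfolding S_def H[OF i jk] \<omega>_components[OF e i jk] by (simp add: algebra_simps sum_distrib_left)
    qed
    also have "\<dots> = (\<Sum>j=1..7. \<Sum>k=1..7. T p [e i, e j, e k] * phc j k l)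
        + lam p / 6 * (\<Sum>j=1..7. \<Sum>k=1..7. phc i j k * phc l j k) + (\<Sum>j=1..7. \<Sum>k=1..7. \<Gamma> p [e i, e j, e k] * phc j k l)
        + 1/4 * (\<Sum>j=1..7. \<Sum>k=1..7. \<Sum>u=1..7. g p (\<beta> p) (e u) * (psc u i j k * phc j k l))"
      unfolding sum.distrib by (simp only: sum_distrib_left)
    also have "(\<Sum>j=1..7. \<Sum>k=1..7. \<Sum>u=1..7. g p (\<beta> p) (e u) * (psc u i j k * phc j k l))
      = (\<Sum>u=1..7. g p (\<beta> p) (e u) * (4 * phc u i l))"
    proof -
      have "(\<Sum>j=1..7. \<Sum>k=1..7. \<Sum>u=1..7. g p (\<beta> p) (e u) * (psc u i j k * phc j k l))
        = (\<Sum>j=1..7. \<Sum>u=1..7. \<Sum>k=1..7. g p (\<beta> p) (e u) * (psc u i j k * phc j k l))" by (rule sum.cong[OF refl sum.swap])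
      also have "\<dots> = (\<Sum>u=1..7. \<Sum>j=1..7. \<Sum>k=1..7. g p (\<beta> p) (e u) * (psc u i j k * phc j k l))" by (rule sum.swap)
      also have "\<dots> = (\<Sum>u=1..7. g p (\<beta> p) (e u) * (\<Sum>j=1..7. \<Sum>k=1..7. psc u i j k * phc j k l))"
        by (simp only: sum_distrib_left)
      also have "\<dots> = (\<Sum>u=1..7. g p (\<beta> p) (e u) * (4 * phc u i l))"
        by (intro sum.cong refl) (simp only: psc_phc[OF _ i l])
      finally show ?thesis .
    qed
    also have "1/4 * (\<Sum>u=1..7. g p (\<beta> p) (e u) * (4 * phc u i l)) = (\<Sum>u=1..7. g p (\<beta> p) (e u) * phc u i l)"
      by (simp add: sum_distrib_left)
    also have "lam p / 6 * (\<Sum>j=1..7. \<Sum>k=1..7. phc i j k * phc l j k) = (if i = l then lam p else 0)"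
      unfolding phc_phc[OF i l] by simp
    finally show ?thesis using torsion_components[OF e i l] by simp
  qed
  from cliff_form_pure[where b = "\<lambda>i l. 0", OF S_form \<psi> this]
  have "cliff_form c 3 e S \<psi> = 0" by simp
  then have "cliff_form c 3 e (T p) \<psi> + (lam p / 6) *\<^sub>R cliff_form c 3 e (\<omega> p) \<psi>
    + cliff_form c 3 e (\<Gamma> p) \<psi> + (1/4) *\<^sub>R cliff_form c 3 e ?H \<psi> = 0"
    unfolding S_def cliff_form_lincomb by (simp add: add.assoc)
  moreover have "cliff_form c 3 e (\<omega> p) \<psi> = - 7 *\<^sub>R \<psi>"
    by (rule cliff_phi[OF \<omega>_form \<psi> \<omega>_components[OF e]])
  moreover have "cliff_form c 3 e (\<Gamma> p) \<psi> = 0"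
    by (rule cliff_Lambda27[OF \<psi> ip on \<omega>_components[OF e] \<Gamma>_27[OF on]])
  ultimately have "cliff_form c 3 e (T p) \<psi> - ((7/6 * lam p) *\<^sub>R \<psi> - (1/4) *\<^sub>R cliff_form c 3 e ?H \<psi>) = 0"
    by (simp add: algebra_simps)
  then show ?thesis by (rule eq_iff_diff_eq_0[THEN iffD2])
qed

lemma spin_cov_parallel:
  assumes \<psi>: "pure \<psi>" and e: "local_adapted_frame A g \<omega> U e" and p: "p \<in> U"
  shows "spin_cov A g c D e (\<lambda>p e. \<psi>) p v = 0"
  using pure_g2[OF \<psi> frame_connection[OF e p, of v]]
  by (simp add: spin_cov_def dir_deriv_eq[OF has_mderiv_const] C_def)

text \<open>3/4 = 6/8: the spin connection, the difference of the two connections and the passage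
  from \<open>i < j\<close> to a full double sum contribute 1/2 each, and the full triple sum is 6
  times the Clifford action.\<close>

lemma dirac_torsion:
  assumes \<psi>: "pure \<psi>" and e: "local_adapted_frame A g \<omega> U e" and p: "p \<in> U"
  shows "dirac A g c Dg e (\<lambda>p e. \<psi>) p = - (3/4) *\<^sub>R cliff_form c 3 (e p) (T p) \<psi>"
proof -
  note U = e[unfolded local_adapted_frame_def]
  let ?T = "\<lambda>a i j. T p [e p a, e p i, e p j]"
  have cov: "spin_cov A g c Dg e (\<lambda>p e. \<psi>) p (e p a) = - (1/8) *\<^sub>R (\<Sum>i=1..7. \<Sum>j=1..7. ?T a i j *\<^sub>R C i (C j \<psi>))" for a
  proof -
    have d: "g p (Dg p v (\<lambda>q. e q i)) (e p j) = g p (D p v (\<lambda>q. e q i)) (e p j) - 1/2 * T p [v, e p i, e p j]"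
      if "i \<in> {1..7}" for v i j
      using lc_conn[of U p "\<lambda>q. e q i" v] U p that by (simp add: g_simps g_\<tau>)
    have "(\<Sum>i=1..7. \<Sum>j\<in>{i<..7}. g p (Dg p (e p a) (\<lambda>q. e q i)) (e p j) *\<^sub>R C i (C j \<psi>))
      = (\<Sum>i=1..7. \<Sum>j\<in>{i<..7}. g p (D p (e p a) (\<lambda>q. e q i)) (e p j) *\<^sub>R C i (C j \<psi>) - (1/2) *\<^sub>R (?T a i j *\<^sub>R C i (C j \<psi>)))"
      by (intro sum.cong refl) (simp add: d scaleR_left_diff_distrib)
    also have "\<dots> = 0 - (1/2) *\<^sub>R (\<Sum>i=1..7. \<Sum>j\<in>{i<..7}. ?T a i j *\<^sub>R C i (C j \<psi>))"
      unfolding sum_subtractf pure_g2[OF \<psi> frame_connection[OF e p]] by (simp only: scaleR_sum_right)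
    also have "(\<Sum>i=1..7. \<Sum>j\<in>{i<..7}. ?T a i j *\<^sub>R C i (C j \<psi>)) = (1/2) *\<^sub>R (\<Sum>i=1..7. \<Sum>j=1..7. ?T a i j *\<^sub>R C i (C j \<psi>))"
      by (rule pure_sum_less) (rule T_antisym(2))
    finally show ?thesis
      by (simp add: spin_cov_def dir_deriv_eq[OF has_mderiv_const] flip: C_def)
  qed
  have "dirac A g c Dg e (\<lambda>p e. \<psi>) p = (\<Sum>a=1..7. C a (- (1/8) *\<^sub>R (\<Sum>i=1..7. \<Sum>j=1..7. ?T a i j *\<^sub>R C i (C j \<psi>))))"
    by (simp add: dirac_def cov flip: C_def)
  also have "\<dots> = - (1/8) *\<^sub>R (\<Sum>a=1..7. \<Sum>i=1..7. \<Sum>j=1..7. ?T a i j *\<^sub>R C a (C i (C j \<psi>)))"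
    by (simp only: C_simps scaleR_sum_right)
  also have "\<dots> = - (3/4) *\<^sub>R cliff_form c 3 (e p) (T p) \<psi>"
    by (simp add: cliff_form_full[OF skew])
  finally show ?thesis .
qed

end


theorem theorem5p1:
  fixes A :: "('m::{t2_space, second_countable_topology}, 7) chart set"
    and g :: "'m \<Rightarrow> real^7 \<Rightarrow> real^7 \<Rightarrow> real"
    and \<omega> \<Gamma> T :: "'m \<Rightarrow> (real^7) form"
    and Dg D :: "('m, 7) cov_deriv"
    and lam :: "'m \<Rightarrow> real" and \<beta> :: "'m \<Rightarrow> real^7"
    and c :: "nat \<Rightarrow> real^8^8"
  assumes "oriented_manifold A" and "riemannian_metric A g"
    and "G2_structure A g \<omega>"
    and "levi_civita A g Dg"
    and "G2_type_1_7_27 A g \<omega> Dg lam \<beta> \<Gamma>"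
    and "affine_connection A D"
    and "\<And>p v vs. length vs = 3 \<Longrightarrow> cov_form A D \<omega> p v vs = 0"
    and T_def: "T = torsion_form A g D"
    and "\<And>p. is_form 3 (T p)"
    and "spin_rep c"
  shows
    "(\<forall>p e. on_frame (g p) e \<longrightarrow>
       (\<forall>X. ricci_endo A g D p e X =
          (1/2) *\<^sub>R (\<Sum>i=1..7. form_inner 3 e
             (\<lambda>vs. contract X (ext_deriv A T p) vs + 2 * cov_form A D T p X vs)
             (contract (e i) (hodge (g p) e 3 (\<omega> p))) *\<^sub>R e i)) \<and>
       (\<forall>i\<in>{1..7}. \<forall>j\<in>{1..7}.
          ricci A g Dg p e (e i) (e j)
          - 1/4 * (\<Sum>m=1..7. \<Sum>n=1..7. T p [e i, e m, e n] * T p [e j, e m, e n])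
          - 1/2 * form_inner 3 e
              (\<lambda>vs. contract (e i) (ext_deriv A T p) vs + 2 * cov_form A D T p (e i) vs)
              (contract (e j) (hodge (g p) e 3 (\<omega> p)))
          - 1/2 * codiff A Dg T p e [e i, e j] = 0) \<and>
       (\<forall>X. form_inner 3 e (contract X (ext_deriv A T p)) (\<omega> p)
            = - 2 * form_inner 3 e (cov_form A D T p X) (\<omega> p))) \<and>
     (\<exists>\<Psi>. spinor_field A g \<omega> c \<Psi> \<and>
       (\<forall>p e. adapted_frame (g p) (\<omega> p) e \<longrightarrow>
          \<Psi> p e \<noteq> 0 \<and> cliff_form c 3 e (\<omega> p) (\<Psi> p e) = - 7 *\<^sub>R \<Psi> p e) \<and>
       (\<forall>U e. local_adapted_frame A g \<omega> U e \<longrightarrow> (\<forall>p\<in>U.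
          (\<forall>v. spin_cov A g c D e \<Psi> p v = 0) \<and>
          dirac A g c Dg e \<Psi> p = - (3/4) *\<^sub>R cliff_form c 3 (e p) (T p) (\<Psi> p (e p)) \<and>
          - (3/4) *\<^sub>R cliff_form c 3 (e p) (T p) (\<Psi> p (e p)) =
            - (7/8 * lam p) *\<^sub>R \<Psi> p (e p)
            + (3/16) *\<^sub>R cliff_form c 3 (e p) (contract (\<beta> p) (hodge (g p) (e p) 3 (\<omega> p)))
                (\<Psi> p (e p)))))"
proof -
  interpret G: g2_type A D g \<omega> Dg c lam \<beta> \<Gamma>
    using assms by unfold_locales simp_all
  obtain \<psi> where \<psi>: "G.pure \<psi>" "\<psi> \<noteq> 0" using G.ex_pure by blast
  show ?thesis
  proof (intro conjI allI impI ballI exI[of _ "\<lambda>p e. \<psi>"])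
    fix p e assume on: "on_frame (g p) e"
    show "ricci_endo A g D p e X =
          (1/2) *\<^sub>R (\<Sum>i=1..7. form_inner 3 e
             (\<lambda>vs. contract X (ext_deriv A T p) vs + 2 * cov_form A D T p X vs)
             (contract (e i) (hodge (g p) e 3 (\<omega> p))) *\<^sub>R e i)" for X
      by (simp add: ricci_endo_def G.ricci_torsion[OF on] G.\<theta>_def T_def scaleR_sum_right)
    show "ricci A g Dg p e (e i) (e j)
          - 1/4 * (\<Sum>m=1..7. \<Sum>n=1..7. T p [e i, e m, e n] * T p [e j, e m, e n])
          - 1/2 * form_inner 3 e
              (\<lambda>vs. contract (e i) (ext_deriv A T p) vs + 2 * cov_form A D T p (e i) vs)
              (contract (e j) (hodge (g p) e 3 (\<omega> p)))
          - 1/2 * codiff A Dg T p e [e i, e j] = 0" for i j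
      \<comment> \<open>The Ricci tensor of \<nabla> is eliminated between its expression through
        the torsion and its comparison with the Riemannian one.\<close>
      using G.ricci_levi_civita[OF on, of "e i" "e j"] G.ricci_torsion[OF on, of "e i" "e j"]
      unfolding G.\<theta>_def T_def by linarith
    show "form_inner 3 e (contract X (ext_deriv A T p)) (\<omega> p)
            = - 2 * form_inner 3 e (cov_form A D T p X) (\<omega> p)" for X
      unfolding T_def by (rule G.torsion_phi[OF on])
  next
    \<comment> \<open>For a field constant in all adapted frames, equivariance says that the lift of
      the stabiliser fixes the spinor.\<close>
    show "spinor_field A g \<omega> c (\<lambda>p e. \<psi>)"
      by (simp add: spinor_field_def G.G2_lift_fixes[OF \<psi>] local_adapted_frame_def G.smooth_fun_const)
  next
    fix p e assume e: "adapted_frame (g p) (\<omega> p) e"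
    show "\<psi> \<noteq> 0" by (rule \<psi>(2))
    show "cliff_form c 3 e (\<omega> p) \<psi> = - 7 *\<^sub>R \<psi>"
      by (rule G.cliff_phi[OF G.\<omega>_form \<psi>(1) G.\<omega>_components[OF e]])
  next
    fix U e p assume e: "local_adapted_frame A g \<omega> U e" and p: "p \<in> U"
    then have ep: "adapted_frame (g p) (\<omega> p) (e p)" by (simp add: local_adapted_frame_def)
    show "spin_cov A g c D e (\<lambda>p e. \<psi>) p v = 0" for v
      by (rule G.spin_cov_parallel[OF \<psi>(1) e p])
    show "dirac A g c Dg e (\<lambda>p e. \<psi>) p = - (3/4) *\<^sub>R cliff_form c 3 (e p) (T p) \<psi>"
      unfolding T_def by (rule G.dirac_torsion[OF \<psi>(1) e p])
    show "- (3/4) *\<^sub>R cliff_form c 3 (e p) (T p) \<psi> = - (7/8 * lam p) *\<^sub>R \<psi>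
            + (3/16) *\<^sub>R cliff_form c 3 (e p) (contract (\<beta> p) (hodge (g p) (e p) 3 (\<omega> p))) \<psi>"
      unfolding T_def G.torsion_clifford[OF \<psi>(1) ep] by (simp add: scaleR_diff_right)
  qed
qed


end
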